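(* Let $V$ be a complex vector space of finite dimension $n\ge1$ with a fixed Hermitian inner product. Then $\mathbb{P}M_H$ is open in $\mathbb{P}M$, and the map $$\overline{\lambda}:\mathbb{P}M_H\to\prod_{k=1}^{n-1}\mathbb{P}\mathrm{End}\Big(\bigwedge^kV\Big),\qquad \mathbb{P}\mathcal{A}\mapsto\Big(\overline{\bigwedge^1\mathcal{A}},\overline{\bigwedge^2\mathcal{A}},\ldots,\overline{\bigwedge^{n-1}\mathcal{A}}\Big)$$ is continuous.
   Context: Overlines denote classes in projective spaces, which carry the classical topology. $M$ is the set of all finite sequences $\mathcal{A}=(A_0,\ldots,A_m)$, $m\ge0$, such that $V_0=V$, each $A_i\in\mathrm{Hom}(V_i,V)$ is nonzero, $V_{i+1}=\mathrm{Ker}(A_i)$ for $0\le i\le m$, and $V_{m+1}=0$. Write $V(\mathcal{A})_i:=V_i$, $\mathbb{P}\mathcal{A}:=(\overline{A_0},\ldots,\overline{A_m})$, $\mathbb{P}M:=\{\mathbb{P}\mathcal{A}\mid\mathcal{A}\in M\}$. Topology on $\mathbb{P}M$: for $\mathcal{A}=(A_0,\ldots,A_m)\in M$ and open neighborhoods $U_i$ of $\overline{A_i}$ in $\mathbb{P}\mathrm{Hom}(V(\mathcal{A})_i,V)$ $(0\le i\le m)$, let $U_{\mathbb{P}\mathcal{A}}(U_0,\ldots,U_m)$ be the set of $\mathbb{P}\mathcal{B}\in\mathbb{P}M$, $\mathcal{B}=(B_0,B_1,\ldots)$, such that for every $i$ there exists $j$ with $V(\mathcal{B})_j\supseteq V(\mathcal{A})_i$,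 $B_j|_{V(\mathcal{A})_i}\neq0$ and $\overline{B_j|_{V(\mathcal{A})_i}}\in U_i$. These sets form a base of neighborhoods of $\mathbb{P}\mathcal{A}$ and define the topology. $M_H:=\{\mathcal{A}\in M\mid\bigoplus_{i=0}^m\mathrm{Im}(A_i)=V\}$ (equivalently $\sum_i\mathrm{Im}(A_i)=V$), and $\mathbb{P}M_H$ is its image in $\mathbb{P}M$. For $\mathcal{A}\in M$ let $V(\mathcal{A})'_i$ be the orthogonal complement of $V(\mathcal{A})_{i+1}$ in $V(\mathcal{A})_i$, so $V=\bigoplus_{i=0}^mV(\mathcal{A})'_i$; let $r_i:=\dim V(\mathcal{A})'_i=\mathrm{rank}(A_i)$. For $1\le k\le n$, choose $j$ with $r_0+\cdots+r_{j-1}<k\le r_0+\cdots+r_j$. Then $\bigwedge^k\mathcal{A}\in\mathrm{End}(\bigwedge^kV)$ is the endomorphism which agrees with $\bigwedge^k\big(A_0|_{V(\mathcal{A})'_0}\oplus\cdots\oplus A_m|_{V(\mathcal{A})'_m}\big)$ on the direct summand $$\bigwedge^{r_0}V(\mathcal{A})'_0\otimes\bigwedge^{r_1}V(\mathcal{A})'_1\otimes\cdots\otimes\bigwedge^{k-(r_0+\cdots+r_{j-1})}V(\mathcal{A})'_j$$ of $\bigwedge^kV$ and is zero on the other summands of the decomposition of $\bigwedge^kV$ induced by $V=\bigoplus_iV(\mathcal{A})'_i$. If $\mathcal{A}\in M_H$ then $\bigwedge^k\mathcal{A}\ne0$ for all $k$, and its class depends only on $\mathbb{P}\mathcal{A}$,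 so $\overline\lambda$ is defined. *)

theory Defs
  imports "HOL-Analysis.Analysis" "HOL-Library.Function_Algebras"
begin

section \<open>Complex vector spaces and Hermitian spaces\<close>

class complex_vector = ab_group_add +
  fixes scaleC :: "complex \<Rightarrow> 'a \<Rightarrow> 'a"  (infixr "*\<^sub>C" 75)
  assumes scaleC_add_right: "a *\<^sub>C (x + y) = a *\<^sub>C x + a *\<^sub>C y"
    and scaleC_add_left: "(a + b) *\<^sub>C x = a *\<^sub>C x + b *\<^sub>C x"
    and scaleC_scaleC: "a *\<^sub>C (b *\<^sub>C x) = (a * b) *\<^sub>C x"
    and scaleC_one: "1 *\<^sub>C x = x"

global_interpretation complex_vector:
  vector_space "scaleC :: complex \<Rightarrow> 'a \<Rightarrow> 'a :: complex_vector"
  defines csubspace = complex_vector.subspace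
    and cspan = complex_vector.span
    and cdim = complex_vector.dim
  by standard (rule scaleC_add_right scaleC_add_left scaleC_scaleC scaleC_one)+

text \<open>
  A type of the following class is a nonzero finite-dimensional complex vector space with a
  Hermitian inner product \<open>cinner\<close>, linear in the first argument. Finite-dimensionality
  and the norm topology come from the underlying Euclidean space, whose inner product is the real
  part of \<open>cinner\<close>; positive definiteness of \<open>cinner\<close> follows.
\<close>

class hermitian_space = complex_vector + euclidean_space +
  fixes cinner :: "'a \<Rightarrow> 'a \<Rightarrow> complex"
  assumes scaleR_scaleC: "r *\<^sub>R x = complex_of_real r *\<^sub>C x"
    and cinner_commute: "cinner x y = cnj (cinner y x)"
    and cinner_add_left: "cinner (x + y) z = cinner x z + cinner y z"
    and cinner_scaleC_left: "cinner (a *\<^sub>C x) y = a * cinner x y"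
    and inner_cinner: "inner x y = Re (cinner x y)"

instantiation complex :: hermitian_space
begin

definition scaleC_complex :: "complex \<Rightarrow> complex \<Rightarrow> complex"
  where "scaleC_complex a x = a * x"

definition cinner_complex :: "complex \<Rightarrow> complex \<Rightarrow> complex"
  where "cinner_complex x y = x * cnj y"

instance
  by standard (auto simp: scaleC_complex_def cinner_complex_def algebra_simps
      scaleR_conv_of_real inner_complex_def)

end

instantiation vec :: (complex_vector, finite) complex_vector
begin

definition scaleC_vec :: "complex \<Rightarrow> 'a ^ 'b \<Rightarrow> 'a ^ 'b"
  where "scaleC_vec a x = (\<chi> i. a *\<^sub>C (x $ i))"

instance
  by standard (auto simp: scaleC_vec_def vec_eq_iff scaleC_add_right scaleC_add_left
      scaleC_scaleC scaleC_one)

end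

instantiation vec :: (hermitian_space, finite) hermitian_space
begin

definition cinner_vec :: "'a ^ 'b \<Rightarrow> 'a ^ 'b \<Rightarrow> complex"
  where "cinner_vec x y = (\<Sum>i\<in>UNIV. cinner (x $ i) (y $ i))"

instance
proof
  fix x y :: "'a ^ 'b"
  show "cinner x y = cnj (cinner y x)"
    unfolding cinner_vec_def cnj_sum by (rule sum.cong[OF refl]) (rule cinner_commute)
qed (auto simp: scaleC_vec_def cinner_vec_def vec_eq_iff scaleR_scaleC cinner_add_left
      cinner_scaleC_left inner_vec_def inner_cinner sum.distrib sum_distrib_left)

end

instantiation "fun" :: (type, complex_vector) complex_vector
begin

definition scaleC_fun :: "complex \<Rightarrow> ('a \<Rightarrow> 'b) \<Rightarrow> 'a \<Rightarrow> 'b"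
  where "scaleC_fun a f = (\<lambda>x. a *\<^sub>C f x)"

instance
  by standard (auto simp: scaleC_fun_def fun_eq_iff scaleC_add_right scaleC_add_left
      scaleC_scaleC scaleC_one)

end


section \<open>Hom spaces and projective spaces\<close>

text \<open>
  Elements of \<open>Hom(W, X)\<close> are represented by functions on the whole type that vanish
  outside \<open>W\<close>, so that \<open>chom W X\<close> is a subspace of the space of all functions.
  As a subset of the function type it carries the topology of pointwise convergence, which for
  finite-dimensional \<open>W\<close> and \<open>X\<close> is the classical one.
\<close>

definition chom :: "'a::complex_vector set \<Rightarrow> 'b::complex_vector set \<Rightarrow> ('a \<Rightarrow> 'b) set"
  where "chom W X = {f. (\<forall>x\<in>W. f x \<in> X) \<and>
    (\<forall>x\<in>W. \<forall>y\<in>W. f (x + y) = f x + f y) \<and>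
    (\<forall>c. \<forall>x\<in>W. f (c *\<^sub>C x) = c *\<^sub>C f x) \<and>
    (\<forall>x. x \<notin> W \<longrightarrow> f x = 0)}"

definition hom_restrict :: "('a \<Rightarrow> 'b::zero) \<Rightarrow> 'a set \<Rightarrow> 'a \<Rightarrow> 'b"
  where "hom_restrict f W = (\<lambda>x. if x \<in> W then f x else 0)"

definition proj_class :: "'a::complex_vector \<Rightarrow> 'a set"
  where "proj_class x = {c *\<^sub>C x | c. c \<noteq> 0}"

definition proj_space :: "'a::complex_vector set \<Rightarrow> 'a set set"
  where "proj_space S = proj_class ` (S - {0})"

definition proj_topology :: "'a::{complex_vector, topological_space} set \<Rightarrow> 'a set topology"
  where "proj_topology S = topology (\<lambda>U. U \<subseteq> proj_space S \<and>
    openin (top_of_set (S - {0})) {x \<in> S - {0}. proj_class x \<in> U})"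

lemma openin_proj_topology:
  "openin (proj_topology S) U \<longleftrightarrow> U \<subseteq> proj_space S \<and>
    openin (top_of_set (S - {0})) {x \<in> S - {0}. proj_class x \<in> U}"
proof -
  have "istopology (\<lambda>U. U \<subseteq> proj_space S \<and>
    openin (top_of_set (S - {0})) {x \<in> S - {0}. proj_class x \<in> U})"
    unfolding istopology_def
  proof (intro conjI allI impI)
    fix U V
    assume "U \<subseteq> proj_space S \<and> openin (top_of_set (S - {0})) {x \<in> S - {0}. proj_class x \<in> U}"
      and "V \<subseteq> proj_space S \<and> openin (top_of_set (S - {0})) {x \<in> S - {0}. proj_class x \<in> V}"
    then have "openin (top_of_set (S - {0}))
        ({x \<in> S - {0}. proj_class x \<in> U} \<inter> {x \<in> S - {0}. proj_class x \<in> V})"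
      and "U \<inter> V \<subseteq> proj_space S"
      by auto
    moreover have "{x \<in> S - {0}. proj_class x \<in> U} \<inter> {x \<in> S - {0}. proj_class x \<in> V}
        = {x \<in> S - {0}. proj_class x \<in> U \<inter> V}"
      by blast
    ultimately show "openin (top_of_set (S - {0})) {x \<in> S - {0}. proj_class x \<in> U \<inter> V}"
      and "U \<inter> V \<subseteq> proj_space S"
      by simp_all
  next
    fix \<U>
    assume *: "\<forall>U\<in>\<U>. U \<subseteq> proj_space S \<and>
      openin (top_of_set (S - {0})) {x \<in> S - {0}. proj_class x \<in> U}"
    then show "\<Union>\<U> \<subseteq> proj_space S"
      by blast
    have "openin (top_of_set (S - {0})) (\<Union>U\<in>\<U>. {x \<in> S - {0}. proj_class x \<in> U})"
      using * by blast
    moreover have "(\<Union>U\<in>\<U>. {x \<in> S - {0}. proj_class x \<in> U})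
        = {x \<in> S - {0}. proj_class x \<in> \<Union>\<U>}"
      by blast
    ultimately show "openin (top_of_set (S - {0})) {x \<in> S - {0}. proj_class x \<in> \<Union>\<U>}"
      by simp
  qed
  then show ?thesis
    by (simp add: proj_topology_def topology_inverse')
qed

lemma topspace_proj_topology [simp]: "topspace (proj_topology S) = proj_space S"
proof
  show "topspace (proj_topology S) \<subseteq> proj_space S"
    using openin_proj_topology openin_topspace by blast
  have "{x \<in> S - {0}. proj_class x \<in> proj_space S} = S - {0}"
    by (auto simp: proj_space_def)
  then have "openin (proj_topology S) (proj_space S)"
    by (simp add: openin_proj_topology)
  then show "proj_space S \<subseteq> topspace (proj_topology S)"
    by (rule openin_subset)
qed

lemma quotient_map_proj_class:
  "quotient_map (top_of_set (S - {0})) (proj_topology S) proj_class"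
  unfolding quotient_map_def
proof (intro conjI allI impI)
  show "proj_class ` topspace (top_of_set (S - {0})) = topspace (proj_topology S)"
    by (simp add: proj_space_def)
  fix U
  assume "U \<subseteq> topspace (proj_topology S)"
  then show "openin (top_of_set (S - {0}))
      {x \<in> topspace (top_of_set (S - {0})). proj_class x \<in> U} = openin (proj_topology S) U"
    by (simp add: openin_proj_topology)
qed


section \<open>The spaces of sequences\<close>

text \<open>A sequence \<open>(A_0, ..., A_m)\<close> is a list of length \<open>m + 1\<close>.\<close>

primrec dom_space :: "('v::complex_vector \<Rightarrow> 'v) list \<Rightarrow> nat \<Rightarrow> 'v set"
  where
    "dom_space A 0 = UNIV"
  | "dom_space A (Suc i) = {x \<in> dom_space A i. (A ! i) x = 0}"

definition MM :: "('v::complex_vector \<Rightarrow> 'v) list set"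
  where "MM = {A. A \<noteq> [] \<and>
    (\<forall>i<length A. A ! i \<in> chom (dom_space A i) UNIV \<and> A ! i \<noteq> 0) \<and>
    dom_space A (length A) = {0}}"

definition proj_seq :: "('v::complex_vector \<Rightarrow> 'v) list \<Rightarrow> ('v \<Rightarrow> 'v) set list"
  where "proj_seq A = map proj_class A"

definition PM :: "('v::complex_vector \<Rightarrow> 'v) set list set"
  where "PM = proj_seq ` MM"

definition basic_nbhd ::
    "('v::complex_vector \<Rightarrow> 'v) list \<Rightarrow> (nat \<Rightarrow> ('v \<Rightarrow> 'v) set set) \<Rightarrow> ('v \<Rightarrow> 'v) set list set"
  where "basic_nbhd A U = {proj_seq B | B. B \<in> MM \<and>
    (\<forall>i<length A. \<exists>j<length B. dom_space A i \<subseteq> dom_space B j \<and>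
      hom_restrict (B ! j) (dom_space A i) \<noteq> 0 \<and>
      proj_class (hom_restrict (B ! j) (dom_space A i)) \<in> U i)}"

definition PM_topology :: "('v::hermitian_space \<Rightarrow> 'v) set list topology"
  where "PM_topology = topology (\<lambda>S. S \<subseteq> PM \<and>
    (\<forall>A\<in>MM. proj_seq A \<in> S \<longrightarrow>
      (\<exists>U. (\<forall>i<length A. openin (proj_topology (chom (dom_space A i) UNIV)) (U i) \<and>
              proj_class (A ! i) \<in> U i) \<and>
           basic_nbhd A U \<subseteq> S)))"

lemma basic_nbhd_mono:
  "(\<And>i. i < length A \<Longrightarrow> U i \<subseteq> U' i) \<Longrightarrow> basic_nbhd A U \<subseteq> basic_nbhd A U'"
  unfolding basic_nbhd_def by blast

lemma openin_PM_topology: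
  fixes S :: "('a::hermitian_space \<Rightarrow> 'a) set list set"
  shows "openin PM_topology S \<longleftrightarrow> S \<subseteq> PM \<and>
    (\<forall>A\<in>MM. proj_seq A \<in> S \<longrightarrow>
      (\<exists>U. (\<forall>i<length A. openin (proj_topology (chom (dom_space A i) UNIV)) (U i) \<and>
              proj_class (A ! i) \<in> U i) \<and>
           basic_nbhd A U \<subseteq> S))"
proof -
  define N where "N A U \<longleftrightarrow>
    (\<forall>i<length A. openin (proj_topology (chom (dom_space A i) UNIV)) (U i) \<and>
      proj_class (A ! i) \<in> U i)" for A :: "('a \<Rightarrow> 'a) list" and U
  define P where "P S \<longleftrightarrow> S \<subseteq> PM \<and>
    (\<forall>A\<in>MM. proj_seq A \<in> S \<longrightarrow> (\<exists>U. N A U \<and> basic_nbhd A U \<subseteq> S))"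
    for S :: "('a \<Rightarrow> 'a) set list set"
  have "P (S \<inter> T)" if S: "P S" and T: "P T" for S T
    unfolding P_def
  proof (intro conjI ballI impI)
    show "S \<inter> T \<subseteq> PM"
      using S by (auto simp: P_def)
    fix A :: "('a \<Rightarrow> 'a) list"
    assume A: "A \<in> MM" "proj_seq A \<in> S \<inter> T"
    obtain U where U: "N A U" "basic_nbhd A U \<subseteq> S"
      using S A by (auto simp: P_def)
    obtain U' where U': "N A U'" "basic_nbhd A U' \<subseteq> T"
      using T A by (auto simp: P_def)
    have 1: "N A (\<lambda>i. U i \<inter> U' i)"
      using U(1) U'(1) by (auto simp: N_def)
    have "basic_nbhd A (\<lambda>i. U i \<inter> U' i) \<subseteq> basic_nbhd A U"
      and "basic_nbhd A (\<lambda>i. U i \<inter> U' i) \<subseteq> basic_nbhd A U'"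
      by (rule basic_nbhd_mono; simp)+
    with U(2) U'(2) have 2: "basic_nbhd A (\<lambda>i. U i \<inter> U' i) \<subseteq> S \<inter> T"
      by blast
    show "\<exists>U. N A U \<and> basic_nbhd A U \<subseteq> S \<inter> T"
      by (intro exI conjI) (rule 1 2)+
  qed
  moreover have "P (\<Union>\<S>)" if *: "\<forall>S\<in>\<S>. P S" for \<S>
    unfolding P_def
  proof (intro conjI ballI impI)
    show "\<Union>\<S> \<subseteq> PM"
      using * by (auto simp: P_def)
    fix A :: "('a \<Rightarrow> 'a) list"
    assume A: "A \<in> MM" "proj_seq A \<in> \<Union>\<S>"
    then obtain S where S: "S \<in> \<S>" "proj_seq A \<in> S"
      by blast
    then obtain U where 1: "N A U" and U: "basic_nbhd A U \<subseteq> S"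
      using * A(1) unfolding P_def by metis
    have 2: "basic_nbhd A U \<subseteq> \<Union>\<S>"
      using U S(1) by (rule Sup_upper2[rotated])
    show "\<exists>U. N A U \<and> basic_nbhd A U \<subseteq> \<Union>\<S>"
      by (intro exI conjI) (rule 1 2)+
  qed
  ultimately have "istopology P"
    unfolding istopology_def by blast
  moreover have "PM_topology = topology P"
    unfolding PM_topology_def P_def N_def ..
  ultimately have "openin PM_topology S \<longleftrightarrow> P S"
    by (metis topology_inverse')
  then show ?thesis
    unfolding P_def N_def .
qed

definition is_direct_sum :: "nat \<Rightarrow> (nat \<Rightarrow> 'v::complex_vector set) \<Rightarrow> bool"
  where "is_direct_sum l W \<longleftrightarrow>
    (\<forall>v. \<exists>!w. w \<in> (\<Pi>\<^sub>E i\<in>{..<l}. W i) \<and> v = (\<Sum>i<l. w i))"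

definition MH :: "('v::complex_vector \<Rightarrow> 'v) list set"
  where "MH = {A \<in> MM. is_direct_sum (length A) (\<lambda>i. (A ! i) ` dom_space A i)}"

definition PMH :: "('v::complex_vector \<Rightarrow> 'v) set list set"
  where "PMH = proj_seq ` MH"


section \<open>Exterior powers\<close>

text \<open>
  The exterior power is realised inside the dual of the space of alternating forms:
  the decomposable element \<open>v_1 \<and> ... \<and> v_k\<close> is evaluation of alternating
  \<open>k\<close>-forms at \<open>(v_1, ..., v_k)\<close>, and the \<open>k\<close>-th exterior power is the
  span of these. Tuples are lists of length \<open>k\<close>; as for \<open>chom\<close>, forms vanish on
  lists of other lengths and evaluation functionals vanish off the space of forms.
\<close>

definition alt_forms :: "nat \<Rightarrow> ('v::complex_vector list \<Rightarrow> complex) set"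
  where "alt_forms k = {\<phi>.
    (\<forall>vs i x y. length vs = k \<and> i < k \<longrightarrow>
      \<phi> (vs[i := x + y]) = \<phi> (vs[i := x]) + \<phi> (vs[i := y])) \<and>
    (\<forall>vs i c x. length vs = k \<and> i < k \<longrightarrow>
      \<phi> (vs[i := c *\<^sub>C x]) = c * \<phi> (vs[i := x])) \<and>
    (\<forall>vs i j. length vs = k \<and> i < j \<and> j < k \<and> vs ! i = vs ! j \<longrightarrow> \<phi> vs = 0) \<and>
    (\<forall>vs. length vs \<noteq> k \<longrightarrow> \<phi> vs = 0)}"

definition wedge :: "'v::complex_vector list \<Rightarrow> ('v list \<Rightarrow> complex) \<Rightarrow> complex"
  where "wedge vs = (\<lambda>\<phi>. if \<phi> \<in> alt_forms (length vs) then \<phi> vs else 0)"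

definition ext_power :: "nat \<Rightarrow> (('v::complex_vector list \<Rightarrow> complex) \<Rightarrow> complex) set"
  where "ext_power k = cspan {wedge vs | vs. length vs = k}"

text \<open>The endomorphism of the exterior power induced by an endomorphism \<open>f\<close>, given as
  the transpose of pulling back forms along \<open>f\<close>.\<close>

definition ext_map :: "nat \<Rightarrow> ('v::complex_vector \<Rightarrow> 'v) \<Rightarrow>
    (('v list \<Rightarrow> complex) \<Rightarrow> complex) \<Rightarrow> (('v list \<Rightarrow> complex) \<Rightarrow> complex)"
  where "ext_map k f = hom_restrict
    (\<lambda>\<xi>. hom_restrict (\<lambda>\<phi>. \<xi> (\<phi> \<circ> map f)) (alt_forms k)) (ext_power k)"

lemma pullback_alt_forms:
  assumes f: "f \<in> chom UNIV UNIV" and \<phi>: "\<phi> \<in> alt_forms k"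
  shows "\<phi> \<circ> map f \<in> alt_forms k"
proof -
  have "\<phi> (map f vs) = 0"
    if "length vs = k" "i < j" "j < k" "vs ! i = vs ! j" for vs i j
  proof -
    have "length (map f vs) = k" "map f vs ! i = map f vs ! j"
      using that by simp_all
    with \<phi> that(2,3) show ?thesis
      unfolding alt_forms_def by blast
  qed
  then show ?thesis
    using assms by (auto simp: alt_forms_def chom_def map_update)
qed

lemma ext_map_wedge:
  assumes "f \<in> chom UNIV UNIV" and "length vs = k"
  shows "ext_map k f (wedge vs) = wedge (map f vs)"
proof -
  have "wedge vs \<in> ext_power k"
    using assms(2) unfolding ext_power_def by (blast intro: complex_vector.span_base)
  then show ?thesis
    using assms pullback_alt_forms[OF assms(1)]
    by (auto simp: ext_map_def hom_restrict_def wedge_def fun_eq_iff)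
qed

text \<open>
  For \<open>V = W_0 \<oplus> ... \<oplus> W_(l-1)\<close> and a list \<open>\<kappa>\<close> of \<open>l\<close>
  degrees with sum \<open>k\<close>, this is the image in the \<open>k\<close>-th exterior power of
  \<open>V\<close> of the tensor product of the \<open>\<kappa>_i\<close>-th exterior powers of the \<open>W_i\<close>.
\<close>

definition ext_summand :: "(nat \<Rightarrow> 'v::complex_vector set) \<Rightarrow> nat list \<Rightarrow>
    (('v list \<Rightarrow> complex) \<Rightarrow> complex) set"
  where "ext_summand W \<kappa> = cspan {wedge (concat us) | us. length us = length \<kappa> \<and>
    (\<forall>i<length \<kappa>. length (us ! i) = \<kappa> ! i \<and> set (us ! i) \<subseteq> W i)}"


section \<open>The map to the product of projective spaces\<close>

definition perp_space :: "('v::hermitian_space \<Rightarrow> 'v) list \<Rightarrow> nat \<Rightarrow> 'v set"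
  where "perp_space A i = {x \<in> dom_space A i. \<forall>y\<in>dom_space A (Suc i). cinner x y = 0}"

definition rk :: "('v::hermitian_space \<Rightarrow> 'v) list \<Rightarrow> nat \<Rightarrow> nat"
  where "rk A i = cdim (perp_space A i)"

definition sum_map :: "('v::hermitian_space \<Rightarrow> 'v) list \<Rightarrow> 'v \<Rightarrow> 'v"
  where "sum_map A = (THE f. f \<in> chom UNIV UNIV \<and>
    (\<forall>i<length A. \<forall>x\<in>perp_space A i. f x = (A ! i) x))"

definition top_index :: "nat \<Rightarrow> ('v::hermitian_space \<Rightarrow> 'v) list \<Rightarrow> nat"
  where "top_index k A = (THE j. j < length A \<and>
    (\<Sum>i<j. rk A i) < k \<and> k \<le> (\<Sum>i\<le>j. rk A i))"

definition top_degrees :: "nat \<Rightarrow> ('v::hermitian_space \<Rightarrow> 'v) list \<Rightarrow> nat list"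
  where "top_degrees k A = (let j = top_index k A in
    map (\<lambda>i. if i < j then rk A i else if i = j then k - (\<Sum>l<j. rk A l) else 0) [0..<length A])"

definition ext_seq :: "nat \<Rightarrow> ('v::hermitian_space \<Rightarrow> 'v) list \<Rightarrow>
    (('v list \<Rightarrow> complex) \<Rightarrow> complex) \<Rightarrow> (('v list \<Rightarrow> complex) \<Rightarrow> complex)"
  where "ext_seq k A = (THE F. F \<in> chom (ext_power k) (ext_power k) \<and>
    (\<forall>\<xi>\<in>ext_summand (perp_space A) (top_degrees k A). F \<xi> = ext_map k (sum_map A) \<xi>) \<and>
    (\<forall>\<kappa>. length \<kappa> = length A \<and> sum_list \<kappa> = k \<and> \<kappa> \<noteq> top_degrees k A \<longrightarrow>
      (\<forall>\<xi>\<in>ext_summand (perp_space A) \<kappa>. F \<xi> = 0)))"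

text \<open>The class of \<open>ext_seq k A\<close> is the same for all representatives \<open>A\<close> of a
  point; the definite description denotes this common class.\<close>

definition lambda_bar :: "('v::hermitian_space \<Rightarrow> 'v) set list \<Rightarrow>
    nat \<Rightarrow> ((('v list \<Rightarrow> complex) \<Rightarrow> complex) \<Rightarrow> (('v list \<Rightarrow> complex) \<Rightarrow> complex)) set"
  where "lambda_bar p = (\<lambda>k\<in>{1..cdim (UNIV :: 'v set) - 1}.
    THE L. \<exists>A\<in>MH. proj_seq A = p \<and> L = proj_class (ext_seq k A))"

end

theory Submission
  imports Defs "HOL-Combinatorics.Permutations"
begin

text \<open>
  With \<open>P_i\<close> the orthogonal projection onto the complement of \<open>V_(i+1)\<close> in \<open>V_i\<close>, a
  sequence \<open>A\<close> lies in \<open>MH\<close> iff the sum of the \<open>A_i P_i\<close> is injective, which is an open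
  condition. If \<open>B\<close> is near such an \<open>A\<close>, each \<open>A_i\<close> is approximated by \<open>c_i B_(j i)\<close> on
  \<open>V(A)_i\<close>, and counting kernels shows that the flag of \<open>B\<close> is a coarsening of the flag of
  \<open>A\<close>: \<open>j\<close> is monotone and onto, and \<open>V(B)_(j i) = V(A)_a\<close> for the least \<open>a\<close> with
  \<open>j a = j i\<close>. Hence \<open>B\<close> lies in \<open>MH\<close>, and the \<open>k\<close>-th exterior power of \<open>B\<close> is, up to
  a scalar, a sum over words in the blocks of \<open>A\<close>, weighted by products of ratios
  \<open>c_(b-1) / c_b\<close> with \<open>j (b - 1) = j b\<close>. These ratios tend to \<open>0\<close> as \<open>B\<close> tends to
  \<open>A\<close>, because \<open>c_(b-1) B_(j b)\<close> tends to \<open>A_(b-1)\<close>, which vanishes on \<open>V(A)_b\<close>, while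
  \<open>c_b B_(j b)\<close> tends to \<open>A_b\<close>. In the limit only the words of the top summand of \<open>A\<close> survive.
\<close>

section \<open>Linear maps and the flag of kernels\<close>

text \<open>The endomorphisms \<open>ext_seq k B\<close> need not converge as \<open>B\<close> tends
  to \<open>A\<close>, since the constants \<open>c_i\<close> are tied to the representatives of
  \<open>B\<close> and may degenerate at different rates; only the class has a limit. The scalar to
  divide by is the coefficient of the top words of \<open>A\<close>. Every other word then carries
  ratios to the powers \<open>min k (flag_rk A b) - low M b\<close>, and these exponents are not
  negative on the words that count: if more than \<open>flag_rk A b\<close> letters lie below
  \<open>b\<close>, an alternating form meets too many vectors of a space of that dimension and
  vanishes. So no weight can blow up. The limit is nonzero on \<open>MH\<close>, which is what lets
  the classes converge.

  That the flag of \<open>B\<close> coarsens that of \<open>A\<close> exactly, and not just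
  approximately, rests on the topology: its neighborhoods ask for inclusions of the kernels. The
  blocks of \<open>B\<close> are therefore sums of blocks of \<open>A\<close>, and one set of
  projections serves all nearby \<open>B\<close>. At each point of an open set one real bound is
  enough, so limits of sequences suffice.\<close>

lemma chom_add: "f \<in> chom W X \<Longrightarrow> x \<in> W \<Longrightarrow> y \<in> W \<Longrightarrow> f (x + y) = f x + f y"
  and chom_scale: "f \<in> chom W X \<Longrightarrow> x \<in> W \<Longrightarrow> f (c *\<^sub>C x) = c *\<^sub>C f x"
  and chom_outside: "f \<in> chom W X \<Longrightarrow> x \<notin> W \<Longrightarrow> f x = 0"
  by (simp_all add: chom_def)

lemma chom_zero: "f \<in> chom W X \<Longrightarrow> f 0 = 0"
  by (metis chom_outside chom_scale complex_vector.scale_zero_left)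

lemma chom_diff:
  assumes "f \<in> chom W X" "x \<in> W" "y \<in> W" "csubspace W"
  shows "f (x - y) = f x - f y"
proof -
  have "f ((x - y) + y) = f (x - y) + f y"
    using assms by (intro chom_add complex_vector.subspace_diff)
  then show ?thesis
    by simp
qed

lemma chom_sum:
  assumes "f \<in> chom W X" "csubspace W" "\<And>i. i \<in> I \<Longrightarrow> g i \<in> W"
  shows "f (\<Sum>i\<in>I. g i) = (\<Sum>i\<in>I. f (g i))"
  using assms(3)
proof (induction I rule: infinite_finite_induct)
  case (insert x F)
  then show ?case
    using assms by (simp add: chom_add complex_vector.subspace_sum)
qed (simp_all add: chom_zero[OF assms(1)])

lemma chom_UNIVI:
  assumes "\<And>x y. f (x + y) = f x + f y" "\<And>c x. f (c *\<^sub>C x) = c *\<^sub>C f x"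
  shows "f \<in> chom UNIV UNIV"
  using assms by (auto simp: chom_def)

lemma chom_UNIV_scale: "f \<in> chom UNIV UNIV \<Longrightarrow> (\<lambda>x. c *\<^sub>C f x) \<in> chom UNIV UNIV"
  by (intro chom_UNIVI) (simp_all add: chom_add chom_scale scaleC_add_right scaleC_scaleC
      mult.commute)

lemma chom_UNIV_sum:
  assumes "\<And>i. i \<in> I \<Longrightarrow> f i \<in> chom UNIV UNIV"
  shows "(\<lambda>x. \<Sum>i\<in>I. f i x) \<in> chom UNIV UNIV"
proof (rule chom_UNIVI)
  fix x y c
  show "(\<Sum>i\<in>I. f i (x + y)) = (\<Sum>i\<in>I. f i x) + (\<Sum>i\<in>I. f i y)"
    unfolding sum.distrib[symmetric] by (intro sum.cong refl chom_add[OF assms]) auto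
  show "(\<Sum>i\<in>I. f i (c *\<^sub>C x)) = c *\<^sub>C (\<Sum>i\<in>I. f i x)"
    unfolding complex_vector.scale_sum_right by (intro sum.cong refl chom_scale[OF assms]) auto
qed

lemma chom_UNIV_inj:
  assumes "f \<in> chom UNIV UNIV" "\<And>x. f x = 0 \<Longrightarrow> x = 0"
  shows "inj f"
  using assms chom_diff[OF assms(1)]
  by (metis (no_types, lifting) UNIV_I complex_vector.subspace_UNIV eq_iff_diff_eq_0 injI)

lemma chom_UNIV_linear: "f \<in> chom UNIV UNIV \<Longrightarrow> Vector_Spaces.linear scaleC scaleC f"
  by (intro Vector_Spaces.linear.intro module_hom.intro)
     (auto simp: module_hom_axioms_def chom_add chom_scale complex_vector.vector_space_axioms
       complex_vector.module_axioms)

lemma chom_UNIV_real_linear: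
  fixes f :: "'a::hermitian_space \<Rightarrow> 'b::hermitian_space"
  shows "f \<in> chom UNIV UNIV \<Longrightarrow> linear f"
  by (intro linearI) (auto simp: chom_add chom_scale scaleR_scaleC)

lemma csubspace_kernel:
  assumes "f \<in> chom W X" "csubspace W"
  shows "csubspace {x \<in> W. f x = 0}"
  using assms by (auto simp: complex_vector.subspace_def chom_add chom_scale chom_zero)

lemma dom_space_subspace:
  assumes "A \<in> MM" "i \<le> length A"
  shows "csubspace (dom_space A i)"
  using assms(2)
proof (induction i)
  case (Suc i)
  then show ?case
    using assms(1) csubspace_kernel[of "A ! i" "dom_space A i" UNIV] by (auto simp: MM_def)
qed (simp add: complex_vector.subspace_UNIV)

lemma dom_space_antimono: "i \<le> j \<Longrightarrow> dom_space A j \<subseteq> dom_space A i"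
  by (induction rule: dec_induct) auto

declare dom_space.simps(2) [simp del]

section \<open>Complex bases of Hermitian spaces\<close>

lemma csubspace_imp_subspace:
  fixes W :: "'a::hermitian_space set"
  shows "csubspace W \<Longrightarrow> subspace W"
  by (simp add: complex_vector.subspace_def subspace_def scaleR_scaleC)

text \<open>The class provides a real basis. Counting ranks, and passing from surjective to
  injective, needs a basis over the complex numbers; one is extracted from \<open>Basis\<close>,
  which spans over the complex numbers as well.\<close>

definition complex_basis :: "'a::hermitian_space set"
  where "complex_basis = (SOME B. finite B \<and> \<not> complex_vector.dependent B \<and> cspan B = UNIV)"

lemma complex_basis:
  "finite (complex_basis :: 'a::hermitian_space set)"
  "\<not> complex_vector.dependent (complex_basis :: 'a set)"
  "cspan (complex_basis :: 'a set) = UNIV"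
proof -
  have sp: "cspan (Basis :: 'a set) = UNIV"
  proof -
    have "subspace (cspan (Basis :: 'a set))"
      by (simp add: csubspace_imp_subspace)
    then have "span Basis \<subseteq> cspan (Basis :: 'a set)"
      by (intro span_minimal) (auto intro: complex_vector.span_base)
    then show ?thesis
      by auto
  qed
  obtain B :: "'a set" where B: "B \<subseteq> Basis" "\<not> complex_vector.dependent B" "Basis \<subseteq> cspan B"
    using complex_vector.maximal_independent_subset[of "Basis :: 'a set"] by metis
  have "cspan B = UNIV"
    using sp B(3) by (metis complex_vector.span_mono complex_vector.span_span top.extremum_uniqueI)
  moreover have "finite B"
    using B(1) finite_Basis finite_subset by blast
  ultimately have "\<exists>B :: 'a set. finite B \<and> \<not> complex_vector.dependent B \<and> cspan B = UNIV"
    using B(2) by blast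
  from someI_ex[OF this, folded complex_basis_def]
  show "finite (complex_basis :: 'a::hermitian_space set)"
  "\<not> complex_vector.dependent (complex_basis :: 'a set)"
  "cspan (complex_basis :: 'a set) = UNIV"
    by blast+
qed

global_interpretation hermitian:
  finite_dimensional_vector_space "scaleC :: complex \<Rightarrow> 'a \<Rightarrow> 'a :: hermitian_space" complex_basis
  rewrites "module.span (scaleC :: complex \<Rightarrow> 'a \<Rightarrow> 'a) = cspan"
    and "module.subspace (scaleC :: complex \<Rightarrow> 'a \<Rightarrow> 'a) = csubspace"
    and "vector_space.dim (scaleC :: complex \<Rightarrow> 'a \<Rightarrow> 'a) = cdim"
proof -
  show "finite_dimensional_vector_space (scaleC :: complex \<Rightarrow> 'a \<Rightarrow> 'a) complex_basis"
    by unfold_locales (use complex_basis in \<open>simp_all add: cspan_def\<close>)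
qed (simp_all add: cspan_def csubspace_def cdim_def)

section \<open>Orthogonal projections and the blocks of a sequence\<close>

lemma cinner_zero_left [simp]: "cinner 0 (y::'a::hermitian_space) = 0"
  using cinner_scaleC_left[of 0 0 y] by simp

lemma cinner_minus_left: "cinner (- x) (y::'a::hermitian_space) = - cinner x y"
  using cinner_add_left[of x "- x" y] by (simp add: add_eq_0_iff)

lemma cinner_diff_left: "cinner (x - z) (y::'a::hermitian_space) = cinner x y - cinner z y"
  using cinner_add_left[of x "- z" y] by (simp add: cinner_minus_left)

lemma cinner_scaleC_right: "cinner x (c *\<^sub>C (y::'a::hermitian_space)) = cnj c * cinner x y"
  by (metis cinner_commute cinner_scaleC_left complex_cnj_mult)

lemma cinner_self_eq_0: "cinner x x = 0 \<Longrightarrow> (x::'a::hermitian_space) = 0"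
  by (metis inner_cinner inner_eq_zero_iff zero_complex.sel(1))

definition oproj :: "'a::hermitian_space set \<Rightarrow> 'a \<Rightarrow> 'a"
  where "oproj W x = (SOME y. y \<in> W \<and> (\<forall>w\<in>W. cinner (x - y) w = 0))"

lemma oproj_ex:
  fixes W :: "'a::hermitian_space set"
  assumes "csubspace W"
  shows "\<exists>y. y \<in> W \<and> (\<forall>w\<in>W. cinner (x - y) w = 0)"
proof -
  have W: "span W = W"
    using csubspace_imp_subspace[OF assms] by (simp add: span_eq_iff)
  obtain y z where yz: "y \<in> W" "\<And>w. w \<in> W \<Longrightarrow> orthogonal z w" "x = y + z"
    using orthogonal_subspace_decomp_exists[of W x] W by metis
  have "cinner z w = 0" if "w \<in> W" for w
  proof -
    \<comment> \<open>Real orthogonality kills only the real part of \<open>cinner z w\<close>; its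
      imaginary part is the real part of \<open>cinner z (\<i> *\<^sub>C w)\<close>.\<close>
    have "\<i> *\<^sub>C w \<in> W"
      using assms that by (simp add: complex_vector.subspace_scale)
    then have "Re (cinner z w) = 0" "Re (cinner z (\<i> *\<^sub>C w)) = 0"
      using yz(2) that by (auto simp: orthogonal_def inner_cinner)
    then show ?thesis
      by (simp add: cinner_scaleC_right complex_eq_iff)
  qed
  then show ?thesis
    using yz by (intro exI[of _ y]) auto
qed

context
  fixes W :: "'a::hermitian_space set"
  assumes W: "csubspace W"
begin

lemma oproj_in: "oproj W x \<in> W"
  and oproj_orth: "w \<in> W \<Longrightarrow> cinner (x - oproj W x) w = 0"
  using someI_ex[OF oproj_ex[OF W, of x]] by (simp_all add: oproj_def)

lemma oproj_unique:
  assumes "y \<in> W" "\<And>w. w \<in> W \<Longrightarrow> cinner (x - y) w = 0"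
  shows "oproj W x = y"
proof -
  let ?d = "oproj W x - y"
  have d: "?d \<in> W"
    using assms(1) oproj_in W by (simp add: complex_vector.subspace_diff)
  have "?d = (x - y) - (x - oproj W x)"
    by simp
  then have "cinner ?d ?d = cinner (x - y) ?d - cinner (x - oproj W x) ?d"
    by (metis cinner_diff_left)
  then have "cinner ?d ?d = 0"
    using assms(2) d oproj_orth by simp
  then show ?thesis
    using cinner_self_eq_0 by fastforce
qed

lemma oproj_id: "x \<in> W \<Longrightarrow> oproj W x = x"
  by (rule oproj_unique) auto

lemma oproj_add: "oproj W (x + y) = oproj W x + oproj W y"
proof (rule oproj_unique)
  show "oproj W x + oproj W y \<in> W"
    using W oproj_in by (simp add: complex_vector.subspace_add)
  fix w assume "w \<in> W"
  then show "cinner (x + y - (oproj W x + oproj W y)) w = 0"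
    using oproj_orth[of w x] oproj_orth[of w y] by (simp add: cinner_diff_left cinner_add_left)
qed

lemma oproj_scale: "oproj W (c *\<^sub>C x) = c *\<^sub>C oproj W x"
proof (rule oproj_unique)
  show "c *\<^sub>C oproj W x \<in> W"
    using W oproj_in by (simp add: complex_vector.subspace_scale)
  fix w assume "w \<in> W"
  then show "cinner (c *\<^sub>C x - c *\<^sub>C oproj W x) w = 0"
    using oproj_orth[of w x] by (simp add: cinner_diff_left cinner_scaleC_left)
qed

lemma oproj_eq_0: "(\<And>w. w \<in> W \<Longrightarrow> cinner x w = 0) \<Longrightarrow> oproj W x = 0"
  by (rule oproj_unique) (auto simp: W complex_vector.subspace_0)

lemma oproj_diff: "oproj W (x - y) = oproj W x - oproj W y"
  using oproj_add[of "x - y" y] by simp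

text \<open>The difference \<open>x - oproj W' x\<close> is orthogonal to \<open>W'\<close>, hence
  to \<open>W\<close>, and so projects to zero there.\<close>

lemma oproj_nested:
  assumes "csubspace W'" "W \<subseteq> W'"
  shows "oproj W (oproj W' x) = oproj W x"
proof -
  have "oproj W (x - oproj W' x) = 0"
    using assms someI_ex[OF oproj_ex[OF assms(1), of x]]
    by (intro oproj_eq_0) (auto simp: oproj_def)
  then show ?thesis
    by (simp add: oproj_diff)
qed

end

lemma cdim_orth_complement:
  fixes W W' :: "'a::hermitian_space set"
  assumes W: "csubspace W" and W': "csubspace W'" and sub: "W' \<subseteq> W"
  shows "cdim {x \<in> W. \<forall>y\<in>W'. cinner x y = 0} + cdim W' = cdim W"
proof -
  let ?P = "{x \<in> W. \<forall>y\<in>W'. cinner x y = 0}"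
  have P: "csubspace ?P"
    using W by (auto simp: complex_vector.subspace_def cinner_add_left cinner_scaleC_left)
  have "{x + y |x y. x \<in> ?P \<and> y \<in> W'} = W"
  proof (intro equalityI subsetI)
    fix x assume "x \<in> {x + y |x y. x \<in> ?P \<and> y \<in> W'}"
    then show "x \<in> W"
      using sub W by (auto intro: complex_vector.subspace_add)
  next
    fix x assume "x \<in> W"
    then have "x - oproj W' x \<in> ?P" "oproj W' x \<in> W'" "x = (x - oproj W' x) + oproj W' x"
      using oproj_in[OF W', of x] oproj_orth[OF W', of _ x] sub W
      by (auto intro: complex_vector.subspace_diff)
    then show "x \<in> {x + y |x y. x \<in> ?P \<and> y \<in> W'}"
      by blast
  qed
  moreover have "?P \<inter> W' = {0}"
    using cinner_self_eq_0 P W' complex_vector.subspace_0 by fastforce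
  ultimately show ?thesis
    using hermitian.dim_sums_Int[OF P W'] by simp
qed

text \<open>On \<open>MM\<close> this is the orthogonal projection onto
  \<open>perp_space A i\<close>. Written as a difference along the flag, it telescopes when summed
  over blocks.\<close>

definition block_proj :: "('v::hermitian_space \<Rightarrow> 'v) list \<Rightarrow> nat \<Rightarrow> 'v \<Rightarrow> 'v"
  where "block_proj A i x = oproj (dom_space A i) x - oproj (dom_space A (Suc i)) x"

text \<open>Precomposing with the projection turns \<open>A ! i\<close>, a linear map on
  \<open>dom_space A i\<close> only, into an endomorphism of the whole space that vanishes on the
  other blocks.\<close>

definition block_map :: "('v::hermitian_space \<Rightarrow> 'v) list \<Rightarrow> nat \<Rightarrow> 'v \<Rightarrow> 'v"
  where "block_map A i x = (A ! i) (block_proj A i x)"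

context
  fixes A :: "('v::hermitian_space \<Rightarrow> 'v) list"
  assumes A: "A \<in> MM"
begin

lemma nth_chom: "i < length A \<Longrightarrow> A ! i \<in> chom (dom_space A i) UNIV"
  and nth_neq_0: "i < length A \<Longrightarrow> A ! i \<noteq> 0"
  and dom_space_length: "dom_space A (length A) = {0}"
  using A by (auto simp: MM_def)

lemma block_proj_chom: "i < length A \<Longrightarrow> block_proj A i \<in> chom UNIV UNIV"
  using oproj_add[OF dom_space_subspace[OF A]] oproj_scale[OF dom_space_subspace[OF A]]
  by (intro chom_UNIVI) (auto simp: block_proj_def complex_vector.scale_right_diff_distrib
      less_imp_le Suc_leI)

lemma block_proj_perp: "i < length A \<Longrightarrow> block_proj A i x \<in> perp_space A i"
proof -
  assume i: "i < length A"
  have s: "csubspace (dom_space A i)" "csubspace (dom_space A (Suc i))"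
    using i by (auto intro!: dom_space_subspace[OF A])
  have sub: "dom_space A (Suc i) \<subseteq> dom_space A i"
    by (rule dom_space_antimono) simp
  have "block_proj A i x = oproj (dom_space A i) x -
      oproj (dom_space A (Suc i)) (oproj (dom_space A i) x)"
    using oproj_nested[OF s(2,1) sub] by (simp add: block_proj_def)
  then show ?thesis
    using oproj_orth[OF s(2), of _ "oproj (dom_space A i) x"] oproj_in[OF s(1)] oproj_in[OF s(2)]
        sub s
    by (auto simp: perp_space_def complex_vector.subspace_diff subset_iff)
qed

lemma perp_in_dom: "x \<in> perp_space A i \<Longrightarrow> x \<in> dom_space A i"
  by (simp add: perp_space_def)

lemma rk_plus: "i < length A \<Longrightarrow> rk A i + cdim (dom_space A (Suc i)) = cdim (dom_space A i)"
  using cdim_orth_complement[OF dom_space_subspace[OF A, of i] dom_space_subspace[OF A, of "Suc i"]]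
    dom_space_antimono[of i "Suc i" A]
  by (simp add: perp_space_def rk_def)

lemma sum_rk: "a \<le> length A \<Longrightarrow> (\<Sum>i<a. rk A i) + cdim (dom_space A a) = cdim (UNIV :: 'v set)"
proof (induction a)
  case (Suc a)
  then show ?case
    using rk_plus[of a] by (simp)
qed simp

lemma sum_rk_length: "(\<Sum>i<length A. rk A i) = cdim (UNIV :: 'v set)"
  using sum_rk[of "length A"] by (simp add: dom_space_length)

lemma oproj_dom_perp:
  assumes "j \<le> length A" "i < length A" "x \<in> perp_space A i"
  shows "oproj (dom_space A j) x = (if j \<le> i then x else 0)"
proof (cases "j \<le> i")
  case True
  then show ?thesis
    using assms dom_space_antimono[of j i A] oproj_id[OF dom_space_subspace[OF A assms(1)], of x]
    by (auto simp: perp_space_def)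
next
  case False
  then have "dom_space A j \<subseteq> dom_space A (Suc i)"
    by (intro dom_space_antimono) simp
  then show ?thesis
    using assms oproj_eq_0[OF dom_space_subspace[OF A assms(1)], of x] False
    by (auto simp: perp_space_def)
qed

lemma block_proj_perp_eq:
  assumes "j < length A" "i < length A" "x \<in> perp_space A i"
  shows "block_proj A j x = (if j = i then x else 0)"
  using oproj_dom_perp[OF _ assms(2,3), of j] oproj_dom_perp[OF _ assms(2,3), of "Suc j"] assms
  by (auto simp: block_proj_def)

lemma block_proj_block_proj:
  "j < length A \<Longrightarrow> i < length A \<Longrightarrow> block_proj A j (block_proj A i x) = (if j =
      i then block_proj A i x else 0)"
  using block_proj_perp_eq block_proj_perp by blast

text \<open>The differences telescope, and the last projection is onto the zero space, where the
  flag of a sequence in \<open>MM\<close> ends. For \<open>a = 0\<close> this splits a vector into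
  its block components.\<close>

lemma sum_block_proj_ge:
  assumes "a \<le> length A"
  shows "(\<Sum>i\<in>{a..<length A}. block_proj A i x) = oproj (dom_space A a) x"
proof -
  have "csubspace {0 :: 'v}"
    by simp
  then have "oproj {0} x = 0"
    using oproj_in[of "{0::'v}" x] by simp
  then have "oproj (dom_space A (length A)) x = 0"
    by (simp add: dom_space_length)
  moreover have "(\<Sum>i\<in>{a..<length A}. block_proj A i x) =
      oproj (dom_space A a) x - oproj (dom_space A (length A)) x"
    using assms unfolding block_proj_def
    using sum_Suc_diff'[of a "length A" "\<lambda>i. - oproj (dom_space A i) x"]
    by (simp add: algebra_simps)
  ultimately show ?thesis
    by simp
qed

lemma sum_block_proj: "(\<Sum>i<length A. block_proj A i x) = x"
  using sum_block_proj_ge[of 0 x] oproj_id[of UNIV x] by (simp add: lessThan_atLeast0)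

lemma block_proj_in_dom: "i < length A \<Longrightarrow> block_proj A i x \<in> dom_space A i"
  using block_proj_perp perp_in_dom by blast

lemma block_proj_in_dom_le: "j \<le> i \<Longrightarrow> i < length A \<Longrightarrow> block_proj A i x \<in> dom_space A j"
  using block_proj_in_dom dom_space_antimono by blast

lemma block_map_chom: "i < length A \<Longrightarrow> block_map A i \<in> chom UNIV UNIV"
  using chom_add[OF nth_chom block_proj_in_dom block_proj_in_dom] chom_scale[OF nth_chom
      block_proj_in_dom]
    chom_add[OF block_proj_chom] chom_scale[OF block_proj_chom]
  by (intro chom_UNIVI) (auto simp: block_map_def)

lemma block_map_perp_eq:
  assumes "j < length A" "i < length A" "x \<in> perp_space A i"
  shows "block_map A j x = (if j = i then (A ! i) x else 0)"
  using block_proj_perp_eq[OF assms] chom_zero[OF nth_chom[OF assms(1)]]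
      by (simp add: block_map_def)

text \<open>The part removed by \<open>block_proj\<close> lies in
  \<open>dom_space A (Suc i)\<close>, the kernel of \<open>A ! i\<close>, so projecting onto all of
  \<open>dom_space A i\<close> gives the same value.\<close>

lemma block_map_oproj: 
  assumes i: "i < length A"
  shows "block_map A i x = (A ! i) (oproj (dom_space A i) x)"
proof -
  have s: "csubspace (dom_space A i)" "csubspace (dom_space A (Suc i))"
    using i by (auto intro!: dom_space_subspace[OF A])
  have "oproj (dom_space A (Suc i)) x \<in> dom_space A (Suc i)"
    by (rule oproj_in[OF s(2)])
  then have "(A ! i) (oproj (dom_space A (Suc i)) x) =
      0" "oproj (dom_space A (Suc i)) x \<in> dom_space A i"
    by (auto simp: dom_space.simps(2))
  then show ?thesis
    using chom_diff[OF nth_chom[OF i] oproj_in[OF s(1)] _ s(1), of _ x]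
    by (simp add: block_map_def block_proj_def)
qed

lemma chom_eqI_perp:
  assumes "f \<in> chom UNIV UNIV" "g \<in> chom UNIV UNIV"
    and "\<And>i x. i < length A \<Longrightarrow> x \<in> perp_space A i \<Longrightarrow> f x = g x"
  shows "f = g"
proof
  fix x
  have "f (\<Sum>i<length A. block_proj A i x) = g (\<Sum>i<length A. block_proj A i x)"
    using assms block_proj_perp by (simp add: chom_sum complex_vector.subspace_UNIV)
  then show "f x = g x"
    by (simp add: sum_block_proj)
qed

lemma sum_map_eq: "sum_map A = (\<lambda>x. \<Sum>i<length A. block_map A i x)" (is "_ = ?f")
  unfolding sum_map_def
proof (rule the_equality)
  have f: "?f \<in> chom UNIV UNIV"
    using block_map_chom by (intro chom_UNIV_sum) auto
  have "?f x = (A ! i) x" if "i < length A" "x \<in> perp_space A i" for i x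
    using that by (simp add: block_map_perp_eq)
  with f show *: "?f \<in> chom UNIV UNIV \<and> (\<forall>i<length A. \<forall>x\<in>perp_space A i. ?f x = (A ! i) x)"
    by blast
  show "g = ?f" if "g \<in> chom UNIV UNIV \<and> (\<forall>i<length A. \<forall>x\<in>perp_space A i. g x = (A ! i) x)" for g
    using that * by (intro chom_eqI_perp) auto
qed

lemma sum_map_chom: "sum_map A \<in> chom UNIV UNIV"
  and sum_map_perp: "i < length A \<Longrightarrow> x \<in> perp_space A i \<Longrightarrow> sum_map A x = (A ! i) x"
proof -
  show "sum_map A \<in> chom UNIV UNIV"
    using block_map_chom unfolding sum_map_eq by (intro chom_UNIV_sum) auto
  show "i < length A \<Longrightarrow> x \<in> perp_space A i \<Longrightarrow> sum_map A x = (A ! i) x"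
    by (simp add: block_map_perp_eq sum_map_eq)
qed

lemma nth_block_proj:
  assumes "i < length A" "x \<in> dom_space A i"
  shows "(A ! i) x = (A ! i) (block_proj A i x)"
  using block_map_oproj[OF assms(1), of x] oproj_id[OF dom_space_subspace[OF A] assms(2)] assms(1)
  by (simp add: block_map_def)

text \<open>As \<open>dom_space A (Suc i)\<close> is the kernel of \<open>A ! i\<close>, the map
  \<open>sum_map A\<close> carries the block \<open>i\<close> isomorphically onto the image of
  \<open>A ! i\<close>. The images then form a direct decomposition of the space iff
  \<open>sum_map A\<close> is bijective, and injectivity suffices by dimension. This replaces the
  direct sum by a condition that is visibly stable under perturbation.\<close>

lemma MH_iff: "A \<in> MH \<longleftrightarrow> inj (sum_map A)"
proof
  let ?l = "length A"
  assume "A \<in> MH"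
  then have ds: "is_direct_sum ?l (\<lambda>i. (A ! i) ` dom_space A i)"
    by (simp add: MH_def)
  have "surj (sum_map A)"
  proof (rule surjI)
    fix v
    obtain w where w: "w \<in> (\<Pi>\<^sub>E i\<in>{..<?l}. (A ! i) ` dom_space A i)" "v = (\<Sum>i<?l. w i)"
      using ds unfolding is_direct_sum_def by metis
    then have "\<forall>i\<in>{..<?l}. \<exists>x. x \<in> dom_space A i \<and> w i = (A ! i) x"
      by (auto simp: PiE_iff image_iff)
    then obtain x where x: "\<And>i. i < ?l \<Longrightarrow> x i \<in> dom_space A i \<and> w i = (A ! i) (x i)"
      by (metis lessThan_iff)
    have "sum_map A (\<Sum>i<?l. block_proj A i (x i)) = (\<Sum>i<?l. sum_map A (block_proj A i (x i)))"
      by (rule chom_sum[OF sum_map_chom]) (auto simp: complex_vector.subspace_UNIV)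
    also have "\<dots> = v"
      using x nth_block_proj by (simp add: w(2) sum_map_perp block_proj_perp)
    finally have "\<exists>y. sum_map A y = v"
      by blast
    then show "sum_map A (SOME y. sum_map A y = v) = v"
      by (rule someI_ex)
  qed
  then show "inj (sum_map A)"
    by (intro hermitian.linear_surj_imp_inj chom_UNIV_linear sum_map_chom)
next
  let ?l = "length A" and ?W = "\<lambda>i. (A ! i) ` dom_space A i"
  assume inj: "inj (sum_map A)"
  then have surj: "surj (sum_map A)"
    by (intro linear_inj_imp_surj chom_UNIV_real_linear sum_map_chom)
  have "\<exists>!w. w \<in> (\<Pi>\<^sub>E i\<in>{..<?l}. ?W i) \<and> v = (\<Sum>i<?l. w i)" for v
  proof (rule ex_ex1I)
    obtain x where "v = sum_map A x"
      using surj by (metis surjE)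
    then have "v = (\<Sum>i<?l. (\<lambda>i\<in>{..<?l}. block_map A i x) i)"
      by (simp add: sum_map_eq)
    moreover have "(\<lambda>i\<in>{..<?l}. block_map A i x) \<in> (\<Pi>\<^sub>E i\<in>{..<?l}. ?W i)"
      using block_proj_in_dom by (auto simp: block_map_def)
    ultimately show "\<exists>w. w \<in> (\<Pi>\<^sub>E i\<in>{..<?l}. ?W i) \<and> v = (\<Sum>i<?l. w i)"
      by blast
  next
    have *: "\<exists>x. \<forall>i<?l. w i = (A ! i) (block_proj A i x) \<and> sum_map A x = v"
      if w: "w \<in> (\<Pi>\<^sub>E i\<in>{..<?l}. ?W i) \<and> v = (\<Sum>i<?l. w i)" for w
    proof -
      have "\<forall>i\<in>{..<?l}. \<exists>x. x \<in> dom_space A i \<and> w i = (A ! i) x"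
        using w by (auto simp: PiE_iff image_iff)
      then obtain x where x: "\<And>i. i < ?l \<Longrightarrow> x i \<in> dom_space A i \<and> w i = (A ! i) (x i)"
        by (metis lessThan_iff)
      \<comment> \<open>The components \<open>w i\<close> have unrelated preimages
        \<open>x i\<close>. Taking from each \<open>x i\<close> only its block \<open>i\<close>
        glues them to one vector, to which injectivity of \<open>sum_map A\<close> applies.\<close>
      let ?y = "\<Sum>i<?l. block_proj A i (x i)"
      have y: "block_proj A i ?y = block_proj A i (x i)" if "i < ?l" for i
        using that
        by (simp add: chom_sum[OF block_proj_chom[OF that]] complex_vector.subspace_UNIV
            block_proj_block_proj)
      have "sum_map A ?y = v"
        using w x nth_block_proj by (simp add: sum_map_eq block_map_def y)
      then show ?thesis
        using x nth_block_proj by (intro exI[of _ ?y]) (auto simp: y)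
    qed
    fix w w'
    assume w: "w \<in> (\<Pi>\<^sub>E i\<in>{..<?l}. ?W i) \<and> v = (\<Sum>i<?l. w i)"
      and w': "w' \<in> (\<Pi>\<^sub>E i\<in>{..<?l}. ?W i) \<and> v = (\<Sum>i<?l. w' i)"
    \<comment> \<open>The equation \<open>sum_map A x = v\<close> stands under the bound
      \<open>i < ?l\<close> and is available only if some index exists.\<close>
    have "?l > 0"
      using A by (auto simp: MM_def)
    obtain x x' where "\<forall>i<?l. w i = (A ! i) (block_proj A i x) \<and> sum_map A x = v"
        "\<forall>i<?l. w' i = (A ! i) (block_proj A i x') \<and> sum_map A x' = v"
      using *[OF w] *[OF w'] by blast
    moreover from this have "x = x'"
      using inj \<open>?l > 0\<close> by (metis injD)
    ultimately show "w = w'"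
      using w w' by (intro PiE_ext[of w "{..<?l}" ?W w']) auto
  qed
  then show "A \<in> MH"
    using A by (auto simp: MH_def is_direct_sum_def)
qed

end

section \<open>Alternating forms\<close>

lemma alt_form_add:
  assumes "\<phi> \<in> alt_forms (length vs)" "i < length vs"
  shows "\<phi> (vs[i := x + y]) = \<phi> (vs[i := x]) + \<phi> (vs[i := y])"
  using assms by (simp add: alt_forms_def)

lemma alt_form_scale:
  assumes "\<phi> \<in> alt_forms (length vs)" "i < length vs"
  shows "\<phi> (vs[i := c *\<^sub>C x]) = c * \<phi> (vs[i := x])"
  using assms by (simp add: alt_forms_def)

lemma alt_form_not_distinct:
  assumes "\<phi> \<in> alt_forms (length vs)" "\<not> distinct vs"
  shows "\<phi> vs = 0"
proof -
  obtain i j where "i < length vs" "j < length vs" "i \<noteq> j" "vs ! i = vs ! j"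
    using assms(2) by (auto simp: distinct_conv_nth)
  then have "\<exists>i j. i < j \<and> j < length vs \<and> vs ! i = vs ! j"
    by (metis linorder_neqE_nat)
  then show ?thesis
    using assms(1) unfolding alt_forms_def by blast
qed

lemma alt_form_eq:
  assumes "\<phi> \<in> alt_forms (length vs)" "i < length vs" "j < length vs" "i \<noteq> j" "vs ! i = vs ! j"
  shows "\<phi> vs = 0"
  using assms by (intro alt_form_not_distinct) (auto simp: distinct_conv_nth)

lemma alt_form_zero:
  assumes "\<phi> \<in> alt_forms (length vs)" "i < length vs" "vs ! i = 0"
  shows "\<phi> vs = 0"
  using alt_form_scale[OF assms(1,2), of 0 0] assms(3)
      by (metis complex_vector.scale_zero_left list_update_id mult_zero_left)

lemma alt_form_middle_sum:
  assumes "\<phi> \<in> alt_forms (length us + Suc (length ws))"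
  shows "\<phi> (us @ (\<Sum>i\<in>I. f i) # ws) = (\<Sum>i\<in>I. \<phi> (us @ f i # ws))"
proof (induction I rule: infinite_finite_induct)
  case (insert x F)
  have "\<phi> ((us @ 0 # ws)[length us := f x + sum f F]) =
     \<phi> ((us @ 0 # ws)[length us := f x]) + \<phi> ((us @ 0 # ws)[length us := sum f F])"
    using assms by (intro alt_form_add) auto
  then show ?case
    using insert by simp
qed (use assms in \<open>auto intro!: alt_form_zero[of _ _ "length us"]\<close>)

lemma alt_form_middle_scale:
  assumes "\<phi> \<in> alt_forms (length us + Suc (length ws))"
  shows "\<phi> (us @ c *\<^sub>C x # ws) = c * \<phi> (us @ x # ws)"
  using alt_form_scale[of \<phi> "us @ 0 # ws" "length us" c x] assms by simp

text \<open>Multilinear expansion with an index set \<open>I h\<close> that may vary from slot to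
  slot with the label \<open>h\<close>. The prefix \<open>us\<close> collects the slots already
  expanded and carries the induction.\<close>

lemma alt_form_map2_sum:
  assumes "\<phi> \<in> alt_forms (length us + length hs)" "length vs = length hs" "\<And>h. finite (I h)"
  shows "\<phi> (us @ map2 (\<lambda>h x. \<Sum>i\<in>I h. q i x) hs vs) =
    (\<Sum>g | list_all2 (\<lambda>i h. i \<in> I h) g hs. \<phi> (us @ map2 q g vs))"
  using assms(1,2)
proof (induction hs arbitrary: us vs)
  case Nil
  then show ?case
    by simp
next
  case (Cons h hs)
  then obtain x vs' where vs: "vs = x # vs'" "length vs' = length hs"
    by (cases vs) auto
  let ?G = "{g. list_all2 (\<lambda>i h. i \<in> I h) g hs}"
  have eq: "{g. list_all2 (\<lambda>i h. i \<in> I h) g (h # hs)} = (\<lambda>(i, g). i # g) ` (I h \<times> ?G)"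
    by (auto simp: list_all2_Cons2 image_iff)
  have "\<phi> (us @ map2 (\<lambda>h x. \<Sum>i\<in>I h. q i x) (h # hs) vs) =
      (\<Sum>i\<in>I h. \<phi> ((us @ [q i x]) @ map2 (\<lambda>h x. \<Sum>i\<in>I h. q i x) hs vs'))"
    using Cons.prems vs by (simp add: alt_form_middle_sum)
  also have "\<dots> = (\<Sum>i\<in>I h. \<Sum>g\<in>?G. \<phi> ((us @ [q i x]) @ map2 q g vs'))"
    using Cons.prems vs by (intro sum.cong refl Cons.IH) auto
  also have "\<dots> = (\<Sum>(i, g)\<in>I h \<times> ?G. \<phi> (us @ map2 q (i # g) vs))"
    by (simp add: sum.cartesian_product vs)
  also have "\<dots> = (\<Sum>g | list_all2 (\<lambda>i h. i \<in> I h) g (h # hs). \<phi> (us @ map2 q g vs))"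
    unfolding eq by (subst sum.reindex) (auto simp: inj_on_def case_prod_unfold)
  finally show ?case .
qed

text \<open>The scalar may depend on the vector in the slot, so that coordinates of that vector can
  be pulled out.\<close>

lemma alt_form_map2_scale_gen:
  assumes "\<phi> \<in> alt_forms (length us + length g)" "length vs = length g"
  shows "\<phi> (us @ map2 (\<lambda>i x. t i x *\<^sub>C q i x) g vs) =
      prod_list (map2 t g vs) * \<phi> (us @ map2 q g vs)"
  using assms
proof (induction g arbitrary: us vs)
  case (Cons i g)
  then obtain x vs' where vs: "vs = x # vs'" "length vs' = length g"
    by (cases vs) auto
  have "\<phi> (us @ map2 (\<lambda>i x. t i x *\<^sub>C q i x) (i # g) vs) =
      t i x * \<phi> ((us @ [q i x]) @ map2 (\<lambda>i x. t i x *\<^sub>C q i x) g vs')"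
    using Cons.prems vs by (simp add: alt_form_middle_scale)
  then show ?case
    using Cons.IH[of "us @ [q i x]" vs'] Cons.prems vs by simp
qed simp

lemma map2_fst: "length g = length vs \<Longrightarrow> map2 (\<lambda>i x. f i) g vs = map f g"
  by (rule nth_equalityI) auto

lemma alt_form_map2_scale:
  assumes "\<phi> \<in> alt_forms (length us + length g)" "length vs = length g"
  shows "\<phi> (us @ map2 (\<lambda>i x. t i *\<^sub>C q i x) g vs) = prod_list (map t g) * \<phi> (us @ map2 q g vs)"
  using alt_form_map2_scale_gen[OF assms, of "\<lambda>i x. t i" q] assms(2) by (simp add: map2_fst)

text \<open>Polarization: the form vanishes with \<open>x + y\<close> in both slots, and the two
  diagonal terms of the expansion vanish too.\<close>

lemma alt_form_swap:
  assumes \<phi>: "\<phi> \<in> alt_forms (length vs)" and ab: "a < length vs" "b < length vs" "a \<noteq> b"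
  shows "\<phi> (vs[a := y, b := x]) = - \<phi> (vs[a := x, b := y])"
proof -
  have *: "\<phi> (vs[a := z, b := z]) = 0" for z
    using \<phi> ab by (intro alt_form_eq[of _ _ a b]) auto
  have l: "\<phi> (vs[a := x + y, b := z]) = \<phi> (vs[a := x, b := z]) + \<phi> (vs[a := y, b := z])" for z
    using alt_form_add[of \<phi> "vs[b := z]" a x y] \<phi> ab by (simp add: list_update_swap[of a b])
  have "0 = \<phi> (vs[a := x + y, b := x + y])"
    by (simp add: *)
  also have "\<dots> = \<phi> (vs[a := x + y, b := x]) + \<phi> (vs[a := x + y, b := y])"
    using alt_form_add[of \<phi> "vs[a := x + y]" b x y] \<phi> ab by simp
  also have "\<dots> = \<phi> (vs[a := y, b := x]) + \<phi> (vs[a := x, b := y])"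
    by (simp add: l *)
  finally show ?thesis
    by (simp add: eq_neg_iff_add_eq_0)
qed

lemma permute_list_transpose:
  assumes "a < length vs" "b < length vs"
  shows "permute_list (Transposition.transpose a b) vs = vs[a := vs ! b, b := vs ! a]"
proof (rule nth_equalityI)
  have p: "Transposition.transpose a b permutes {..<length vs}"
    using assms by (intro permutes_swap_id) auto
  fix i assume "i < length (permute_list (Transposition.transpose a b) vs)"
  then show "permute_list (Transposition.transpose a b) vs ! i = vs[a := vs ! b, b := vs ! a] ! i"
    using assms by (auto simp: permute_list_nth[OF p] Transposition.transpose_def nth_list_update)
qed simp

lemma alt_form_transpose:
  assumes "\<phi> \<in> alt_forms (length vs)" "a < length vs" "b < length vs" "a \<noteq> b"
  shows "\<phi> (permute_list (Transposition.transpose a b) vs) = - \<phi> vs"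
  using alt_form_swap[OF assms, of "vs ! b" "vs ! a"] assms by (simp add: permute_list_transpose)

lemma alt_form_permute:
  assumes "p permutes {..<length vs}" "\<phi> \<in> alt_forms (length vs)"
  shows "\<phi> (permute_list p vs) = of_int (sign p) * \<phi> vs"
  using finite_lessThan[of "length vs"] assms(1)
proof (induction rule: permutes_rev_induct)
  case (swap a b p)
  have \<tau>: "Transposition.transpose a b permutes {..<length vs}"
    using swap by (intro permutes_swap_id) auto
  then have "\<phi> (permute_list (p \<circ> Transposition.transpose a b) vs) = - \<phi> (permute_list p vs)"
    using alt_form_transpose[of \<phi> "permute_list p vs" a b] assms(2) swap
        by (simp add: permute_list_compose)
  moreover have "sign (p \<circ> Transposition.transpose a b) = - sign p"
    using swap \<tau> by (subst sign_compose) (auto simp: sign_swap_id permutes_imp_permutation[OF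
        finite_lessThan])
  ultimately show ?case
    using swap by (simp add: o_def)
qed simp

lemma wedge_in_ext_power: "length vs = k \<Longrightarrow> wedge vs \<in> ext_power k"
  unfolding ext_power_def by (blast intro: complex_vector.span_base)

text \<open>The factor is a sign; proportionality is all that membership in a span requires.\<close>

lemma wedge_permute:
  assumes "mset xs = mset ys"
  shows "\<exists>c. wedge xs = c *\<^sub>C wedge ys"
proof -
  obtain p where p: "p permutes {..<length ys}" "permute_list p ys = xs"
    using mset_eq_permutation[OF assms] by metis
  have "length xs = length ys"
    using assms by (metis size_mset)
  then have "wedge xs = complex_of_int (sign p) *\<^sub>C wedge ys"
    using alt_form_permute[OF p(1)] p(2)
    by (auto simp: wedge_def fun_eq_iff scaleC_fun_def scaleC_complex_def)
  then show ?thesis ..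
qed

lemma alt_form_span:
  assumes \<phi>: "\<phi> \<in> alt_forms (length vs)" and q: "q < length vs"
    and "y \<in> cspan X" "X \<subseteq> (!) vs ` ({..<length vs} - {q})"
  shows "\<phi> (vs[q := y]) = 0"
  using assms(3)
proof (induction rule: complex_vector.span_induct_alt)
  case base
  then show ?case
    using \<phi> q by (intro alt_form_zero[of _ _ q]) auto
next
  case (step c x y)
  then obtain p where p: "p < length vs" "p \<noteq> q" "x = vs ! p"
    using assms(4) by auto
  then have "\<phi> (vs[q := x]) = 0"
    using \<phi> q by (intro alt_form_eq[of _ _ p q]) auto
  then show ?case
    using step \<phi> q by (simp add: alt_form_add alt_form_scale)
qed

text \<open>Among the entries in \<open>W\<close> either two coincide, or they are more vectors than
  the dimension of \<open>W\<close> allows to be independent, and one is a combination of the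
  others. Positions are counted instead of vectors so that repetitions are covered.\<close>

lemma alt_form_dependent:
  fixes vs :: "'v::hermitian_space list"
  assumes \<phi>: "\<phi> \<in> alt_forms (length vs)"
    and card: "cdim W < card {p. p < length vs \<and> vs ! p \<in> W}"
  shows "\<phi> vs = 0"
proof (rule ccontr)
  assume "\<phi> vs \<noteq> 0"
  then have dist: "distinct vs"
    using \<phi> alt_form_not_distinct by blast
  let ?I = "{p. p < length vs \<and> vs ! p \<in> W}" and ?X = "{x \<in> set vs. x \<in> W}"
  have "?X = (!) vs ` ?I"
    by (auto simp: in_set_conv_nth)
  moreover have "inj_on ((!) vs) ?I"
    using dist by (auto simp: inj_on_def nth_eq_iff_index_eq)
  ultimately have "cdim W < card ?X"
    using card by (simp add: card_image)
  then have "complex_vector.dependent ?X"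
    using hermitian.independent_card_le_dim[of ?X W] by auto
  then obtain x where x: "x \<in> ?X" "x \<in> cspan (?X - {x})"
    by (auto simp: complex_vector.dependent_def)
  then obtain q where q: "q < length vs" "vs ! q = x"
    by (auto simp: in_set_conv_nth)
  have "\<phi> (vs[q := x]) = 0"
  proof (rule alt_form_span[OF \<phi> q(1) x(2)])
    show "?X - {x} \<subseteq> (!) vs ` ({..<length vs} - {q})"
      using q by (fastforce simp: in_set_conv_nth)
  qed
  then show False
    using q \<open>\<phi> vs \<noteq> 0\<close> by (metis list_update_id)
qed

text \<open>The form is the determinant of the coordinates along \<open>es\<close> in a basis
  extending \<open>es\<close>, given by the Leibniz formula; at \<open>es\<close> itself the matrix
  is the identity.\<close>

lemma alt_form_nonzero_independent:
  fixes es :: "'v::complex_vector list"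
  assumes dist: "distinct es" and ind: "\<not> complex_vector.dependent (set es)"
  shows "\<exists>\<phi>\<in>alt_forms (length es). \<phi> es \<noteq> 0"
proof -
  let ?k = "length es"
  let ?B = "complex_vector.extend_basis (set es)"
  have B: "\<not> complex_vector.dependent ?B" "cspan ?B = UNIV" "set es \<subseteq> ?B"
    using complex_vector.independent_extend_basis[OF ind] complex_vector.span_extend_basis[OF ind]
      complex_vector.extend_basis_superset[OF ind] by auto
  define r where "r v j = complex_vector.representation ?B v (es ! j)" for v j
  have r_add: "r (x + y) j = r x j + r y j" and r_scale: "r (c *\<^sub>C x) j = c * r x j" for x y j c
    using B by (simp_all add: r_def complex_vector.representation_add
        complex_vector.representation_scale)
  define \<phi> where "\<phi> vs = (if length vs = ?k then
    \<Sum>p | p permutes {..<?k}. of_int (sign p) * (\<Prod>i<?k. r (vs ! i) (p i)) else 0)" for vs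
  \<comment> \<open>Each Leibniz term contains exactly one factor from slot \<open>m\<close>, which
    makes it linear in that slot.\<close>
  have upd: "(\<Prod>i<?k. r (vs[m := x] ! i) (p i)) = r x (p m) * (\<Prod>i\<in>{..<?k} - {m}. r (vs ! i) (p i))"
    if "length vs = ?k" "m < ?k" for vs m x p
  proof -
    have "(\<Prod>i<?k. r (vs[m := x] ! i) (p i)) =
      r (vs[m := x] ! m) (p m) * (\<Prod>i\<in>{..<?k} - {m}. r (vs[m := x] ! i) (p i))"
      using that by (intro prod.remove) auto
    also have "(\<Prod>i\<in>{..<?k} - {m}. r (vs[m := x] ! i) (p i)) = (\<Prod>i\<in>{..<?k} - {m}. r (vs ! i) (p i))"
      by (intro prod.cong) auto
    finally show ?thesis
      using that by simp
  qed
  have "\<phi> \<in> alt_forms ?k"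
    unfolding alt_forms_def
  proof (intro CollectI conjI allI impI; (elim conjE)?)
    fix vs :: "'v list" and i x y assume "length vs = ?k" "i < ?k"
    then show "\<phi> (vs[i := x + y]) = \<phi> (vs[i := x]) + \<phi> (vs[i := y])"
      by (simp add: \<phi>_def upd r_add algebra_simps sum.distrib)
  next
    fix vs :: "'v list" and i c x assume "length vs = ?k" "i < ?k"
    then show "\<phi> (vs[i := c *\<^sub>C x]) = c * \<phi> (vs[i := x])"
      by (simp add: \<phi>_def upd r_scale sum_distrib_left algebra_simps)
  next
    fix vs :: "'v list" and a b assume vs: "length vs = ?k" "a < b" "b < ?k" "vs ! a = vs ! b"
    let ?\<tau> = "Transposition.transpose a b"
    have \<tau>: "?\<tau> permutes {..<?k}"
      using vs by (intro permutes_swap_id) auto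
    \<comment> \<open>Exchanging two equal slots only reorders the factors, while the sign of the
      permutation flips; hence the sum equals its own negative.\<close>
    have prod: "(\<Prod>i<?k. r (vs ! i) ((p \<circ> ?\<tau>) i)) = (\<Prod>i<?k. r (vs ! i) (p i))" for p
    proof -
      have "(\<Prod>i<?k. r (vs ! i) (p i)) = (\<Prod>i<?k. r (vs ! (?\<tau> i)) (p (?\<tau> i)))"
        using prod.permute[OF \<tau>, of "\<lambda>i. r (vs ! i) (p i)"] by (simp add: o_def)
      moreover have "vs ! (?\<tau> i) = vs ! i" for i
        using vs by (simp add: Transposition.transpose_def)
      ultimately show ?thesis
        by simp
    qed
    have "\<phi> vs = (\<Sum>p | p permutes {..<?k}. of_int (sign (p \<circ> ?\<tau>)) *
        (\<Prod>i<?k. r (vs ! i) ((p \<circ> ?\<tau>) i)))"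
      using vs sum_permutations_compose_right[OF \<tau>, of "\<lambda>p. of_int (sign p) *
          (\<Prod>i<?k. r (vs ! i) (p i))"]
      by (simp add: \<phi>_def)
    also have "\<dots> = (\<Sum>p | p permutes {..<?k}. - (of_int (sign p) * (\<Prod>i<?k. r (vs ! i) (p i))))"
    proof (rule sum.cong[OF refl])
      fix p assume "p \<in> {p. p permutes {..<?k}}"
      then have "sign (p \<circ> ?\<tau>) = - sign p"
        using \<tau> vs
        by (subst sign_compose) (auto simp: sign_swap_id permutes_imp_permutation[OF
            finite_lessThan])
      then show "of_int (sign (p \<circ> ?\<tau>)) * (\<Prod>i<?k. r (vs ! i) ((p \<circ> ?\<tau>) i)) =
          - (of_int (sign p) * (\<Prod>i<?k. r (vs ! i) (p i)))"
        unfolding prod by simp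
    qed
    also have "\<dots> = - \<phi> vs"
      using vs by (simp add: \<phi>_def sum_negf)
    finally show "\<phi> vs = 0"
      by simp
  qed (simp add: \<phi>_def)
  \<comment> \<open>A permutation other than the identity moves some \<open>i\<close>, and the
    coordinate of \<open>es ! i\<close> along \<open>es ! p i\<close> is then zero.\<close>
  moreover have "\<phi> es = (\<Sum>p\<in>{id}. of_int (sign p) * (\<Prod>i<?k. r (es ! i) (p i)))"
    unfolding \<phi>_def if_P[OF refl]
  proof (rule sum.mono_neutral_right)
    show "\<forall>p\<in>{p. p permutes {..<?k}} - {id}. of_int (sign p) * (\<Prod>i<?k. r (es ! i) (p i)) = 0"
    proof
      fix p assume p: "p \<in> {p. p permutes {..<?k}} - {id}"
      then obtain i where i: "p i \<noteq> i"
        by (auto simp: fun_eq_iff)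
      then have "i < ?k"
        using p permutes_not_in by fastforce
      moreover from this have "p i < ?k"
        using p permutes_in_image by fastforce
      ultimately have "r (es ! i) (p i) = 0"
        using i dist B by (auto simp: r_def complex_vector.representation_basis nth_eq_iff_index_eq
            subset_iff)
      then show "of_int (sign p) * (\<Prod>i<?k. r (es ! i) (p i)) = 0"
        using \<open>i < ?k\<close> by (auto intro!: prod_zero)
    qed
  qed (auto simp: finite_permutations permutes_id)
  moreover have "(\<Prod>i<?k. r (es ! i) i) = 1"
    using B by (intro prod.neutral) (auto simp: r_def complex_vector.representation_basis
        subset_iff)
  ultimately show ?thesis
    by (intro bexI[of _ \<phi>]) auto
qed

section \<open>Exterior powers as sums over words\<close>

lemma sum_fun_apply: "(\<Sum>i\<in>I. f i) x = (\<Sum>i\<in>I. f i x)"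
  by (induction I rule: infinite_finite_induct) auto

definition words :: "nat \<Rightarrow> nat \<Rightarrow> nat list set"
  where "words l k = {g. set g \<subseteq> {..<l} \<and> length g = k}"

lemma finite_words [simp]: "finite (words l k)"
  by (simp add: words_def finite_lists_length_eq)

text \<open>
  Expanding \<open>Q_(g_1) v_1 \<and> ... \<and> Q_(g_k) v_k\<close> over words \<open>g\<close> separates the
  summands of the exterior power. The weight \<open>s\<close> may depend only on the letters of
  \<open>g\<close> and not on their order; this is what keeps \<open>word_form\<close> alternating.
\<close>

definition word_form :: "nat \<Rightarrow> nat \<Rightarrow> (nat multiset \<Rightarrow> complex) \<Rightarrow> (nat \<Rightarrow> 'v \<Rightarrow> 'v) \<Rightarrow>
    ('v list \<Rightarrow> complex) \<Rightarrow> 'v list \<Rightarrow> complex"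
  where "word_form k l s Q \<phi> vs =
    (if length vs = k then \<Sum>g\<in>words l k. s (mset g) * \<phi> (map2 Q g vs) else 0)"

text \<open>Transposing a map on forms, as in \<open>ext_map\<close>, gives linearity in
  \<open>\<xi>\<close> at once and avoids prescribing values on decomposable elements, which would
  have to be checked for consistency.\<close>

definition ext_word :: "nat \<Rightarrow> nat \<Rightarrow> (nat multiset \<Rightarrow> complex) \<Rightarrow> (nat \<Rightarrow> 'v \<Rightarrow> 'v) \<Rightarrow>
    (('v::complex_vector list \<Rightarrow> complex) \<Rightarrow> complex) \<Rightarrow> (('v list \<Rightarrow> complex) \<Rightarrow> complex)"
  where "ext_word k l s Q = hom_restrict
    (\<lambda>\<xi>. hom_restrict (\<lambda>\<phi>. \<xi> (word_form k l s Q \<phi>)) (alt_forms k)) (ext_power k)"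

lemma map2_update:
  "length g = length vs \<Longrightarrow> i < length vs \<Longrightarrow>
    map2 Q g (vs[i := x]) = (map2 Q g vs)[i := Q (g ! i) x]"
  by (rule nth_equalityI) (auto simp: nth_list_update)

lemma words_nth: "g \<in> words l k \<Longrightarrow> i < k \<Longrightarrow> g ! i < l"
  by (auto simp: words_def subset_iff)

lemma words_length: "g \<in> words l k \<Longrightarrow> length g = k"
  by (simp add: words_def)

lemma words_permute:
  assumes "p permutes {..<k}" "g \<in> words l k"
  shows "permute_list p g \<in> words l k"
proof -
  have "set (permute_list p g) = set g"
    using assms by (intro set_permute_list) (simp add: words_def)
  then show ?thesis
    using assms by (simp add: words_def)
qed

lemma word_form_alt:
  assumes Q: "\<And>i. i < l \<Longrightarrow> Q i \<in> chom UNIV UNIV" and \<phi>: "\<phi> \<in> alt_forms k"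
  shows "word_form k l s Q \<phi> \<in> alt_forms k"
  unfolding alt_forms_def
proof (intro CollectI conjI allI impI; (elim conjE)?)
  fix vs :: "'a list" and i x y
  assume vs: "length vs = k" "i < k"
  have "\<phi> (map2 Q g (vs[i := x + y])) = \<phi> (map2 Q g (vs[i := x])) + \<phi> (map2 Q g (vs[i := y]))"
    if "g \<in> words l k" for g
  proof -
    have "g ! i < l" "length g = k"
      using that vs by (auto simp: words_nth words_length)
    then show ?thesis
      using vs \<phi> chom_add[OF Q, of "g ! i"] by (simp add: map2_update alt_form_add)
  qed
  then show "word_form k l s Q \<phi> (vs[i := x + y]) =
      word_form k l s Q \<phi> (vs[i := x]) + word_form k l s Q \<phi> (vs[i := y])"
    using vs by (simp add: word_form_def sum.distrib[symmetric] algebra_simps cong: sum.cong)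
next
  fix vs :: "'a list" and i x c
  assume vs: "length vs = k" "i < k"
  have "\<phi> (map2 Q g (vs[i := c *\<^sub>C x])) = c * \<phi> (map2 Q g (vs[i := x]))" if "g \<in> words l k" for g
  proof -
    have "g ! i < l" "length g = k"
      using that vs by (auto simp: words_nth words_length)
    then show ?thesis
      using vs \<phi> chom_scale[OF Q, of "g ! i"] by (simp add: map2_update alt_form_scale)
  qed
  then show "word_form k l s Q \<phi> (vs[i := c *\<^sub>C x]) = c * word_form k l s Q \<phi> (vs[i := x])"
    using vs by (simp add: word_form_def sum_distrib_left algebra_simps cong: sum.cong)
next
  fix vs :: "'a list" and a b
  assume vs: "length vs = k" "a < b" "b < k" "vs ! a = vs ! b"
  \<comment> \<open>With equal vectors in slots \<open>a\<close> and \<open>b\<close>, exchanging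
    the letters at these places is an involution on words. It keeps the multiset, hence the weight,
    and negates the value of the form.\<close>
  let ?p = "permute_list (Transposition.transpose a b)"
  have \<tau>: "Transposition.transpose a b permutes {..<k}"
    using vs by (intro permutes_swap_id) auto
  have pvs: "?p vs = vs"
    using vs by (simp add: permute_list_transpose) (metis list_update_id)
  have pp: "?p (?p g) = g" if "g \<in> words l k" for g
    using that \<tau> permute_list_compose[of "Transposition.transpose a b" g "Transposition.transpose a
        b"]
    by (simp add: words_def)
  have "(\<Sum>g\<in>words l k. s (mset g) * \<phi> (map2 Q g vs)) =
      (\<Sum>g\<in>words l k. s (mset (?p g)) * \<phi> (map2 Q (?p g) vs))"
    by (rule sum.reindex_bij_witness[of _ ?p ?p]) (auto simp: pp words_permute[OF \<tau>])
  also have "\<dots> = (\<Sum>g\<in>words l k. - (s (mset g) * \<phi> (map2 Q g vs)))"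
  proof (rule sum.cong[OF refl])
    fix g assume g: "g \<in> words l k"
    then have l: "length g = k" "mset (?p g) = mset g"
      using \<tau> by (auto simp: words_def)
    have "map2 Q (?p g) (?p vs) = ?p (map2 Q g vs)"
      using l vs(1) \<tau> by (simp add: permute_list_zip permute_list_map)
    then have "\<phi> (map2 Q (?p g) vs) = - \<phi> (map2 Q g vs)"
      using \<phi> l vs pvs alt_form_transpose[of \<phi> "map2 Q g vs" a b] by simp
    then show "s (mset (?p g)) * \<phi> (map2 Q (?p g) vs) = - (s (mset g) * \<phi> (map2 Q g vs))"
      using l by simp
  qed
  also have "\<dots> = - (\<Sum>g\<in>words l k. s (mset g) * \<phi> (map2 Q g vs))"
    by (simp add: sum_negf)
  finally show "word_form k l s Q \<phi> vs = 0"
    using vs by (simp add: word_form_def)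
qed (simp add: word_form_def)

lemma ext_word_wedge:
  assumes Q: "\<And>i. i < l \<Longrightarrow> Q i \<in> chom UNIV UNIV" and vs: "length vs = k"
  shows "ext_word k l s Q (wedge vs) = (\<Sum>g\<in>words l k. s (mset g) *\<^sub>C wedge (map2 Q g vs))"
proof
  fix \<phi>
  have "wedge vs (word_form k l s Q \<phi>) = (\<Sum>g\<in>words l k. s (mset g) * \<phi> (map2 Q g vs))"
    if "\<phi> \<in> alt_forms k"
    using word_form_alt[of l Q, OF Q that] vs by (simp add: wedge_def word_form_def)
  moreover have "(\<Sum>g\<in>words l k. s (mset g) *\<^sub>C wedge (map2 Q g vs)) \<phi> =
      (\<Sum>g\<in>words l k. s (mset g) * (if \<phi> \<in> alt_forms k then \<phi> (map2 Q g vs) else 0))"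
    using vs by (auto simp: sum_fun_apply scaleC_fun_def scaleC_complex_def wedge_def words_def
        intro!: sum.cong)
  ultimately show "ext_word k l s Q (wedge vs) \<phi> =
      (\<Sum>g\<in>words l k. s (mset g) *\<^sub>C wedge (map2 Q g vs)) \<phi>"
    using wedge_in_ext_power[OF vs] by (auto simp: ext_word_def hom_restrict_def)
qed

lemma ext_word_wedge_apply:
  assumes "\<And>i. i < l \<Longrightarrow> Q i \<in> chom UNIV UNIV" and "length vs = k" and "\<phi> \<in> alt_forms k"
  shows "ext_word k l s Q (wedge vs) \<phi> = (\<Sum>g\<in>words l k. s (mset g) * \<phi> (map2 Q g vs))"
proof -
  have "ext_word k l s Q (wedge vs) = (\<Sum>g\<in>words l k. s (mset g) *\<^sub>C wedge (map2 Q g vs))"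
    using assms(1,2) by (rule ext_word_wedge)
  then show ?thesis
    using assms(2,3)
    by (auto simp: sum_fun_apply scaleC_fun_def scaleC_complex_def wedge_def words_length intro!:
        sum.cong)
qed

section \<open>Linear maps determined by their values on a spanning set\<close>

lemma ext_power_subspace: "csubspace (ext_power k)"
  by (simp add: ext_power_def)

lemma chom_in_subspace:
  assumes f: "f \<in> chom W UNIV" and W: "csubspace W" "X \<subseteq> W" and Y: "csubspace Y"
    and X: "\<And>x. x \<in> X \<Longrightarrow> f x \<in> Y" and x: "x \<in> cspan X"
  shows "f x \<in> Y"
proof -
  have "csubspace {x \<in> W. f x \<in> Y}"
    using W(1) Y f by (auto simp: complex_vector.subspace_def chom_add chom_scale chom_zero)
  then have "cspan X \<subseteq> {x \<in> W. f x \<in> Y}"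
    using W(2) X by (intro complex_vector.span_minimal) auto
  then show ?thesis
    using x by blast
qed

lemma chom_eq_on_span:
  assumes f: "f \<in> chom W UNIV" and g: "g \<in> chom W UNIV" and W: "csubspace W" "X \<subseteq> W"
    and X: "\<And>x. x \<in> X \<Longrightarrow> f x = g x" and x: "x \<in> cspan X"
  shows "f x = g x"
proof -
  have "csubspace {x \<in> W. f x = g x}"
    using W(1) f g
    by (auto simp: complex_vector.subspace_def chom_add chom_scale chom_zero[OF f] chom_zero[OF g])
  then have "cspan X \<subseteq> {x \<in> W. f x = g x}"
    using W(2) X by (intro complex_vector.span_minimal) auto
  then show ?thesis
    using x by blast
qed

lemma chom_mono: "f \<in> chom W X \<Longrightarrow> X \<subseteq> Y \<Longrightarrow> f \<in> chom W Y"
  by (auto simp: chom_def)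

text \<open>Linearity in \<open>\<xi>\<close> comes from evaluation being pointwise and holds for
  every \<open>h\<close>.\<close>

lemma hom_restrict_transpose_chom:
  fixes h :: "('v::complex_vector list \<Rightarrow> complex) \<Rightarrow> 'v list \<Rightarrow> complex"
  shows "hom_restrict (\<lambda>\<xi>. hom_restrict (\<lambda>\<phi>. \<xi> (h \<phi>)) S) (ext_power k) \<in> chom (ext_power k) UNIV"
  using complex_vector.subspace_add[OF ext_power_subspace[of k]]
    complex_vector.subspace_scale[OF ext_power_subspace[of k]]
  by (auto simp: chom_def hom_restrict_def scaleC_fun_def scaleC_complex_def fun_eq_iff)

lemma ext_map_chom_UNIV: "ext_map k f \<in> chom (ext_power k) UNIV"
  unfolding ext_map_def by (rule hom_restrict_transpose_chom)

lemma ext_word_chom: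
  assumes Q: "\<And>i. i < l \<Longrightarrow> Q i \<in> chom UNIV UNIV"
  shows "ext_word k l s Q \<in> chom (ext_power k) (ext_power k)"
proof -
  have u: "ext_word k l s Q \<in> chom (ext_power k) UNIV"
    unfolding ext_word_def by (rule hom_restrict_transpose_chom)
  have "ext_word k l s Q \<xi> \<in> ext_power k" if "\<xi> \<in> ext_power k" for \<xi>
  proof (rule chom_in_subspace[OF u ext_power_subspace _ ext_power_subspace])
    show "\<xi> \<in> cspan {wedge vs |vs :: 'a list. length vs = k}"
      using that by (simp add: ext_power_def)
    fix \<eta> assume "\<eta> \<in> {wedge vs |vs :: 'a list. length vs = k}"
    then obtain vs :: "'a list" where vs: "\<eta> = wedge vs" "length vs = k"
      by blast
    have "(\<Sum>g\<in>words l k. s (mset g) *\<^sub>C wedge (map2 Q g vs)) \<in> ext_power k"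
      using vs(2) by (intro complex_vector.subspace_sum complex_vector.subspace_scale
          ext_power_subspace
          wedge_in_ext_power) (simp add: words_def)
    then show "ext_word k l s Q \<eta> \<in> ext_power k"
      using ext_word_wedge[OF Q vs(2)] vs by simp
  qed (auto intro: wedge_in_ext_power)
  then show ?thesis
    using u by (simp add: chom_def)
qed

text \<open>
  A summand of the exterior power is recorded by the numbers of letters below each \<open>a\<close>.
  They never exceed \<open>min k (flag_rk A a)\<close> on a summand that is not zero, and the top
  summand is the one attaining this bound for all \<open>a\<close>.
\<close>

definition low :: "nat multiset \<Rightarrow> nat \<Rightarrow> nat"
  where "low M a = size (filter_mset (\<lambda>i. i < a) M)"

definition flag_rk :: "('v::hermitian_space \<Rightarrow> 'v) list \<Rightarrow> nat \<Rightarrow> nat"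
  where "flag_rk A a = (\<Sum>i<a. rk A i)"

definition top_weight :: "nat \<Rightarrow> ('v::hermitian_space \<Rightarrow> 'v) list \<Rightarrow> nat multiset \<Rightarrow> complex"
  where "top_weight k A M = (if \<forall>a\<le>length A. low M a = min k (flag_rk A a) then 1 else 0)"

lemma flag_rk_Suc [simp]: "flag_rk A (Suc a) = flag_rk A a + rk A a"
  and flag_rk_0 [simp]: "flag_rk A 0 = 0"
  by (simp_all add: flag_rk_def)

lemma flag_rk_mono: "a \<le> b \<Longrightarrow> flag_rk A a \<le> flag_rk A b"
  unfolding flag_rk_def by (rule sum_mono2) auto

section \<open>The top summand: degrees, partial sums and words\<close>

lemma top_index:
  assumes k: "1 \<le> k" "k \<le> flag_rk A (length A)"
  shows "top_index k A < length A" "flag_rk A (top_index k A) < k" "k \<le> flag_rk A (Suc (top_index k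
      A))"
proof -
  define j where "j = (LEAST j. k \<le> flag_rk A (Suc j))"
  have ne: "length A \<noteq> 0"
    using k by (cases "length A") auto
  then have ex: "k \<le> flag_rk A (Suc (length A - 1))"
    using k by simp
  have 1: "k \<le> flag_rk A (Suc j)"
    unfolding j_def by (rule LeastI[of _ "length A - 1"]) (use ex in simp)
  have 2: "j < length A"
    using Least_le[of "\<lambda>j. k \<le> flag_rk A (Suc j)", OF ex] ne unfolding j_def by linarith
  have 3: "flag_rk A j < k"
  proof (cases j)
    case (Suc i)
    then show ?thesis
      using not_less_Least[of i "\<lambda>j. k \<le> flag_rk A (Suc j)"] unfolding j_def[symmetric] by simp
  qed (use k in simp)
  have "top_index k A = j"
    unfolding top_index_def lessThan_Suc_atMost[symmetric] flag_rk_def[symmetric]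
  proof (rule the_equality)
    fix i assume i: "i < length A \<and> flag_rk A i < k \<and> k \<le> flag_rk A (Suc i)"
    show "i = j"
      using i 1 2 3 flag_rk_mono[of "Suc i" j A] flag_rk_mono[of "Suc j" i A]
      by (meson Suc_leI dual_order.trans linorder_neqE_nat not_le)
  qed (use 1 2 3 in blast)
  then show "top_index k A < length A" "flag_rk A (top_index k A) < k" "k \<le> flag_rk A (Suc
      (top_index k A))"
    using 1 2 3 by auto
qed

text \<open>Truncated subtraction merges the three cases of the definition: before the top index the
  rank is the minimum, and beyond it \<open>k - flag_rk A i\<close> is zero.\<close>

lemma top_degrees_nth:
  assumes k: "1 \<le> k" "k \<le> flag_rk A (length A)" and i: "i < length A"
  shows "top_degrees k A ! i = min (rk A i) (k - flag_rk A i)"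
proof -
  note t = top_index[OF k]
  consider "i < top_index k A" | "i = top_index k A" | "i > top_index k A"
    by linarith
  then show ?thesis
  proof cases
    case 1
    then show ?thesis
      using t i flag_rk_mono[of "Suc i" "top_index k A" A] by (simp add: top_degrees_def Let_def)
  next
    case 2
    then show ?thesis
      using t i by (simp add: top_degrees_def Let_def flag_rk_def)
  next
    case 3
    then show ?thesis
      using t i flag_rk_mono[of "Suc (top_index k A)" i A] by (simp add: top_degrees_def Let_def)
  qed
qed

lemma length_top_degrees [simp]: "length (top_degrees k A) = length A"
  by (simp add: top_degrees_def Let_def)

text \<open>Degrees are determined by their partial sums. The top degrees fill the blocks greedily,
  so their partial sums are the largest that the ranks and \<open>k\<close> permit.\<close>

lemma top_degrees_iff:
  assumes k: "1 \<le> k" "k \<le> flag_rk A (length A)" and \<kappa>: "length \<kappa> = length A"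
  shows "(\<forall>a\<le>length A. (\<Sum>i<a. \<kappa> ! i) = min k (flag_rk A a)) \<longleftrightarrow> \<kappa> = top_degrees k A"
proof
  assume *: "\<forall>a\<le>length A. (\<Sum>i<a. \<kappa> ! i) = min k (flag_rk A a)"
  show "\<kappa> = top_degrees k A"
  proof (rule nth_equalityI)
    fix i assume "i < length \<kappa>"
    then show "\<kappa> ! i = top_degrees k A ! i"
      using *[rule_format, of i] *[rule_format, of "Suc i"] \<kappa>
      by (auto simp: top_degrees_nth[OF k] min_def split: if_splits)
  qed (simp add: \<kappa>)
next
  assume *: "\<kappa> = top_degrees k A"
  have "(\<Sum>i<a. \<kappa> ! i) = min k (flag_rk A a)" if "a \<le> length A" for a
    using that
  proof (induction a)
    case (Suc a)
    then show ?case
      by (auto simp: * top_degrees_nth[OF k] min_def split: if_splits)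
  qed simp
  then show "\<forall>a\<le>length A. (\<Sum>i<a. \<kappa> ! i) = min k (flag_rk A a)"
    by blast
qed

text \<open>For a tuple listing \<open>\<kappa> ! i\<close> vectors of each block \<open>i\<close>,
  in the order of the blocks, the letter at a position names the block of the vector there.\<close>

definition block_word :: "nat list \<Rightarrow> nat list"
  where "block_word \<kappa> = concat (map (\<lambda>i. replicate (\<kappa> ! i) i) [0..<length \<kappa>])"

lemma low_mset: "low (mset xs) a = length (filter (\<lambda>i. i < a) xs)"
  unfolding low_def by (metis mset_filter size_mset)

lemma low_block_word:
  assumes "a \<le> length \<kappa>"
  shows "low (mset (block_word \<kappa>)) a = (\<Sum>i<a. \<kappa> ! i)"
proof -
  have "low (mset (concat (map (\<lambda>i. replicate (\<kappa> ! i) i) [0..<l]))) a = (\<Sum>i<min a l. \<kappa> ! i)" for l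
    unfolding low_mset by (induction l) (auto simp: min_def le_Suc_eq not_le less_Suc_eq_le)
  then show ?thesis
    using assms by (simp add: block_word_def min_def)
qed

lemma top_weight_block_word:
  assumes k: "1 \<le> k" "k \<le> flag_rk A (length A)" and \<kappa>: "length \<kappa> = length A"
  shows "top_weight k A (mset (block_word \<kappa>)) = (if \<kappa> = top_degrees k A then 1 else 0)"
  using top_degrees_iff[OF k \<kappa>] low_block_word[of _ \<kappa>] \<kappa> by (simp add: top_weight_def)

lemma length_block_word: "length (block_word \<kappa>) = sum_list \<kappa>"
  by (simp add: block_word_def length_concat comp_def map_nth)

lemma block_word_in_words: "block_word \<kappa> \<in> words (length \<kappa>) (sum_list \<kappa>)"
  unfolding words_def by (auto simp: length_block_word) (auto simp: block_word_def)

lemma list_all2_concat: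
  "list_all2 (list_all2 P) xss yss \<Longrightarrow> list_all2 P (concat xss) (concat yss)"
  by (induction rule: list_all2_induct) (auto intro: list_all2_appendI)

lemma list_all2_block_word:
  assumes "length us = length \<kappa>" "\<And>i. i < length \<kappa> \<Longrightarrow> length (us ! i) = \<kappa> ! i \<and> set (us ! i) \<subseteq> W i"
  shows "list_all2 (\<lambda>i x. x \<in> W i) (block_word \<kappa>) (concat us)"
  unfolding block_word_def using assms
  by (intro list_all2_concat) (auto simp: list_all2_conv_all_nth subset_iff)

lemma wedge_zero:
  assumes "0 \<in> set vs"
  shows "wedge vs = 0"
  using assms alt_form_zero by (fastforce simp: wedge_def in_set_conv_nth)

lemma list_all2_map2_eq:
  "list_all2 P hs xs \<Longrightarrow> (\<And>h x. P h x \<Longrightarrow> f h x = g x) \<Longrightarrow> map2 f hs xs = map g xs"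
  by (induction rule: list_all2_induct) auto

text \<open>A word other than \<open>block_word \<kappa>\<close> applies the map of a foreign block
  to some vector and makes that entry zero, so a single term of the sum survives.\<close>

lemma ext_word_block:
  assumes A: "A \<in> MM" and us: "length us = length A"
    "\<And>i. i < length A \<Longrightarrow> length (us ! i) = \<kappa> ! i \<and> set (us ! i) \<subseteq> perp_space A i"
    and \<kappa>: "length \<kappa> = length A" "sum_list \<kappa> = k"
  shows "ext_word k (length A) s (block_map A) (wedge (concat us)) =
    s (mset (block_word \<kappa>)) *\<^sub>C wedge (map (sum_map A) (concat us))"
proof -
  let ?h = "block_word \<kappa>" and ?vs = "concat us" and ?l = "length A"
  have h: "?h \<in> words ?l k"
    using block_word_in_words[of \<kappa>] \<kappa> by simp
  have "list_all2 (\<lambda>i x. x \<in> perp_space A i) ?h ?vs"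
    using us \<kappa> by (intro list_all2_block_word) auto
  moreover from this have len: "length ?vs = k"
    using words_length[OF h] list_all2_lengthD by fastforce
  ultimately have P: "list_all2 (\<lambda>i x. i < ?l \<and> x \<in> perp_space A i) ?h ?vs"
    using words_nth[OF h] words_length[OF h] by (simp add: list_all2_conv_all_nth)
  have "wedge (map2 (block_map A) g ?vs) = 0" if g: "g \<in> words ?l k" "g \<noteq> ?h" for g
  proof -
    obtain p where p: "p < k" "g ! p \<noteq> ?h ! p"
      using g h by (metis nth_equalityI words_length)
    then have "block_map A (g ! p) (?vs ! p) = 0"
      using P g words_nth[OF g(1)] words_length[OF h]
          by (auto simp: list_all2_conv_all_nth block_map_perp_eq[OF A])
    then have "map2 (block_map A) g ?vs ! p = 0"
      using p len words_length[OF g(1)] by simp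
    then show ?thesis
      using p len words_length[OF g(1)] nth_mem[of p "map2 (block_map A) g ?vs"]
          by (intro wedge_zero) simp
  qed
  then have "(\<Sum>g\<in>words ?l k. s (mset g) *\<^sub>C wedge (map2 (block_map A) g ?vs)) =
      (\<Sum>g\<in>{?h}. s (mset g) *\<^sub>C wedge (map2 (block_map A) g ?vs))"
    using h by (intro sum.mono_neutral_right) auto
  moreover have "map2 (block_map A) ?h ?vs = map (sum_map A) ?vs"
    using P
  proof (rule list_all2_map2_eq)
    fix i x assume "i < ?l \<and> x \<in> perp_space A i"
    then show "block_map A i x = sum_map A x"
      using block_map_perp_eq[OF A, of i i x] sum_map_perp[OF A, of i x] by simp
  qed
  ultimately show ?thesis
    using ext_word_wedge[OF block_map_chom[OF A] len] by simp
qed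

lemma ext_summand_subset:
  assumes "sum_list \<kappa> = k"
  shows "{wedge (concat us) | us. length us = length \<kappa> \<and>
    (\<forall>i<length \<kappa>. length (us ! i) = \<kappa> ! i \<and> set (us ! i) \<subseteq> W i)} \<subseteq> ext_power k"
proof clarify
  fix us assume us: "length us = length \<kappa>" "\<forall>i<length \<kappa>. length (us ! i) = \<kappa> ! i \<and>
      set (us ! i) \<subseteq> W i"
  then have "map length us = \<kappa>"
    by (intro nth_equalityI) auto
  then show "wedge (concat us) \<in> ext_power k"
    using assms by (intro wedge_in_ext_power) (simp add: length_concat)
qed

text \<open>Sorting tagged entries by their tag only permutes them, as long as all tags are below
  \<open>l\<close>.\<close>

lemma mset_concat_filter:
  "mset (concat (map (\<lambda>i. filter (\<lambda>p. fst p = i) zs) [0..<l])) = mset (filter (\<lambda>p. fst p < l) zs)"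
proof (induction l)
  case (Suc l)
  have "mset (filter (\<lambda>p. fst p < l) zs) + mset (filter (\<lambda>p. fst p = l) zs) =
      mset (filter (\<lambda>p. fst p < Suc l) zs)"
    by (rule multiset_eqI) (auto simp: count_filter_mset less_Suc_eq)
  then show ?case
    using Suc by simp
qed simp

text \<open>Splitting every slot into block components and expanding gives wedges whose entries each
  lie in one block. Sorting the entries by block costs a scalar and yields a generator of some
  summand.\<close>

lemma wedge_span_summands:
  assumes A: "A \<in> MM" and len: "length vs = k"
  shows "wedge vs \<in> cspan (\<Union>\<kappa>\<in>{\<kappa>. length \<kappa> = length A \<and>
      sum_list \<kappa> = k}. ext_summand (perp_space A) \<kappa>)"
    (is "_ \<in> cspan ?U")
proof -
  let ?l = "length A"
  have eq: "wedge vs = (\<Sum>g\<in>words ?l k. wedge (map2 (block_proj A) g vs))"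
  proof
    fix \<phi>
    have "wedge vs \<phi> = (\<Sum>g\<in>words ?l k. \<phi> (map2 (block_proj A) g vs))" if \<phi>: "\<phi> \<in> alt_forms k"
    proof -
      \<comment> \<open>The labels are dummies, since every slot is expanded over the same
        blocks.\<close>
      have "map2 (\<lambda>h x. \<Sum>i<?l. block_proj A i x) (replicate k ()) vs = vs"
        using len by (intro nth_equalityI) (auto simp: sum_block_proj[OF A])
      moreover have "{g. list_all2 (\<lambda>i h. i \<in> {..<?l}) g (replicate k ())} = words ?l k"
        by (auto simp: words_def list_all2_conv_all_nth subset_iff in_set_conv_nth)
      ultimately show ?thesis
        using alt_form_map2_sum[of \<phi> "[]" "replicate k ()" vs "\<lambda>_. {..<?l}" "block_proj A"] \<phi> len
        by (simp add: wedge_def)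
    qed
    then show "wedge vs \<phi> = (\<Sum>g\<in>words ?l k. wedge (map2 (block_proj A) g vs)) \<phi>"
      using len by (auto simp: sum_fun_apply wedge_def words_length intro!: sum.cong sum.neutral)
  qed
  have "wedge (map2 (block_proj A) g vs) \<in> cspan ?U" if g: "g \<in> words ?l k" for g
  proof -
    define zs where "zs = zip g (map2 (block_proj A) g vs)"
    define us where "us = map (\<lambda>i. map snd (filter (\<lambda>p. fst p = i) zs)) [0..<?l]"
    have zs: "map snd zs = map2 (block_proj A) g vs" "\<And>p. p \<in> set zs \<Longrightarrow>
        fst p < ?l \<and> snd p \<in> perp_space A (fst p)"
      using len words_length[OF g] words_nth[OF g] block_proj_perp[OF A]
          by (auto simp: zs_def in_set_conv_nth)
    have "concat us = map snd (concat (map (\<lambda>i. filter (\<lambda>p. fst p = i) zs) [0..<?l]))"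
      by (simp add: us_def map_concat comp_def)
    then have "mset (concat us) = image_mset snd (mset (filter (\<lambda>p. fst p < ?l) zs))"
      by (simp only: mset_map mset_concat_filter)
    also have "filter (\<lambda>p. fst p < ?l) zs = zs"
      using zs by (auto simp: filter_id_conv)
    finally have ms: "mset (map2 (block_proj A) g vs) = mset (concat us)"
      by (simp only: zs(1)[symmetric] mset_map)
    then have "length (concat us) = k"
      using mset_eq_length[OF ms] len words_length[OF g] by simp
    then have sum: "sum_list (map length us) = k"
      by (simp add: length_concat)
    have "wedge (concat us) \<in> ext_summand (perp_space A) (map length us)"
      unfolding ext_summand_def
    proof (intro complex_vector.span_base CollectI exI[of _ us] conjI allI impI refl)
      fix i assume "i < length (map length us)"
      then show "set (us ! i) \<subseteq> perp_space A i" "length (us ! i) = map length us ! i"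
        using zs(2) by (auto simp: us_def)
    qed simp
    then have "wedge (concat us) \<in> ?U"
      using sum by (intro UN_I[of "map length us"]) (auto simp: us_def)
    then have "wedge (concat us) \<in> cspan ?U"
      by (rule complex_vector.span_base)
    moreover obtain c where "wedge (map2 (block_proj A) g vs) = c *\<^sub>C wedge (concat us)"
      using wedge_permute[OF ms] by blast
    ultimately show ?thesis
      by (simp add: complex_vector.span_scale)
  qed
  then show ?thesis
    unfolding eq by (rule complex_vector.span_sum)
qed

text \<open>This resolves the definite description. On generators of the summands the word sum
  reduces to one term, whose weight is 1 on the top summand and 0 on the others; uniqueness holds
  because the summands span the exterior power.\<close>

lemma ext_seq_eq:
  assumes A: "A \<in> MM" and k: "1 \<le> k" "k \<le> cdim (UNIV :: 'v::hermitian_space set)"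
  shows "ext_seq k A = ext_word k (length A) (top_weight k A) (block_map (A :: ('v \<Rightarrow> 'v) list))"
    (is "_ = ?F")
  unfolding ext_seq_def
proof (rule the_equality)
  let ?l = "length A"
  have kl: "k \<le> flag_rk A ?l"
    using k sum_rk_length[OF A] by (simp add: flag_rk_def)
  have F: "?F \<in> chom (ext_power k) (ext_power k)"
    by (intro ext_word_chom block_map_chom A)
  have "(\<Sum>i<?l. top_degrees k A ! i) = min k (flag_rk A ?l)"
    using top_degrees_iff[OF k(1) kl, of "top_degrees k A"] by simp
  then have sum_top: "sum_list (top_degrees k A) = k"
    using kl by (simp add: sum_list_sum_nth lessThan_atLeast0)
  have gen: "?F (wedge (concat us)) = (if \<kappa> =
      top_degrees k A then ext_map k (sum_map A) (wedge (concat us)) else 0)"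
    if "length \<kappa> = ?l" "sum_list \<kappa> = k" "length us = length \<kappa>"
      "\<forall>i<length \<kappa>. length (us ! i) = \<kappa> ! i \<and> set (us ! i) \<subseteq> perp_space A i" for \<kappa> us
  proof -
    have "map length us = \<kappa>"
      using that by (intro nth_equalityI) auto
    then have len: "length (concat us) = k"
      using that by (simp add: length_concat)
    show ?thesis
      using that ext_word_block[OF A, of us \<kappa> k "top_weight k A"] top_weight_block_word[OF k(1) kl
          that(1)]
        ext_map_wedge[OF sum_map_chom[OF A] len] by (simp add: complex_vector.scale_one)
  qed
  have 1: "?F \<xi> = ext_map k (sum_map A) \<xi>" if "\<xi> \<in> ext_summand (perp_space A) (top_degrees k A)"
      for \<xi>
    using chom_mono[OF F] ext_map_chom_UNIV ext_power_subspace ext_summand_subset[OF sum_top] _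
      that[unfolded ext_summand_def]
    by (rule chom_eq_on_span) (use gen[OF length_top_degrees sum_top] in auto)
  have 2: "?F \<xi> = 0" if "length \<kappa> = ?l" "sum_list \<kappa> = k" "\<kappa> \<noteq> top_degrees k A"
    "\<xi> \<in> ext_summand (perp_space A) \<kappa>" for \<xi> \<kappa>
  proof -
    have "?F \<xi> \<in> {0}"
      using chom_mono[OF F] ext_power_subspace ext_summand_subset[OF that(2)]
          complex_vector.subspace_single_0 _
        that(4)[unfolded ext_summand_def]
      by (rule chom_in_subspace) (use gen[OF that(1,2)] that(3) in auto)
    then show ?thesis
      by simp
  qed
  show "?F \<in> chom (ext_power k) (ext_power k) \<and>
    (\<forall>\<xi>\<in>ext_summand (perp_space A) (top_degrees k A). ?F \<xi> = ext_map k (sum_map A) \<xi>) \<and>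
    (\<forall>\<kappa>. length \<kappa> = length A \<and> sum_list \<kappa> = k \<and> \<kappa> \<noteq> top_degrees k A \<longrightarrow>
      (\<forall>\<xi>\<in>ext_summand (perp_space A) \<kappa>. ?F \<xi> = 0))"
    using F 1 2 by blast
  fix G
  assume G: "G \<in> chom (ext_power k) (ext_power k) \<and>
    (\<forall>\<xi>\<in>ext_summand (perp_space A) (top_degrees k A). G \<xi> = ext_map k (sum_map A) \<xi>) \<and>
    (\<forall>\<kappa>. length \<kappa> = length A \<and> sum_list \<kappa> = k \<and> \<kappa> \<noteq> top_degrees k A \<longrightarrow>
      (\<forall>\<xi>\<in>ext_summand (perp_space A) \<kappa>. G \<xi> = 0))"
  let ?K = "{\<kappa>. length \<kappa> = ?l \<and> sum_list \<kappa> = k}"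
  let ?U = "\<Union>\<kappa>\<in>?K. ext_summand (perp_space A) \<kappa>"
  have U: "?U \<subseteq> ext_power k"
    unfolding ext_summand_def
    by (intro UN_least complex_vector.span_minimal ext_summand_subset ext_power_subspace) auto
  have eqU: "G \<xi> = ?F \<xi>" if "\<xi> \<in> ?U" for \<xi>
    using that G 1 2 by (metis (mono_tags, lifting) UN_E mem_Collect_eq)
  have "G \<xi> = ?F \<xi>" if "\<xi> \<in> ext_power k" for \<xi>
  proof -
    have "\<xi> \<in> cspan {wedge vs | vs :: 'v list. length vs = k}"
      using that by (simp add: ext_power_def)
    moreover have "{wedge vs | vs :: 'v list. length vs = k} \<subseteq> cspan ?U"
      using wedge_span_summands[OF A] by blast
    ultimately have "\<xi> \<in> cspan ?U"
      using complex_vector.span_minimal[OF _ complex_vector.subspace_span] by blast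
    then show ?thesis
      using chom_eq_on_span[OF chom_mono[of G] chom_mono[OF F] ext_power_subspace U eqU] G by blast
  qed
  moreover have "G \<xi> = 0" "?F \<xi> = 0" if "\<xi> \<notin> ext_power k" for \<xi>
    using that F G chom_outside[of _ "ext_power k"] by blast+
  ultimately show "G = ?F"
    by (intro ext) metis
qed

lemma distinct_concat_take:
  "distinct (concat (map f xs)) \<Longrightarrow> distinct (concat (map (\<lambda>i. take (m i) (f i)) xs))"
proof (induction xs)
  case (Cons x xs)
  have "set (concat (map (\<lambda>i. take (m i) (f i)) xs)) \<subseteq> set (concat (map f xs))"
    using set_take_subset by fastforce
  then show ?case
    using Cons set_take_subset[of "m x" "f x"] by (simp add: disjoint_iff subset_iff) blast
qed simp

text \<open>A witness is the wedge of initial parts of bases of the blocks, with the top degrees as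
  lengths. Its image is the wedge of the images under the injective \<open>sum_map A\<close>, hence
  of independent vectors.\<close>

lemma ext_seq_nonzero:
  assumes A: "A \<in> MH" and k: "1 \<le> k" "k \<le> cdim (UNIV :: 'v::hermitian_space set)"
  shows "ext_seq k (A :: ('v \<Rightarrow> 'v) list) \<noteq> 0"
proof -
  let ?l = "length A" and ?S = "sum_map A" and ?n = "cdim (UNIV :: 'v set)"
  have AM: "A \<in> MM"
    using A by (simp add: MH_def)
  have "\<exists>b. distinct b \<and> set b \<subseteq> perp_space A i \<and> perp_space A i \<subseteq> cspan (set b) \<and>
      length b = rk A i" for i
  proof -
    obtain B where B: "B \<subseteq> perp_space A i" "\<not> complex_vector.dependent B" "perp_space A i \<subseteq> cspan B"
        "card B = rk A i"
      using complex_vector.basis_exists[of "perp_space A i"] by (metis rk_def)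
    obtain b where "set b = B" "distinct b"
      using finite_distinct_list[OF hermitian.finiteI_independent[OF B(2)]] by blast
    then show ?thesis
      using B by (metis distinct_card)
  qed
  then obtain b where b: "\<And>i. distinct (b i)" "\<And>i. set (b i) \<subseteq> perp_space A i"
      "\<And>i. perp_space A i \<subseteq> cspan (set (b i))" "\<And>i. length (b i) = rk A i"
    by metis
  let ?X = "concat (map b [0..<?l])"
  have "length ?X = (\<Sum>i<?l. rk A i)"
    by (simp add: length_concat comp_def b lessThan_atLeast0 interv_sum_list_conv_sum_set_nat)
  then have len: "length ?X = ?n"
    by (simp add: sum_rk_length[OF AM])
  have sp: "UNIV \<subseteq> cspan (set ?X)"
  proof
    fix x
    have "block_proj A i x \<in> cspan (set ?X)" if "i < ?l" for i
    proof -
      have "cspan (set (b i)) \<subseteq> cspan (set ?X)"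
        using that by (intro complex_vector.span_mono) auto
      then show ?thesis
        using block_proj_perp[OF AM that] b(3) by blast
    qed
    then have "(\<Sum>i<?l. block_proj A i x) \<in> cspan (set ?X)"
      by (intro complex_vector.span_sum) auto
    then show "x \<in> cspan (set ?X)"
      by (simp add: sum_block_proj[OF AM])
  qed
  \<comment> \<open>The list spans and has exactly as many entries as the dimension, so it is
    independent and free of repetitions.\<close>
  have ind: "\<not> complex_vector.dependent (set ?X)"
    using sp card_length[of ?X] len by (intro hermitian.card_le_dim_spanning[of _ UNIV]) auto
  have "?n \<le> card (set ?X)"
    using complex_vector.dim_le_card[OF sp] by simp
  then have dist: "distinct ?X"
    using card_length[of ?X] len by (intro card_distinct) simp
  define \<kappa> where "\<kappa> = top_degrees k A"
  have kl: "k \<le> flag_rk A ?l"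
    using k sum_rk_length[OF AM] by (simp add: flag_rk_def)
  have \<kappa>: "length \<kappa> = ?l"
    by (simp add: \<kappa>_def)
  have "(\<Sum>i<?l. \<kappa> ! i) = k"
    using top_degrees_iff[OF k(1) kl \<kappa>] kl by (simp add: \<kappa>_def)
  then have sum: "sum_list \<kappa> = k"
    by (simp add: sum_list_sum_nth lessThan_atLeast0 \<kappa>)
  \<comment> \<open>\<open>\<kappa> ! i\<close> never exceeds \<open>rk A i\<close>, so
    \<open>take\<close> really delivers \<open>\<kappa> ! i\<close> vectors.\<close>
  define us where "us = map (\<lambda>i. take (\<kappa> ! i) (b i)) [0..<?l]"
  have us: "length us = ?l" "\<And>i. i < ?l \<Longrightarrow> length (us ! i) = \<kappa> ! i \<and> set (us ! i) \<subseteq> perp_space A i"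
    using b(2) set_take_subset
    by (fastforce simp: us_def b(4) \<kappa>_def top_degrees_nth[OF k(1) kl])+
  have "map length us = \<kappa>"
    using us \<kappa> by (intro nth_equalityI) auto
  then have lvs: "length (concat us) = k"
    using sum by (simp add: length_concat)
  have "set (concat us) \<subseteq> set ?X"
    using set_take_subset by (fastforce simp: us_def)
  then have "\<not> complex_vector.dependent (set (concat us))"
    using ind complex_vector.dependent_mono by blast
  moreover have "distinct (concat us)"
    unfolding us_def using dist by (rule distinct_concat_take)
  ultimately obtain \<phi> where \<phi>: "\<phi> \<in> alt_forms k" "\<phi> (concat us) \<noteq> 0"
    using alt_form_nonzero_independent lvs by blast
  have inj: "inj ?S"
    using A MH_iff[OF AM] by simp
  then have "Vector_Spaces.linear scaleC scaleC (inv ?S)"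
    by (intro hermitian.inj_linear_imp_inv_linear chom_UNIV_linear sum_map_chom AM)
  then have "inv ?S \<in> chom UNIV UNIV"
    by (intro chom_UNIVI) (auto simp: module_hom.scale module_hom.add simp flip:
        module_hom_iff_linear)
  \<comment> \<open>Pulling the form back along the inverse of \<open>sum_map A\<close> undoes the
    map, so the image is tested by the value of \<open>\<phi>\<close> at the original
    vectors.\<close>
  then have "\<phi> \<circ> map (inv ?S) \<in> alt_forms k"
    using \<phi>(1) by (rule pullback_alt_forms)
  then have "wedge (map ?S (concat us)) (\<phi> \<circ> map (inv ?S)) = \<phi> (concat us)"
    using lvs inj by (simp add: wedge_def comp_def)
  moreover have "ext_seq k A (wedge (concat us)) = wedge (map ?S (concat us))"
    using ext_word_block[OF AM us \<kappa> sum, of "top_weight k A"] top_weight_block_word[OF k(1) kl \<kappa>]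
    by (simp add: ext_seq_eq[OF AM k] \<kappa>_def complex_vector.scale_one)
  ultimately show ?thesis
    using \<phi>(2) by (metis zero_fun_apply)
qed

section \<open>Sequences whose flag is coarsened\<close>

lemma low_add_mset: "low (add_mset i M) a = low M a + (if i < a then 1 else 0)"
  by (simp add: low_def)

lemma low_le_size: "low M a \<le> size M"
  unfolding low_def by (rule size_filter_mset_lesseq)

lemma low_zero [simp]: "low M 0 = 0"
  by (simp add: low_def)

lemma low_words:
  assumes "g \<in> words l k"
  shows "low (mset g) l = k"
proof -
  have "filter (\<lambda>i. i < l) g = g"
    using assms by (auto simp: words_def filter_id_conv)
  then show ?thesis
    using assms by (simp add: low_mset words_length)
qed

text \<open>Each \<open>t i\<close> telescopes into \<open>t 0\<close> times the successive ratios
  up to \<open>i\<close>. The ratio at \<open>b\<close> then occurs once for every letter that is at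
  least \<open>b\<close>.\<close>

lemma prod_list_ratios:
  fixes t :: "nat \<Rightarrow> complex"
  assumes t: "\<And>i. i < l \<Longrightarrow> t i \<noteq> 0" and g: "set g \<subseteq> {..<l}"
  shows "prod_list (map t g) =
    t 0 ^ length g * (\<Prod>b\<in>{1..<l}. (t b / t (b - 1)) ^ (length g - low (mset g) b))"
  using g
proof (induction g)
  case (Cons i g)
  let ?r = "\<lambda>b. t b / t (b - 1)"
  have single: "t i = t 0 * (\<Prod>b\<in>{1..<l}. if b \<le> i then ?r b else 1)" if "i < l" for i
  proof -
    have "t i = t 0 * (\<Prod>b\<in>{1..i}. ?r b)"
      using that
    proof (induction i)
      case (Suc i)
      then show ?case
        using t[of i] by (simp add: prod.atLeast_Suc_atMost_Suc_shift prod.nat_ivl_Suc')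
    qed simp
    moreover have "{b \<in> {1..<l}. b \<le> i} = {1..i}"
      using that by auto
    ultimately show ?thesis
      using prod.inter_filter[of "{1..<l}" ?r "\<lambda>b. b \<le> i"] by simp
  qed
  \<comment> \<open>Truncated subtraction is exact here because \<open>low\<close> never exceeds the
    length.\<close>
  have e: "?r b ^ (length (i # g) - low (mset (i # g)) b) =
      (if b \<le> i then ?r b else 1) * ?r b ^ (length g - low (mset g) b)" for b
  proof -
    have "low (mset g) b \<le> length g"
      using low_le_size[of "mset g" b] by simp
    then show ?thesis
      by (simp add: low_add_mset Suc_diff_le)
  qed
  show ?case
    using Cons single[of i] unfolding e prod.distrib by (simp add: algebra_simps)
qed simp

text \<open>
  In the application below, \<open>B\<close> is near \<open>A\<close>, and \<open>c i\<close> rescales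
  \<open>B ! j i\<close> so that its restriction to \<open>dom_space A i\<close> is near \<open>A ! i\<close>. The ratio is
  set to \<open>0\<close> across a jump of \<open>j\<close>, so that \<open>coarse_weight\<close>, with \<open>0 ^ 0 = 1\<close>,
  also kills the words outside the top summand of \<open>B\<close>.
\<close>

definition coarse_ratio :: "(nat \<Rightarrow> nat) \<Rightarrow> (nat \<Rightarrow> complex) \<Rightarrow> nat \<Rightarrow> complex"
  where "coarse_ratio j c b = (if j (b - 1) = j b then c (b - 1) / c b else 0)"

definition coarse_weight :: "nat \<Rightarrow> ('v::hermitian_space \<Rightarrow> 'v) list \<Rightarrow> (nat \<Rightarrow> nat) \<Rightarrow> (nat \<Rightarrow> complex) \<Rightarrow>
    nat multiset \<Rightarrow> complex"
  where "coarse_weight k A j c M = (if \<forall>a\<le>length A. low M a \<le> min k (flag_rk A a)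
    then \<Prod>b\<in>{1..<length A}. coarse_ratio j c b ^ (min k (flag_rk A b) - low M b) else 0)"

text \<open>This is the product of the \<open>1 / c i\<close> along a word with
  \<open>low M b = min k (flag_rk A b)\<close> for all \<open>b\<close>, that is, a top word of
  \<open>A\<close>.\<close>

definition coarse_scale :: "nat \<Rightarrow> ('v::hermitian_space \<Rightarrow> 'v) list \<Rightarrow> (nat \<Rightarrow> complex) \<Rightarrow> complex"
  where "coarse_scale k A c =
    (1 / c 0) ^ k * (\<Prod>b\<in>{1..<length A}. (c (b - 1) / c b) ^ (k - min k (flag_rk A b)))"

text \<open>The facts below are exact identities. Nearness of \<open>B\<close> to \<open>A\<close>
  enters through the inclusions, the nonzero restrictions and \<open>inj\<close>, so they also
  compare two representatives of one point. \<open>Q\<close> is a variable so that it can then be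
  \<open>block_map A\<close>.\<close>

context
  fixes A B :: "('v::hermitian_space \<Rightarrow> 'v) list" and j :: "nat \<Rightarrow> nat" and c :: "nat \<Rightarrow> complex"
    and Q :: "nat \<Rightarrow> 'v \<Rightarrow> 'v"
  assumes A: "A \<in> MM" and B: "B \<in> MM"
    and j_less: "\<And>i. i < length A \<Longrightarrow> j i < length B"
    and j_dom: "\<And>i. i < length A \<Longrightarrow> dom_space A i \<subseteq> dom_space B (j i)"
    and j_nonzero: "\<And>i. i < length A \<Longrightarrow> hom_restrict (B ! j i) (dom_space A i) \<noteq> 0"
    and c: "\<And>i. i < length A \<Longrightarrow> c i \<noteq> 0"
    and Q: "\<And>i x. i < length A \<Longrightarrow> Q i x = c i *\<^sub>C (B ! j i) (block_proj A i x)"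
    and inj: "inj (\<lambda>x. \<Sum>i<length A. Q i x)"
begin

lemma Q_chom: "i < length A \<Longrightarrow> Q i \<in> chom UNIV UNIV"
proof -
  assume i: "i < length A"
  have "block_proj A i x \<in> dom_space B (j i)" for x
    using block_proj_in_dom[OF A i] j_dom[OF i] by blast
  then have "(\<lambda>x. (B ! j i) (block_proj A i x)) \<in> chom UNIV UNIV"
    using chom_add[OF nth_chom[OF B j_less[OF i]]] chom_scale[OF nth_chom[OF B j_less[OF i]]]
      chom_add[OF block_proj_chom[OF A i]] chom_scale[OF block_proj_chom[OF A i]]
    by (intro chom_UNIVI) auto
  moreover have "Q i = (\<lambda>x. c i *\<^sub>C (B ! j i) (block_proj A i x))"
    using Q[OF i] by auto
  ultimately show ?thesis
    by (simp add: chom_UNIV_scale)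
qed

lemma Q_block_proj: "i < length A \<Longrightarrow> i' < length A \<Longrightarrow>
    Q i (block_proj A i' x) = (if i = i' then Q i x else 0)"
  using chom_zero[OF nth_chom[OF B j_less]] by (simp add: Q block_proj_block_proj[OF A])

lemma Q_sum_chom: "(\<lambda>x. \<Sum>i<length A. Q i x) \<in> chom UNIV UNIV"
  using Q_chom by (intro chom_UNIV_sum) auto

lemma Q_sum_block_proj: "i < length A \<Longrightarrow> (\<Sum>i'<length A. Q i' (block_proj A i x)) = Q i x"
  by (simp add: Q_block_proj)

lemma Q_sum_eq_0: "(\<Sum>i<length A. Q i x) = 0 \<Longrightarrow> x = 0"
  using injD[OF inj, of x 0] chom_zero[OF Q_sum_chom] by simp

text \<open>If \<open>j\<close> dropped from \<open>i\<close> to \<open>i'\<close>, the space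
  \<open>dom_space A i'\<close> would lie in the kernel of \<open>B ! j i'\<close>, whose
  restriction to it is not zero.\<close>

lemma j_mono:
  assumes "i \<le> i'" "i' < length A"
  shows "j i \<le> j i'"
proof (rule ccontr)
  assume "\<not> j i \<le> j i'"
  then have "dom_space B (j i) \<subseteq> dom_space B (Suc (j i'))"
    by (intro dom_space_antimono) simp
  then have "dom_space A i' \<subseteq> dom_space B (Suc (j i'))"
    using dom_space_antimono[OF assms(1), of A] j_dom[of i] assms by force
  then have "hom_restrict (B ! j i') (dom_space A i') = 0"
    by (auto simp: hom_restrict_def dom_space.simps(2) fun_eq_iff)
  then show False
    using j_nonzero assms by blast
qed

text \<open>Going down the flag of \<open>B\<close>, the new kernel contains
  \<open>dom_space A b\<close> by the inclusions. Conversely, \<open>B ! j'\<close> acts on the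
  blocks \<open>a..<b\<close> of \<open>A\<close> as the maps \<open>Q i\<close> up to nonzero
  scalars, so by \<open>inj\<close> it is injective on their sum, and a vector of its kernel has no
  components there.\<close>

lemma coarse_flag:
  "j' \<le> length B \<Longrightarrow> \<exists>a\<le>length A. dom_space B j' = dom_space A a \<and> (\<forall>i<length A. j i < j' \<longleftrightarrow> i < a)"
proof (induction j')
  case 0
  then show ?case
    by (intro exI[of _ 0]) simp
next
  case (Suc j')
  then obtain a where a: "a \<le> length A" "dom_space B j' = dom_space A a"
    "\<And>i. i < length A \<Longrightarrow> j i < j' \<longleftrightarrow> i < a"
    by auto
  have j': "j' < length B"
    using Suc by simp
  \<comment> \<open>By monotonicity the indices with \<open>j i \<le> j'\<close> form an initial
    segment; \<open>b\<close> is its end, which is \<open>length A\<close> if no index maps beyond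
    \<open>j'\<close>.\<close>
  have "\<exists>b\<ge>a. b \<le> length A \<and> (\<forall>i<length A. j i < Suc j' \<longleftrightarrow> i < b)"
  proof (cases "\<exists>i<length A. j' < j i")
    case True
    define b where "b = (LEAST i. i < length A \<and> j' < j i)"
    have b: "b < length A" "j' < j b"
      using LeastI_ex[OF True] by (auto simp: b_def)
    have "j i < Suc j' \<longleftrightarrow> i < b" if "i < length A" for i
    proof
      assume "j i < Suc j'"
      then show "i < b"
        using j_mono[of b i] b that by (meson leD le_less_trans less_Suc_eq_le not_le)
    next
      assume "i < b"
      then show "j i < Suc j'"
        using not_less_Least[of i "\<lambda>i. i < length A \<and> j' < j i"] that by (auto simp: b_def)
    qed
    moreover have "a \<le> b"
      using a(3)[of b] b by linarith
    ultimately show ?thesis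
      using b by (intro exI[of _ b]) auto
  next
    case False
    then have "j i < Suc j'" if "i < length A" for i
      using that by (meson not_less less_Suc_eq_le)
    then show ?thesis
      using a(1) by (intro exI[of _ "length A"]) auto
  qed
  then obtain b where b: "a \<le> b" "b \<le> length A" "\<And>i. i < length A \<Longrightarrow> j i < Suc j' \<longleftrightarrow> i < b"
    by blast
  have sub1: "dom_space A b \<subseteq> dom_space B (Suc j')"
  proof (cases "b = length A")
    case True
    then show ?thesis
      using dom_space_length[OF A] complex_vector.subspace_0[OF dom_space_subspace[OF B,
          of "Suc j'"]] Suc
      by simp
  next
    case False
    then have "Suc j' \<le> j b"
      using b(2) b(3)[of b] by simp
    then show ?thesis
      using j_dom[of b] dom_space_antimono[of "Suc j'" "j b" B] b(2) False by force
  qed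
  have "x \<in> dom_space A b" if x: "x \<in> dom_space B (Suc j')" for x
  proof -
    have x': "x \<in> dom_space A a" "(B ! j') x = 0"
      using x a by (auto simp: dom_space.simps(2))
    have chomB: "B ! j' \<in> chom (dom_space A a) UNIV"
      using nth_chom[OF B j'] a(2) by simp
    have sA: "csubspace (dom_space A a)" "csubspace (dom_space A b)"
      using dom_space_subspace[OF A] a b by auto
    \<comment> \<open>The rest \<open>x - ?y\<close> lies in \<open>dom_space A b\<close>, which
      \<open>B ! j'\<close> kills by \<open>sub1\<close>; so \<open>B ! j'\<close> kills
      \<open>?y\<close> as well.\<close>
    let ?y = "\<Sum>i\<in>{a..<b}. block_proj A i x"
    have "x = (\<Sum>i\<in>{a..<length A}. block_proj A i x)"
      using sum_block_proj_ge[OF A a(1)] oproj_id[OF sA(1) x'(1)] by simp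
    also have "\<dots> = ?y + (\<Sum>i\<in>{b..<length A}. block_proj A i x)"
      using b by (simp add: sum.atLeastLessThan_concat)
    finally have xy: "x - ?y = oproj (dom_space A b) x"
      using sum_block_proj_ge[OF A b(2)] by (metis add_diff_cancel_left')
    then have xyb: "x - ?y \<in> dom_space A b"
      using oproj_in[OF sA(2)] by simp
    then have "x - ?y \<in> dom_space A a" "(B ! j') (x - ?y) = 0"
      using sub1 dom_space_antimono[OF b(1), of A] by (auto simp: dom_space.simps(2))
    then have "(B ! j') (x - (x - ?y)) = 0"
      using chom_diff[OF chomB x'(1) _ sA(1), of "x - ?y"] x'(2) by simp
    then have "0 = (B ! j') ?y"
      by simp
    also have "\<dots> = (\<Sum>i\<in>{a..<b}. (B ! j') (block_proj A i x))"
      using b(2) block_proj_in_dom_le[OF A] by (intro chom_sum[OF chomB sA(1)]) auto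
    \<comment> \<open>Dividing each component by \<open>c i\<close> trades \<open>B ! j'\<close> for
      \<open>Q i\<close>. The other \<open>Q i'\<close> vanish on block \<open>i\<close>, so the
      full sum of the \<open>Q\<close> may be inserted and its injectivity used.\<close>
    also have "\<dots> = (\<Sum>i\<in>{a..<b}. Q i ((1 / c i) *\<^sub>C block_proj A i x))"
    proof (rule sum.cong[OF refl])
      fix i assume i: "i \<in> {a..<b}"
      then have il: "i < length A"
        using b by simp
      then have "j i = j'"
        using i a(3)[of i] b(3)[of i] by auto
      then show "(B ! j') (block_proj A i x) = Q i ((1 / c i) *\<^sub>C block_proj A i x)"
        using c[OF il] il Q[OF il, of x]
        by (simp add: chom_scale[OF Q_chom[OF il]] Q_block_proj scaleC_scaleC scaleC_one)
    qed
    also have "\<dots> = (\<Sum>i\<in>{a..<b}. \<Sum>i'<length A. Q i' ((1 / c i) *\<^sub>C block_proj A i x))"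
    proof (rule sum.cong[OF refl])
      fix i assume i: "i \<in> {a..<b}"
      then have il: "i < length A"
        using b by simp
      have "(\<Sum>i'<length A. Q i' ((1 / c i) *\<^sub>C block_proj A i x)) =
          (\<Sum>i'<length A. Q i' (block_proj A i ((1 / c i) *\<^sub>C x)))"
        by (simp add: chom_scale[OF block_proj_chom[OF A il]])
      then show "Q i ((1 / c i) *\<^sub>C block_proj A i x) =
          (\<Sum>i'<length A. Q i' ((1 / c i) *\<^sub>C block_proj A i x))"
        using il by (simp add: Q_sum_block_proj chom_scale[OF Q_chom[OF il]] Q_block_proj)
    qed
    also have "\<dots> = (\<Sum>i'<length A. Q i' (\<Sum>i\<in>{a..<b}. (1 / c i) *\<^sub>C block_proj A i x))"
      using chom_sum[OF Q_sum_chom complex_vector.subspace_UNIV,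
          of "{a..<b}" "\<lambda>i. (1 / c i) *\<^sub>C block_proj A i x"]
      by simp
    finally have z: "(\<Sum>i\<in>{a..<b}. (1 / c i) *\<^sub>C block_proj A i x) = 0"
      using Q_sum_eq_0 by metis
    have "block_proj A i x = 0" if i: "i \<in> {a..<b}" for i
    proof -
      have il: "i < length A"
        using i b by simp
      have "block_proj A i (\<Sum>i\<in>{a..<b}. (1 / c i) *\<^sub>C block_proj A i x) =
          (\<Sum>i'\<in>{a..<b}. (1 / c i') *\<^sub>C block_proj A i (block_proj A i' x))"
        using il by (subst chom_sum[OF block_proj_chom[OF A] complex_vector.subspace_UNIV])
          (auto simp: chom_scale[OF block_proj_chom[OF A]])
      also have "\<dots> = (\<Sum>i'\<in>{a..<b}. if i = i' then (1 / c i) *\<^sub>C block_proj A i x else 0)"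
        using il b by (intro sum.cong) (auto simp: block_proj_block_proj[OF A])
      also have "\<dots> = (1 / c i) *\<^sub>C block_proj A i x"
        using i by simp
      finally have "(1 / c i) *\<^sub>C block_proj A i x = 0"
        using z chom_zero[OF block_proj_chom[OF A il]] by simp
      then show ?thesis
        using c[OF il] by simp
    qed
    then have "?y = 0"
      by simp
    then show ?thesis
      using xyb by simp
  qed
  then show ?case
    using sub1 b by (intro exI[of _ b]) auto
qed

lemma flag_rk_coarse:
  assumes "j' \<le> length B" "a \<le> length A" "dom_space B j' = dom_space A a"
  shows "flag_rk B j' = flag_rk A a"
  using sum_rk[OF B assms(1)] sum_rk[OF A assms(2)] assms(3) by (simp add: flag_rk_def)

text \<open>By \<open>coarse_flag\<close> the block \<open>j'\<close> of \<open>B\<close> is the sum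
  of the blocks of \<open>A\<close> with \<open>j i = j'\<close>; the blocks of \<open>A\<close>
  further down lie in the kernel of \<open>B ! j'\<close>.\<close>

lemma block_map_coarse:
  assumes j': "j' < length B"
  shows "block_map B j' x = (\<Sum>i | i < length A \<and> j i = j'. (1 / c i) *\<^sub>C Q i x)"
proof -
  obtain a where a: "a \<le> length A" "dom_space B j' = dom_space A a"
    "\<And>i. i < length A \<Longrightarrow> j i < j' \<longleftrightarrow> i < a"
    using coarse_flag[of j'] j' by auto
  obtain b where b: "b \<le> length A" "dom_space B (Suc j') = dom_space A b"
    "\<And>i. i < length A \<Longrightarrow> j i < Suc j' \<longleftrightarrow> i < b"
    using coarse_flag[of "Suc j'"] j' by auto
  have eq: "{i. i < length A \<and> j i = j'} = {i \<in> {a..<length A}. i < b}"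
    using a(3) b(3) by (force simp: less_Suc_eq_le)
  have "block_map B j' x = (B ! j') (\<Sum>i\<in>{a..<length A}. block_proj A i x)"
    using block_map_oproj[OF B j'] a(2) sum_block_proj_ge[OF A a(1)] by simp
  also have "\<dots> = (\<Sum>i\<in>{a..<length A}. (B ! j') (block_proj A i x))"
    using a(2) block_proj_in_dom_le[OF A]
    by (intro chom_sum[OF nth_chom[OF B j'] dom_space_subspace[OF B less_imp_le[OF j']]]) auto
  also have "\<dots> = (\<Sum>i\<in>{i \<in> {a..<length A}. i < b}. (B ! j') (block_proj A i x))"
  proof (rule sum.mono_neutral_right)
    show "\<forall>i\<in>{a..<length A} - {i \<in> {a..<length A}. i < b}. (B ! j') (block_proj A i x) = 0"
    proof
      fix i assume "i \<in> {a..<length A} - {i \<in> {a..<length A}. i < b}"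
      then have "block_proj A i x \<in> dom_space B (Suc j')"
        using block_proj_in_dom_le[OF A, of b i] b(2) by auto
      then show "(B ! j') (block_proj A i x) = 0"
        by (simp add: dom_space.simps(2))
    qed
  qed auto
  also have "\<dots> = (\<Sum>i | i < length A \<and> j i = j'. (1 / c i) *\<^sub>C Q i x)"
    unfolding eq[symmetric] using c by (intro sum.cong refl) (auto simp: Q scaleC_scaleC scaleC_one)
  finally show ?thesis .
qed

lemma sum_map_coarse: "sum_map B x = (\<Sum>i<length A. (1 / c i) *\<^sub>C Q i x)"
proof -
  have "sum_map B x = (\<Sum>j'<length B. \<Sum>i\<in>{i \<in> {..<length A}. j i = j'}. (1 / c i) *\<^sub>C Q i x)"
    using block_map_coarse by (simp add: sum_map_eq[OF B])
  also have "\<dots> = (\<Sum>i<length A. (1 / c i) *\<^sub>C Q i x)"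
    using j_less by (intro sum.group) auto
  finally show ?thesis .
qed

text \<open>\<open>sum_map B\<close> is the injective sum of the \<open>Q i\<close> composed with an
  invertible map that multiplies each block of \<open>A\<close> by a scalar.\<close>

lemma coarse_MH: "B \<in> MH"
proof -
  have "x = 0" if "sum_map B x = 0" for x
  proof -
    let ?y = "\<Sum>i<length A. (1 / c i) *\<^sub>C block_proj A i x"
    have "block_proj A i ?y = (1 / c i) *\<^sub>C block_proj A i x" if i: "i < length A" for i
    proof -
      have "block_proj A i ?y = (\<Sum>i'<length A. (1 / c i') *\<^sub>C block_proj A i (block_proj A i' x))"
        using i by (subst chom_sum[OF block_proj_chom[OF A] complex_vector.subspace_UNIV])
          (auto simp: chom_scale[OF block_proj_chom[OF A]])
      also have "\<dots> = (\<Sum>i'<length A. if i = i' then (1 / c i) *\<^sub>C block_proj A i x else 0)"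
        using i by (intro sum.cong) (auto simp: block_proj_block_proj[OF A])
      finally show ?thesis
        using i by simp
    qed
    note y = this
    have "(\<Sum>i<length A. Q i ?y) = (\<Sum>i<length A. (1 / c i) *\<^sub>C Q i x)"
    proof (rule sum.cong[OF refl])
      fix i assume "i \<in> {..<length A}"
      then have i: "i < length A"
        by simp
      have "Q i ?y = Q i (block_proj A i ?y)"
        using i by (simp add: Q_block_proj)
      also have "\<dots> = (1 / c i) *\<^sub>C Q i x"
        using i unfolding y[OF i] by (simp add: Q_block_proj chom_scale[OF Q_chom[OF i]])
      finally show "Q i ?y = (1 / c i) *\<^sub>C Q i x" .
    qed
    also have "\<dots> = 0"
      using that unfolding sum_map_coarse .
    finally have "?y = 0"
      by (rule Q_sum_eq_0)
    then have "block_proj A i x = 0" if "i < length A" for i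
      using y[OF that] c[OF that] chom_zero[OF block_proj_chom[OF A that]] by simp
    then show ?thesis
      using sum_block_proj[OF A, of x] by simp
  qed
  then show ?thesis
    unfolding MH_iff[OF B] by (intro chom_UNIV_inj sum_map_chom B)
qed

text \<open>If \<open>map j g\<close> is a top word of \<open>B\<close>, then \<open>g\<close>
  attains the bound at each jump of \<open>j\<close>, so the ratio 0 placed there has exponent 0 and
  the remaining ratios are the genuine ones. Otherwise the bound is missed at some jump, and the
  positive power of 0 annihilates the weight.\<close>

lemma word_weight_coarse:
  assumes k: "k \<le> cdim (UNIV :: 'v set)" and g: "g \<in> words (length A) k"
    and le: "\<And>a. a \<le> length A \<Longrightarrow> low (mset g) a \<le> min k (flag_rk A a)"
  shows "top_weight k B (mset (map j g)) * prod_list (map (\<lambda>i. 1 / c i) g) =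
    coarse_scale k A c * coarse_weight k A j c (mset g)"
proof -
  let ?l = "length A"
  let ?m = "\<lambda>a. min k (flag_rk A a)"
  let ?\<tau> = "\<lambda>b. c (b - 1) / c b"
  have l0: "?l \<noteq> 0"
    using A by (auto simp: MM_def)
  \<comment> \<open>A cut of the word \<open>map j g\<close> in the flag of \<open>B\<close> is a
    cut of \<open>g\<close> in the flag of \<open>A\<close>.\<close>
  have lowj: "low (mset (map j g)) j' = low (mset g) a"
    if "\<And>i. i < ?l \<Longrightarrow> j i < j' \<longleftrightarrow> i < a" for j' a
  proof -
    have "filter ((\<lambda>i. i < j') \<circ> j) g = filter (\<lambda>i. i < a) g"
      using that g by (intro filter_cong) (auto simp: words_def subset_iff)
    then show ?thesis
      unfolding low_mset filter_map length_map by simp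
  qed
  have "prod_list (map (\<lambda>i. 1 / c i) g) = (1 / c 0) ^ k * (\<Prod>b\<in>{1..<?l}. ((1 / c b) / (1 / c (b -
      1))) ^ (k - low (mset g) b))"
    using prod_list_ratios[of ?l "\<lambda>i. 1 / c i" g] c g by (simp add: words_def)
  also have "(\<Prod>b\<in>{1..<?l}. ((1 / c b) / (1 / c (b - 1))) ^ (k - low (mset g) b)) =
      (\<Prod>b\<in>{1..<?l}. ?\<tau> b ^ (k - ?m b) * ?\<tau> b ^ (?m b - low (mset g) b))"
  proof (rule prod.cong[OF refl])
    fix b assume "b \<in> {1..<?l}"
    then have "k - low (mset g) b = (k - ?m b) + (?m b - low (mset g) b)"
      using le[of b] by auto
    then show "((1 / c b) / (1 / c (b - 1))) ^ (k - low (mset g) b) =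
        ?\<tau> b ^ (k - ?m b) * ?\<tau> b ^ (?m b - low (mset g) b)"
      by (simp only: power_add[symmetric]) simp
  qed
  finally have pl: "prod_list (map (\<lambda>i. 1 / c i) g) =
      coarse_scale k A c * (\<Prod>b\<in>{1..<?l}. ?\<tau> b ^ (?m b - low (mset g) b))"
    by (simp add: coarse_scale_def prod.distrib)
  have w: "coarse_weight k A j c (mset g) = (\<Prod>b\<in>{1..<?l}. coarse_ratio j c b ^ (?m b -
      low (mset g) b))"
    using le by (auto simp: coarse_weight_def)
  show ?thesis
  proof (cases "\<forall>j'\<le>length B. low (mset (map j g)) j' = min k (flag_rk B j')")
    case True
    have "coarse_ratio j c b ^ (?m b - low (mset g) b) = ?\<tau> b ^ (?m b - low (mset g) b)"
      if b: "b \<in> {1..<?l}" for b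
    proof (cases "j (b - 1) = j b")
      case False
      then have lt: "j (b - 1) < j b"
        using j_mono[of "b - 1" b] b by simp
      obtain a where a: "a \<le> ?l" "dom_space B (j b) = dom_space A a"
        "\<And>i. i < ?l \<Longrightarrow> j i < j b \<longleftrightarrow> i < a"
        using coarse_flag[of "j b"] j_less[of b] b by auto
      have "b - 1 < a" "\<not> b < a"
        using a(3)[of "b - 1"] a(3)[of b] lt b by auto
      then have "a = b"
        by simp
      then have "low (mset g) b = ?m b"
        using True lowj[OF a(3)] flag_rk_coarse[OF _ a(1,2)] j_less[of b] b by auto
      then show ?thesis
        by simp
    qed (simp add: coarse_ratio_def)
    then have "coarse_weight k A j c (mset g) = (\<Prod>b\<in>{1..<?l}. ?\<tau> b ^ (?m b - low (mset g) b))"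
      unfolding w by (intro prod.cong) auto
    then show ?thesis
      using True pl by (simp add: top_weight_def)
  next
    case False
    then obtain j' where j': "j' \<le> length B" "low (mset (map j g)) j' \<noteq> min k (flag_rk B j')"
      by blast
    obtain a where a: "a \<le> ?l" "dom_space B j' = dom_space A a"
      "\<And>i. i < ?l \<Longrightarrow> j i < j' \<longleftrightarrow> i < a"
      using coarse_flag[OF j'(1)] by auto
    have ne: "low (mset g) a \<noteq> ?m a"
      using j' lowj[OF a(3)] flag_rk_coarse[OF j'(1) a(1,2)] by simp
    have "flag_rk A ?l = cdim (UNIV :: 'v set)"
      using sum_rk_length[OF A] by (simp add: flag_rk_def)
    \<comment> \<open>At both ends of the flag the bound is attained by every word, with values 0
      and \<open>k\<close>; the defect therefore sits at an inner index, where the product has a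
      factor.\<close>
    then have "a \<noteq> ?l"
      using ne low_words[OF g] k by auto
    moreover have "a \<noteq> 0"
      using ne by (intro notI) simp
    ultimately have a': "a \<in> {1..<?l}"
      using a(1) by simp
    then have "j (a - 1) < j'" "\<not> j a < j'"
      using a(3)[of "a - 1"] a(3)[of a] by auto
    then have "coarse_ratio j c a = 0"
      by (simp add: coarse_ratio_def)
    moreover have "?m a - low (mset g) a \<noteq> 0"
      using le[OF a(1)] ne by linarith
    ultimately have "coarse_weight k A j c (mset g) = 0"
      unfolding w using a' by (intro prod_zero) (auto intro!: bexI[of _ a])
    moreover have "top_weight k B (mset (map j g)) = 0"
      unfolding top_weight_def using False by (intro if_not_P)
    ultimately show ?thesis
      by simp
  qed
qed

text \<open>Components in blocks below \<open>a\<close> are orthogonal to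
  \<open>dom_space A a\<close>, and that complement has dimension \<open>flag_rk A a\<close>. The
  form is pulled back along the sum of the \<open>Q i\<close>, which acts on each block component as
  the single \<open>Q i\<close> of its block.\<close>

lemma word_vanish:
  assumes \<phi>: "\<phi> \<in> alt_forms k" and g: "g \<in> words (length A) k" and vs: "length vs = k"
    and a: "a \<le> length A" "low (mset g) a > flag_rk A a"
  shows "\<phi> (map2 Q g vs) = 0"
proof -
  let ?W = "{x \<in> UNIV. \<forall>y\<in>dom_space A a. cinner x y = 0}"
  let ?ys = "map2 (block_proj A) g vs"
  let ?S = "\<lambda>x. \<Sum>i<length A. Q i x"
  have "cdim ?W + cdim (dom_space A a) = cdim (UNIV :: 'v set)"
    by (intro cdim_orth_complement dom_space_subspace A a) (auto simp: complex_vector.subspace_UNIV)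
  then have W: "cdim ?W = flag_rk A a"
    using sum_rk[OF A a(1)] by (simp add: flag_rk_def)
  have "?ys ! p \<in> ?W" if "p < k" "g ! p < a" for p
  proof -
    have gp: "g ! p < length A"
      using words_nth[OF g] that by simp
    have "dom_space A a \<subseteq> dom_space A (Suc (g ! p))"
      using that by (intro dom_space_antimono) simp
    then show ?thesis
      using block_proj_perp[OF A gp, of "vs ! p"] that vs words_length[OF g]
          by (auto simp: perp_space_def)
  qed
  then have "{p. p < k \<and> g ! p < a} \<subseteq> {p. p < length ?ys \<and> ?ys ! p \<in> ?W}"
    using vs words_length[OF g] by auto
  then have "card {p. p < k \<and> g ! p < a} \<le> card {p. p < length ?ys \<and> ?ys ! p \<in> ?W}"
    by (intro card_mono) auto
  then have "cdim ?W < card {p. p < length ?ys \<and> ?ys ! p \<in> ?W}"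
    using a(2) W words_length[OF g] by (simp add: low_mset length_filter_conv_card)
  moreover have "\<phi> \<circ> map ?S \<in> alt_forms (length ?ys)"
    using pullback_alt_forms[OF Q_sum_chom \<phi>] vs words_length[OF g] by simp
  ultimately have "(\<phi> \<circ> map ?S) ?ys = 0"
    by (intro alt_form_dependent)
  moreover have "map ?S ?ys = map2 Q g vs"
    using words_nth[OF g] words_length[OF g] vs
        by (intro nth_equalityI) (auto simp: Q_sum_block_proj)
  ultimately show ?thesis
    by (simp only: comp_apply)
qed

text \<open>Inserting \<open>block_map_coarse\<close> into every slot expands a word
  \<open>h\<close> in the blocks of \<open>B\<close> into all words \<open>g\<close> in the blocks
  of \<open>A\<close> with \<open>map j g = h\<close>. Words breaking the rank bound contribute
  zero, so it does no harm that \<open>coarse_weight\<close> drops them.\<close>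

lemma ext_seq_coarse:
  assumes k: "1 \<le> k" "k \<le> cdim (UNIV :: 'v set)"
  shows "ext_seq k B = coarse_scale k A c *\<^sub>C ext_word k (length A) (coarse_weight k A j c) Q"
    (is "_ = ?s *\<^sub>C ?F")
proof
  let ?W = "words (length A) k"
  fix \<xi>
  have F: "(\<lambda>\<xi>. ?s *\<^sub>C ?F \<xi>) \<in> chom (ext_power k) UNIV"
    using ext_word_chom[of "length A" Q k "coarse_weight k A j c", OF Q_chom]
    by (auto simp: chom_def scaleC_add_right scaleC_scaleC mult.commute)
  have G: "ext_word k (length B) (top_weight k B) (block_map B) \<in> chom (ext_power k) UNIV"
    by (rule chom_mono[OF ext_word_chom[OF block_map_chom[OF B]]]) auto
  have gen: "ext_word k (length B) (top_weight k B) (block_map B) (wedge vs) = ?s *\<^sub>C ?F (wedge vs)"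
    if vs: "length vs = k" for vs
  proof
    fix \<phi>
    show "ext_word k (length B) (top_weight k B) (block_map B) (wedge vs) \<phi> =
        (?s *\<^sub>C ?F (wedge vs)) \<phi>"
    proof (cases "\<phi> \<in> alt_forms k")
      case \<phi>: True
      have G_eq: "ext_word k (length B) (top_weight k B) (block_map B) (wedge vs) \<phi> =
          (\<Sum>h\<in>words (length B) k. top_weight k B (mset h) * \<phi> (map2 (block_map B) h vs))"
        by (rule ext_word_wedge_apply[OF block_map_chom[OF B] vs \<phi>])
      have F_eq: "?F (wedge vs) \<phi> = (\<Sum>g\<in>?W. coarse_weight k A j c (mset g) * \<phi> (map2 Q g vs))"
        by (rule ext_word_wedge_apply[OF Q_chom vs \<phi>])
      let ?t = "\<lambda>i. 1 / c i"
      let ?I = "\<lambda>h. {i. i < length A \<and> j i = h}"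
      have expand: "\<phi> (map2 (block_map B) h vs) =
          (\<Sum>g\<in>{g \<in> ?W. map j g = h}. prod_list (map ?t g) * \<phi> (map2 Q g vs))"
        if h: "h \<in> words (length B) k" for h
      proof -
        have lh: "length h = k"
          using words_length[OF h] .
        have e1: "map2 (block_map B) h vs = map2 (\<lambda>h x. \<Sum>i\<in>?I h. ?t i *\<^sub>C Q i x) h vs"
          using words_nth[OF h] lh vs by (intro nth_equalityI) (auto simp: block_map_coarse)
        have e2: "{g. list_all2 (\<lambda>i h. i \<in> ?I h) g h} = {g \<in> ?W. map j g = h}"
          by (auto simp: lh list_all2_conv_all_nth words_def list_eq_iff_nth_eq set_conv_nth)
        have "\<phi> (map2 (block_map B) h vs) =
            (\<Sum>g\<in>{g \<in> ?W. map j g = h}. \<phi> (map2 (\<lambda>i x. ?t i *\<^sub>C Q i x) g vs))"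
          unfolding e1 using alt_form_map2_sum[of \<phi> "[]" h vs ?I "\<lambda>i x. ?t i *\<^sub>C Q i x",
              unfolded e2] \<phi> lh vs
          by simp
        also have "\<dots> = (\<Sum>g\<in>{g \<in> ?W. map j g = h}. prod_list (map ?t g) * \<phi> (map2 Q g vs))"
          using alt_form_map2_scale[of \<phi> "[]" _ vs ?t Q] \<phi> vs words_length[of _ "length A" k]
          by (intro sum.cong) auto
        finally show ?thesis .
      qed
      have "(\<Sum>h\<in>words (length B) k. top_weight k B (mset h) * \<phi> (map2 (block_map B) h vs)) =
          (\<Sum>h\<in>words (length B) k. \<Sum>g\<in>{g \<in> ?W. map j g = h}.
            top_weight k B (mset (map j g)) * (prod_list (map ?t g) * \<phi> (map2 Q g vs)))"
        by (intro sum.cong) (auto simp: expand sum_distrib_left)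
      also have "\<dots> = (\<Sum>g\<in>?W. top_weight k B (mset (map j g)) * (prod_list (map ?t g) *
          \<phi> (map2 Q g vs)))"
        using j_less by (intro sum.group finite_words) (auto simp: words_def subset_iff)
      also have "\<dots> = (\<Sum>g\<in>?W. ?s * (coarse_weight k A j c (mset g) * \<phi> (map2 Q g vs)))"
      proof (rule sum.cong[OF refl])
        fix g assume g: "g \<in> ?W"
        show "top_weight k B (mset (map j g)) * (prod_list (map ?t g) * \<phi> (map2 Q g vs)) =
            ?s * (coarse_weight k A j c (mset g) * \<phi> (map2 Q g vs))"
        proof (cases "\<forall>a\<le>length A. low (mset g) a \<le> min k (flag_rk A a)")
          case True
          then show ?thesis
            using word_weight_coarse[OF k(2) g] by (metis (no_types, lifting) mult.assoc)
        next
          case False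
          then obtain a where "a \<le> length A" "low (mset g) a > flag_rk A a"
            using low_le_size[of "mset g"] words_length[OF g]
                by (fastforce simp: not_le min_less_iff_disj)
          then have "\<phi> (map2 Q g vs) = 0"
            using word_vanish[OF \<phi> g vs] by blast
          then show ?thesis
            by simp
        qed
      qed
      finally show ?thesis
        unfolding G_eq by (simp add: F_eq scaleC_fun_def scaleC_complex_def sum_distrib_left)
    next
      case False
      then show ?thesis
        by (simp add: ext_word_def hom_restrict_def scaleC_fun_def scaleC_complex_def)
    qed
  qed
  show "ext_seq k B \<xi> = (?s *\<^sub>C ?F) \<xi>"
  proof (cases "\<xi> \<in> ext_power k")
    case True
    then have \<xi>: "\<xi> \<in> cspan {wedge vs | vs :: 'v list. length vs = k}"
      by (simp add: ext_power_def)
    have "ext_word k (length B) (top_weight k B) (block_map B) \<xi> = ?s *\<^sub>C ?F \<xi>"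
      by (rule chom_eq_on_span[OF G F ext_power_subspace _ _ \<xi>]) (use gen wedge_in_ext_power in
          auto)
    then show ?thesis
      by (simp add: ext_seq_eq[OF B k] scaleC_fun_def)
  next
    case False
    then show ?thesis
      by (simp add: ext_seq_eq[OF B k] ext_word_def hom_restrict_def scaleC_fun_def
          scaleC_complex_def fun_eq_iff)
  qed
qed

end

section \<open>Limits\<close>

lemma norm_scaleC: "norm (c *\<^sub>C x) = norm c * norm (x::'a::hermitian_space)"
proof -
  have "inner (c *\<^sub>C x) (c *\<^sub>C x) = Re ((c * cnj c) * cinner x x)"
    by (simp add: inner_cinner cinner_scaleC_left cinner_scaleC_right algebra_simps)
  also have "\<dots> = (norm c)\<^sup>2 * inner x x"
    by (simp add: complex_norm_square[symmetric] inner_cinner)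
  finally have "(norm (c *\<^sub>C x))\<^sup>2 = (norm c * norm x)\<^sup>2"
    by (simp add: power2_norm_eq_inner power_mult_distrib)
  then show ?thesis
    by (simp add: power2_eq_iff_nonneg)
qed

lemma tendsto_linear_basis:
  fixes R :: "nat \<Rightarrow> 'a::euclidean_space \<Rightarrow> 'b::real_normed_vector"
  assumes R: "\<And>N. linear (R N)" and R': "linear R'" and lim: "\<And>b. b \<in> Basis \<Longrightarrow> (\<lambda>N. R N b) \<longlonglongrightarrow> R' b"
  shows "(\<lambda>N. R N x) \<longlonglongrightarrow> R' x"
proof -
  have eq: "f x = (\<Sum>b\<in>Basis. inner x b *\<^sub>R f b)" if "linear f" for f :: "'a \<Rightarrow> 'b"
    using linear_sum[OF that, of "\<lambda>b. inner x b *\<^sub>R b" Basis] linear_scale[OF that]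
    by (simp add: euclidean_representation)
  show ?thesis
    unfolding eq[OF R] eq[OF R'] by (intro tendsto_intros lim)
qed

text \<open>An injective linear map is bounded below by some \<open>\<beta> > 0\<close>, and a
  perturbation of norm less than \<open>\<beta>\<close> has no kernel; the norm is estimated by the
  sum over \<open>Basis\<close>.\<close>

lemma eventually_inj:
  fixes T :: "nat \<Rightarrow> 'a::euclidean_space \<Rightarrow> 'b::euclidean_space"
  assumes T: "\<And>N. linear (T N)" and T': "linear T'" "inj T'" and lim: "\<And>x. (\<lambda>N. T N x) \<longlonglongrightarrow> T' x"
  shows "eventually (\<lambda>N. inj (T N)) sequentially"
proof -
  obtain \<beta> where \<beta>: "\<beta> > 0" "\<And>x. \<beta> * norm x \<le> norm (T' x)"
    using linear_inj_bounded_below_pos[OF T'] by blast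
  have "(\<lambda>N. \<Sum>b\<in>Basis. norm (T' b - T N b)) \<longlonglongrightarrow> (\<Sum>b\<in>Basis. norm (T' b - T' b))"
    by (intro tendsto_intros lim)
  then have "eventually (\<lambda>N. (\<Sum>b\<in>Basis. norm (T' b - T N b)) < \<beta>) sequentially"
    using \<beta>(1) by (simp add: order_tendstoD)
  then show ?thesis
  proof (rule eventually_mono)
    fix N assume N: "(\<Sum>b\<in>Basis. norm (T' b - T N b)) < \<beta>"
    have "x = 0" if x: "T N x = 0" for x
    proof (rule ccontr)
      assume "x \<noteq> 0"
      have lin: "linear (\<lambda>x. T' x - T N x)"
        using T T' by (intro linear_compose_sub)
      have "\<beta> * norm x \<le> norm (T' x - T N x)"
        using \<beta>(2)[of x] x by simp
      also have "T' x - T N x = (\<Sum>b\<in>Basis. inner x b *\<^sub>R (T' b - T N b))"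
        using linear_sum[OF lin, of "\<lambda>b. inner x b *\<^sub>R b" Basis] linear_scale[OF lin]
        by (simp add: euclidean_representation)
      also have "norm \<dots> \<le> (\<Sum>b\<in>Basis. norm x * norm (T' b - T N b))"
        by (intro sum_norm_le) (simp add: Basis_le_norm mult_right_mono)
      also have "\<dots> = norm x * (\<Sum>b\<in>Basis. norm (T' b - T N b))"
        by (simp add: sum_distrib_left)
      also have "\<dots> < norm x * \<beta>"
        using N \<open>x \<noteq> 0\<close> by simp
      finally show False
        by simp
    qed
    then show "inj (T N)"
      using linear_injective_0[OF T] by blast
  qed
qed

lemma tendsto_funI:
  fixes f :: "nat \<Rightarrow> 'a \<Rightarrow> 'b::topological_space"
  assumes "\<And>x. (\<lambda>N. f N x) \<longlonglongrightarrow> f' x"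
  shows "f \<longlonglongrightarrow> f'"
proof -
  have "limitin (product_topology (\<lambda>i. euclidean) UNIV) f f' sequentially"
    using assms by (simp add: limitin_componentwise)
  then show ?thesis
    by (simp add: euclidean_product_topology)
qed

text \<open>A multilinear form is a polynomial in the real coordinates of its arguments, with the
  values on words of basis vectors as coefficients.\<close>

lemma tendsto_alt_form:
  fixes xs :: "nat \<Rightarrow> 'v::hermitian_space list"
  assumes \<phi>: "\<phi> \<in> alt_forms k" and len: "\<And>N. length (xs N) = k" "length ys = k"
    and lim: "\<And>p. p < k \<Longrightarrow> (\<lambda>N. xs N ! p) \<longlonglongrightarrow> ys ! p"
  shows "(\<lambda>N. \<phi> (xs N)) \<longlonglongrightarrow> \<phi> ys"
proof -
  let ?G = "{g. list_all2 (\<lambda>i h. i \<in> (Basis :: 'v set)) g (replicate k ())}"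
  have lenG: "length g = k" if "g \<in> ?G" for g
    using that list_all2_lengthD by fastforce
  have eq: "\<phi> vs = (\<Sum>g\<in>?G. (\<Prod>p\<in>{0..<k}. complex_of_real (inner (vs ! p) (g ! p))) *
      \<phi> (map2 (\<lambda>b x. b) g vs))"
    if vs: "length vs = k" for vs :: "'v list"
  proof -
    have "map2 (\<lambda>h x. \<Sum>b\<in>Basis. complex_of_real (inner x b) *\<^sub>C b) (replicate k ()) vs = vs"
      using vs by (intro nth_equalityI) (auto simp: scaleR_scaleC[symmetric]
          euclidean_representation)
    then have "\<phi> vs = (\<Sum>g\<in>?G. \<phi> (map2 (\<lambda>b x. complex_of_real (inner x b) *\<^sub>C b) g vs))"
      using alt_form_map2_sum[of \<phi> "[]" "replicate k ()" vs "\<lambda>_. Basis" "\<lambda>b x. complex_of_real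
          (inner x b) *\<^sub>C b"]
        \<phi> vs by simp
    also have "\<dots> = (\<Sum>g\<in>?G. (\<Prod>p\<in>{0..<k}. complex_of_real (inner (vs ! p) (g ! p))) *
        \<phi> (map2 (\<lambda>b x. b) g vs))"
    proof (rule sum.cong[OF refl])
      fix g assume "g \<in> ?G"
      then have g: "length g = k"
        by (rule lenG)
      have "prod_list (map2 (\<lambda>b x. complex_of_real (inner x b)) g vs) =
          (\<Prod>p\<in>{0..<k}. complex_of_real (inner (vs ! p) (g ! p)))"
        using g vs by (subst prod.list_conv_set_nth) (auto intro!: prod.cong)
      then show "\<phi> (map2 (\<lambda>b x. complex_of_real (inner x b) *\<^sub>C b) g vs) =
          (\<Prod>p\<in>{0..<k}. complex_of_real (inner (vs ! p) (g ! p))) * \<phi> (map2 (\<lambda>b x. b) g vs)"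
        using alt_form_map2_scale_gen[of \<phi> "[]" g vs "\<lambda>b x. complex_of_real (inner x b)" "\<lambda>b x. b"]
            \<phi> g vs
        by simp
    qed
    finally show ?thesis .
  qed
  have m: "map2 (\<lambda>b x. b) g vs = g" if "g \<in> ?G" "length vs = k" for g and vs :: "'v list"
    using lenG[OF that(1)] that(2) map2_fst[of g vs "\<lambda>b. b"] by simp
  have "(\<lambda>N. \<Sum>g\<in>?G. (\<Prod>p\<in>{0..<k}. complex_of_real (inner (xs N ! p) (g ! p))) * \<phi> g) \<longlonglongrightarrow>
      (\<Sum>g\<in>?G. (\<Prod>p\<in>{0..<k}. complex_of_real (inner (ys ! p) (g ! p))) * \<phi> g)"
    by (intro tendsto_intros lim) auto
  then show ?thesis
    unfolding eq[OF len(1)] eq[OF len(2)] using m len by simp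
qed

text \<open>Convergence is pointwise, so it can be checked on decomposable elements, where the word
  sum is finite, and extended by linearity.\<close>

lemma tendsto_ext_word:
  fixes Q :: "nat \<Rightarrow> nat \<Rightarrow> 'v::hermitian_space \<Rightarrow> 'v"
  assumes Q: "\<And>N i. i < l \<Longrightarrow> Q N i \<in> chom UNIV UNIV" and Q': "\<And>i. i < l \<Longrightarrow> Q' i \<in> chom UNIV UNIV"
    and limQ: "\<And>i x. i < l \<Longrightarrow> (\<lambda>N. Q N i x) \<longlonglongrightarrow> Q' i x"
    and lims: "\<And>g. g \<in> words l k \<Longrightarrow> (\<lambda>N. s N (mset g)) \<longlonglongrightarrow> s' (mset g)"
  shows "(\<lambda>N. ext_word k l (s N) (Q N)) \<longlonglongrightarrow> ext_word k l s' Q'"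
proof (intro tendsto_funI)
  let ?F = "\<lambda>N. ext_word k l (s N) (Q N)" and ?F' = "ext_word k l s' Q'"
  fix \<xi> :: "('v list \<Rightarrow> complex) \<Rightarrow> complex" and \<phi> :: "'v list \<Rightarrow> complex"
  have C: "?F N \<in> chom (ext_power k) (ext_power k)" for N
    by (rule ext_word_chom[OF Q])
  have C': "?F' \<in> chom (ext_power k) (ext_power k)"
    by (rule ext_word_chom[OF Q'])
  show "(\<lambda>N. ?F N \<xi> \<phi>) \<longlonglongrightarrow> ?F' \<xi> \<phi>"
  proof (cases "\<xi> \<in> ext_power k \<and> \<phi> \<in> alt_forms k")
    case True
    then have \<xi>: "\<xi> \<in> cspan {wedge vs | vs :: 'v list. length vs = k}" and \<phi>: "\<phi> \<in> alt_forms k"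
      by (auto simp: ext_power_def)
    \<comment> \<open>Membership travels through the induction because the maps are additive only on
      \<open>ext_power k\<close>.\<close>
    have "\<xi> \<in> ext_power k \<and> (\<lambda>N. ?F N \<xi> \<phi>) \<longlonglongrightarrow> ?F' \<xi> \<phi>"
      using \<xi>
    proof (induction rule: complex_vector.span_induct_alt)
      case base
      have "?F N 0 = 0" "?F' 0 = 0" for N
        using chom_zero[OF C] chom_zero[OF C'] by auto
      then show ?case
        using complex_vector.subspace_0[OF ext_power_subspace[of k]] by (simp add: zero_fun_def)
    next
      case (step c x y)
      then obtain vs :: "'v list" where vs: "x = wedge vs" "length vs = k"
        by blast
      have x: "x \<in> ext_power k"
        using vs by (simp add: wedge_in_ext_power)
      then have cx: "c *\<^sub>C x \<in> ext_power k"
        by (rule complex_vector.subspace_scale[OF ext_power_subspace])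
      have y: "y \<in> ext_power k"
        using step by blast
      have lin: "F (c *\<^sub>C x + y) \<phi> = c * F x \<phi> + F y \<phi>"
        if "F \<in> chom (ext_power k) (ext_power k)" for F
        unfolding chom_add[OF that cx y] chom_scale[OF that x]
        by (simp add: scaleC_fun_def scaleC_complex_def)
      have "(\<lambda>N. \<Sum>g\<in>words l k. s N (mset g) * \<phi> (map2 (Q N) g vs)) \<longlonglongrightarrow>
          (\<Sum>g\<in>words l k. s' (mset g) * \<phi> (map2 Q' g vs))"
      proof (intro tendsto_sum tendsto_mult lims tendsto_alt_form[OF \<phi>])
        fix g p assume "g \<in> words l k" "p < k"
        then show "(\<lambda>N. map2 (Q N) g vs ! p) \<longlonglongrightarrow> map2 Q' g vs ! p"
          using vs by (simp add: words_length words_nth limQ)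
      qed (use vs in \<open>auto simp: words_length\<close>)
      then have "(\<lambda>N. ?F N x \<phi>) \<longlonglongrightarrow> ?F' x \<phi>"
        using ext_word_wedge_apply[of l "Q _" vs k \<phi> "s _", OF Q vs(2) \<phi>]
          ext_word_wedge_apply[of l Q' vs k \<phi> s', OF Q' vs(2) \<phi>] by (simp add: vs(1))
      then have "(\<lambda>N. c * ?F N x \<phi> + ?F N y \<phi>) \<longlonglongrightarrow> c * ?F' x \<phi> + ?F' y \<phi>"
        using step by (intro tendsto_intros) auto
      then show ?case
        unfolding lin[OF C] lin[OF C'] using complex_vector.subspace_add[OF ext_power_subspace cx y]
            by blast
    qed
    then show ?thesis
      by blast
  next
    case False
    then show ?thesis
      by (auto simp: ext_word_def hom_restrict_def)
  qed
qed

section \<open>Projective classes and independence of the representative\<close>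

lemma proj_class_eqD:
  assumes "proj_class x = proj_class y"
  shows "\<exists>c. c \<noteq> 0 \<and> x = c *\<^sub>C y"
proof -
  have "x \<in> proj_class x"
    unfolding proj_class_def by (rule CollectI, rule exI[of _ 1]) (simp add: scaleC_one)
  then show ?thesis
    using assms by (auto simp: proj_class_def)
qed

lemma proj_class_scale:
  assumes "c \<noteq> 0"
  shows "proj_class (c *\<^sub>C x) = proj_class x"
proof (intro equalityI subsetI)
  fix y assume "y \<in> proj_class (c *\<^sub>C x)"
  then show "y \<in> proj_class x"
    using assms by (auto simp: proj_class_def scaleC_scaleC)
next
  fix y assume "y \<in> proj_class x"
  then obtain d where "d \<noteq> 0" "y = d *\<^sub>C x"
    by (auto simp: proj_class_def)
  then have "y = (d / c) *\<^sub>C c *\<^sub>C x" "d / c \<noteq> 0"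
    using assms by (auto simp: scaleC_scaleC)
  then show "y \<in> proj_class (c *\<^sub>C x)"
    unfolding proj_class_def by blast
qed

text \<open>The left side is \<open>coarse_weight\<close> with every ratio set to 0. As
  \<open>0 ^ 0 = 1\<close>, a word survives iff it attains all inner bounds, and at the two ends of
  the flag every word attains them.\<close>

lemma coarse_weight_limit:
  assumes A: "A \<in> MM" and k: "k \<le> cdim (UNIV :: 'v::hermitian_space set)" and g: "g \<in> words (length
      A) k"
  shows "(if \<forall>a\<le>length A. low (mset g) a \<le> min k (flag_rk A a)
    then \<Prod>b\<in>{1..<length A}. 0 ^ (min k (flag_rk A b) - low (mset g) b) else 0) =
    top_weight k (A :: ('v \<Rightarrow> 'v) list) (mset g)"
proof -
  have fl: "flag_rk A (length A) = cdim (UNIV :: 'v set)"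
    using sum_rk_length[OF A] by (simp add: flag_rk_def)
  consider "\<not> (\<forall>a\<le>length A. low (mset g) a \<le> min k (flag_rk A a))"
    | "\<forall>a\<le>length A. low (mset g) a \<le> min k (flag_rk A a)" "\<forall>a\<le>length A. low (mset g) a =
        min k (flag_rk A a)"
    | "\<forall>a\<le>length A. low (mset g) a \<le> min k (flag_rk A a)" "\<not> (\<forall>a\<le>length A. low (mset g) a =
        min k (flag_rk A a))"
    by blast
  then show ?thesis
  proof cases
    case 1
    then show ?thesis
      by (auto simp: top_weight_def)
  next
    case 2
    then have "(\<Prod>b\<in>{1..<length A}. (0::complex) ^ (min k (flag_rk A b) - low (mset g) b)) = 1"
      by (intro prod.neutral) auto
    then show ?thesis
      using 2 by (simp add: top_weight_def)
  next
    case 3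
    then obtain a where a: "a \<le> length A" "low (mset g) a \<noteq> min k (flag_rk A a)"
      by blast
    then have "a \<noteq> length A"
      using low_words[OF g] fl k by auto
    moreover have "a \<noteq> 0"
      using a(2) by (intro notI) simp
    ultimately have a': "a \<in> {1..<length A}"
      using a by simp
    moreover have "min k (flag_rk A a) - low (mset g) a \<noteq> 0"
      using 3(1) a by (metis diff_is_0_eq le_antisym)
    ultimately have "(\<Prod>b\<in>{1..<length A}. (0::complex) ^ (min k (flag_rk A b) - low (mset g) b)) = 0"
      by (intro prod_zero bexI[of _ a]) auto
    then show ?thesis
      using 3 unfolding top_weight_def by simp
  qed
qed

lemma ext_word_cong:
  assumes "\<And>g. g \<in> words l k \<Longrightarrow> s (mset g) = s' (mset g)"
  shows "ext_word k l s Q = ext_word k l s' Q"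
proof -
  have "word_form k l s Q = word_form k l s' Q"
    using assms by (auto simp: word_form_def fun_eq_iff intro!: sum.cong)
  then show ?thesis
    by (simp add: ext_word_def)
qed

text \<open>A sequence in \<open>MM\<close> is not empty, so \<open>c 0\<close> is among the nonzero
  constants.\<close>

lemma coarse_scale_nonzero:
  assumes "A \<in> MM" "\<And>i. i < length A \<Longrightarrow> c i \<noteq> 0"
  shows "coarse_scale k A c \<noteq> 0"
  using assms by (auto simp: coarse_scale_def MM_def)

text \<open>Two representatives are an instance of coarsening with \<open>j\<close> the identity.
  Then \<open>j\<close> jumps at every step, all ratios are 0, and the weight is that of
  \<open>A\<close> without passing to a limit.\<close>

lemma same_proj_seq:
  fixes A B :: "('v::hermitian_space \<Rightarrow> 'v) list"
  assumes A: "A \<in> MH" and B: "B \<in> MM" and eq: "proj_seq A = proj_seq B"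
  shows "B \<in> MH"
    and "1 \<le> k \<Longrightarrow> k \<le> cdim (UNIV :: 'v set) \<Longrightarrow> proj_class (ext_seq k B) = proj_class (ext_seq k A)"
proof -
  have AM: "A \<in> MM"
    using A by (simp add: MH_def)
  have len: "length A = length B"
    using eq unfolding proj_seq_def by (metis length_map)
  have "\<exists>c. c \<noteq> 0 \<and> A ! i = c *\<^sub>C B ! i" if "i < length A" for i
    using eq len that by (intro proj_class_eqD) (metis nth_map proj_seq_def)
  then obtain c where c: "\<And>i. i < length A \<Longrightarrow> c i \<noteq> 0 \<and> A ! i = c i *\<^sub>C B ! i"
    by metis
  have dom: "dom_space A i = dom_space B i" if "i \<le> length A" for i
    using that by (induction i) (auto simp: dom_space.simps(2) c scaleC_fun_def)
  have nz: "hom_restrict (B ! i) (dom_space A i) \<noteq> 0" if "i < length A" for i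
  proof -
    have "hom_restrict (B ! i) (dom_space A i) = B ! i"
      using nth_chom[OF B, of i] that len dom[of i]
      by (auto simp: hom_restrict_def fun_eq_iff chom_outside)
    then show ?thesis
      using nth_neq_0[OF B] that len by simp
  qed
  have inj: "inj (\<lambda>x. \<Sum>i<length A. block_map A i x)"
    using A MH_iff[OF AM] by (simp add: sum_map_eq[OF AM])
  have Q: "block_map A i x = c i *\<^sub>C (B ! i) (block_proj A i x)" if "i < length A" for i x
    using c[OF that] by (simp add: block_map_def scaleC_fun_def)
  have c': "c i \<noteq> 0" if "i < length A" for i
    using c that by blast
  have d: "dom_space A i \<subseteq> dom_space B i" if "i < length A" for i
    using dom[of i] that by simp
  have l: "i < length B" if "i < length A" for i
    using len that by simp
  show "B \<in> MH"
    by (rule coarse_MH[where A = A and j = "\<lambda>i. i", OF AM B l d nz c' Q inj])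
  assume k: "1 \<le> k" "k \<le> cdim (UNIV :: 'v set)"
  have "ext_seq k B = coarse_scale k A c *\<^sub>C
      ext_word k (length A) (coarse_weight k A (\<lambda>i. i) c) (block_map A)"
    by (rule ext_seq_coarse[where A = A and j = "\<lambda>i. i", OF AM B l d nz c' Q inj k])
  also have "ext_word k (length A) (coarse_weight k A (\<lambda>i. i) c) (block_map A) = ext_seq k A"
    unfolding ext_seq_eq[OF AM k]
  proof (rule ext_word_cong)
    fix g assume g: "g \<in> words (length A) k"
    have "(\<Prod>b\<in>{1..<length A}. coarse_ratio (\<lambda>i. i) c b ^ (min k (flag_rk A b) - low (mset g) b)) =
        (\<Prod>b\<in>{1..<length A}. 0 ^ (min k (flag_rk A b) - low (mset g) b))"
      by (intro prod.cong) (auto simp: coarse_ratio_def)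
    note eq = this
    show "coarse_weight k A (\<lambda>i. i) c (mset g) = top_weight k A (mset g)"
      unfolding coarse_weight_def eq by (rule coarse_weight_limit[OF AM k(2) g])
  qed
  finally show "proj_class (ext_seq k B) = proj_class (ext_seq k A)"
    using coarse_scale_nonzero[OF AM c'] by (simp add: proj_class_scale)
qed

lemma lambda_bar_eq:
  fixes A :: "('v::hermitian_space \<Rightarrow> 'v) list"
  assumes A: "A \<in> MH" and k: "k \<in> {1..cdim (UNIV :: 'v set) - 1}"
  shows "lambda_bar (proj_seq A) k = proj_class (ext_seq k A)"
proof -
  have "(THE L. \<exists>B\<in>MH. proj_seq B = proj_seq A \<and>
      L = proj_class (ext_seq k B)) = proj_class (ext_seq k A)"
  proof (rule the_equality)
    show "\<exists>B\<in>MH. proj_seq B = proj_seq A \<and> proj_class (ext_seq k A) = proj_class (ext_seq k B)"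
      using A by blast
    fix L assume "\<exists>B\<in>MH. proj_seq B = proj_seq A \<and> L = proj_class (ext_seq k B)"
    then obtain B where B: "B \<in> MH" "proj_seq A = proj_seq B" "L = proj_class (ext_seq k B)"
      by metis
    have k': "1 \<le> k" "k \<le> cdim (UNIV :: 'v set)"
      using k by (simp_all only: atLeastAtMost_iff) linarith
    have "B \<in> MM"
      using B(1) by (simp add: MH_def)
    then show "L = proj_class (ext_seq k A)"
      unfolding B(3) by (rule same_proj_seq(2)[OF A _ B(2) k'])
  qed
  then show ?thesis
    unfolding lambda_bar_def restrict_def using k by (simp only: if_True)
qed

section \<open>Openness and continuity\<close>

text \<open>\<open>c i\<close> selects the representative of the class that is compared with
  \<open>A ! i\<close>. The projections of \<open>Basis\<close> span \<open>dom_space A i\<close>,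
  so finitely many vectors suffice.\<close>

definition close_at :: "real \<Rightarrow> ('v::hermitian_space \<Rightarrow> 'v) list \<Rightarrow> ('v \<Rightarrow> 'v) list \<Rightarrow>
    (nat \<Rightarrow> nat) \<Rightarrow> (nat \<Rightarrow> complex) \<Rightarrow> bool"
  where "close_at \<epsilon> A B j c \<longleftrightarrow> (\<forall>i<length A. j i < length B \<and> dom_space A i \<subseteq> dom_space B (j i) \<and>
    hom_restrict (B ! j i) (dom_space A i) \<noteq> 0 \<and> c i \<noteq> 0 \<and>
    (\<forall>b\<in>Basis. norm (c i *\<^sub>C (B ! j i) (oproj (dom_space A i) b) -
      (A ! i) (oproj (dom_space A i) b)) < \<epsilon>))"

lemma tendsto_close:
  fixes Bs :: "nat \<Rightarrow> ('v::hermitian_space \<Rightarrow> 'v) list"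
  assumes A: "A \<in> MM" and Bs: "\<And>N. Bs N \<in> MM" and close: "\<And>N. close_at (1 / Suc N) A (Bs N) (j N) (c
      N)"
    and i: "i < length A"
  shows "(\<lambda>N. c N i *\<^sub>C (Bs N ! j N i) (oproj (dom_space A i) x)) \<longlonglongrightarrow> block_map A i x"
    and "(\<lambda>x. c N i *\<^sub>C (Bs N ! j N i) (oproj (dom_space A i) x)) \<in> chom UNIV UNIV"
proof -
  have s: "csubspace (dom_space A i)"
    using dom_space_subspace[OF A] i by simp
  have chom: "(\<lambda>x. c N i *\<^sub>C (Bs N ! j N i) (oproj (dom_space A i) x)) \<in> chom UNIV UNIV" for N
  proof -
    have j: "j N i < length (Bs N)" "dom_space A i \<subseteq> dom_space (Bs N) (j N i)"
      using close[of N] i by (auto simp: close_at_def)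
    have "oproj (dom_space A i) x \<in> dom_space (Bs N) (j N i)" for x
      using oproj_in[OF s] j by blast
    then have "(\<lambda>x. (Bs N ! j N i) (oproj (dom_space A i) x)) \<in> chom UNIV UNIV"
      using chom_add[OF nth_chom[OF Bs j(1)]] chom_scale[OF nth_chom[OF Bs j(1)]]
      by (intro chom_UNIVI) (auto simp: oproj_add[OF s] oproj_scale[OF s])
    then show ?thesis
      by (rule chom_UNIV_scale)
  qed
  then show "(\<lambda>x. c N i *\<^sub>C (Bs N ! j N i) (oproj (dom_space A i) x)) \<in> chom UNIV UNIV" .
  show "(\<lambda>N. c N i *\<^sub>C (Bs N ! j N i) (oproj (dom_space A i) x)) \<longlonglongrightarrow> block_map A i x"
  proof (rule tendsto_linear_basis[where R = "\<lambda>N x. c N i *\<^sub>C (Bs N ! j N i) (oproj (dom_space A i)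
      x)"
        and R' = "block_map A i"])
    fix b :: 'v assume b: "b \<in> Basis"
    have le: "norm (c N i *\<^sub>C (Bs N ! j N i) (oproj (dom_space A i) b) -
        block_map A i b) \<le> 1 / Suc N" for N
      using close[of N] i b by (auto simp: close_at_def block_map_oproj[OF A i] intro: less_imp_le)
    have "(\<lambda>N. 1 / real (Suc N)) \<longlonglongrightarrow> 0"
      using LIMSEQ_inverse_real_of_nat by (simp add: inverse_eq_divide)
    then have "(\<lambda>N. c N i *\<^sub>C (Bs N ! j N i) (oproj (dom_space A i) b) - block_map A i b) \<longlonglongrightarrow> 0"
      by (rule Lim_null_comparison[OF always_eventually[OF allI[OF le]]])
    then show "(\<lambda>N. c N i *\<^sub>C (Bs N ! j N i) (oproj (dom_space A i) b)) \<longlonglongrightarrow> block_map A i b"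
      by (simp add: LIM_zero_iff)
  qed (use chom block_map_chom[OF A i] chom_UNIV_real_linear in auto)
qed

lemma tendsto_coarse_ratio:
  fixes Bs :: "nat \<Rightarrow> ('v::hermitian_space \<Rightarrow> 'v) list"
  assumes A: "A \<in> MM" and Bs: "\<And>N. Bs N \<in> MM" and close: "\<And>N. close_at (1 / Suc N) A (Bs N) (j N) (c
      N)"
    and b: "b \<in> {1..<length A}"
  shows "(\<lambda>N. coarse_ratio (j N) (c N) b) \<longlonglongrightarrow> 0"
proof -
  have b': "b < length A" "b - 1 < length A" "Suc (b - 1) = b"
    using b by auto
  have "\<exists>y. (A ! b) y \<noteq> 0"
    using nth_neq_0[OF A b'(1)] by (auto simp: fun_eq_iff)
  then obtain y where y: "(A ! b) y \<noteq> 0"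
    by blast
  then have yb: "y \<in> dom_space A b"
    using chom_outside[OF nth_chom[OF A b'(1)]] by blast
  then have yb1: "y \<in> dom_space A (b - 1)" "(A ! (b - 1)) y = 0"
    using dom_space.simps(2)[of A "b - 1"] b'(3) by auto
  have o: "oproj (dom_space A b) y = y" "oproj (dom_space A (b - 1)) y = y"
    using oproj_id[OF dom_space_subspace[OF A] yb] oproj_id[OF dom_space_subspace[OF A] yb1(1)] b'
        by auto
  let ?u = "\<lambda>N i. c N i *\<^sub>C (Bs N ! j N i) y"
  have l0: "(\<lambda>N. ?u N (b - 1)) \<longlonglongrightarrow> 0"
    using tendsto_close(1)[OF A Bs close b'(2), of y]
        unfolding block_map_oproj[OF A b'(2)] o yb1(2) .
  have l1: "(\<lambda>N. ?u N b) \<longlonglongrightarrow> (A ! b) y"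
    using tendsto_close(1)[OF A Bs close b'(1), of y] unfolding block_map_oproj[OF A b'(1)] o .
  have "(\<lambda>N. norm (?u N (b - 1)) / norm (?u N b)) \<longlonglongrightarrow> norm (0 :: 'v) / norm ((A ! b) y)"
    using y by (intro tendsto_intros l0 l1) simp
  then have lim: "(\<lambda>N. norm (?u N (b - 1)) / norm (?u N b)) \<longlonglongrightarrow> 0"
    by simp
  have "eventually (\<lambda>N. ?u N b \<noteq> 0) sequentially"
    using l1 y by (rule tendsto_imp_eventually_ne)
  \<comment> \<open>Without a jump at \<open>b\<close> both vectors are multiples of the same value
    of \<open>B\<close> at \<open>y\<close>, and their norms have the quotient wanted; across a jump
    the ratio is 0.\<close>
  then have "eventually (\<lambda>N. norm (coarse_ratio (j N) (c N) b) \<le> norm (?u N (b -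
      1)) / norm (?u N b)) sequentially"
  proof (rule eventually_mono)
    fix N assume nz: "?u N b \<noteq> 0"
    show "norm (coarse_ratio (j N) (c N) b) \<le> norm (?u N (b - 1)) / norm (?u N b)"
    proof (cases "j N (b - 1) = j N b")
      case True
      have "c N b \<noteq> 0"
        using close[of N] b'(1) by (simp add: close_at_def)
      moreover have "(Bs N ! j N b) y \<noteq> 0"
        using nz by auto
      ultimately show ?thesis
        using True by (simp add: coarse_ratio_def norm_scaleC norm_divide)
    qed (simp add: coarse_ratio_def)
  qed
  then show ?thesis
    using lim by (rule Lim_null_comparison)
qed

lemma eventually_close:
  fixes Bs :: "nat \<Rightarrow> ('v::hermitian_space \<Rightarrow> 'v) list"
  assumes A: "A \<in> MH" and Bs: "\<And>N. Bs N \<in> MM" and close: "\<And>N. close_at (1 / Suc N) A (Bs N) (j N) (c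
      N)"
  shows "eventually (\<lambda>N. Bs N \<in> MH) sequentially"
    and "\<lbrakk>1 \<le> k; k \<le> cdim (UNIV :: 'v set); openin (proj_topology (chom (ext_power k) (ext_power
        k))) W;
      proj_class (ext_seq k A) \<in> W\<rbrakk> \<Longrightarrow> eventually (\<lambda>N. proj_class (ext_seq k (Bs N)) \<in> W)
          sequentially"
proof -
  have AM: "A \<in> MM"
    using A by (simp add: MH_def)
  let ?l = "length A"
  define Q where "Q N i x = c N i *\<^sub>C (Bs N ! j N i) (block_proj A i x)" for N i x
  have cl: "j N i < length (Bs N)" "dom_space A i \<subseteq> dom_space (Bs N) (j N i)"
      "hom_restrict (Bs N ! j N i) (dom_space A i) \<noteq> 0" "c N i \<noteq> 0" if "i < ?l" for N i
    using close[of N] that by (auto simp: close_at_def)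
  \<comment> \<open>A block projection is fixed by the projection onto \<open>dom_space A i\<close>,
    so \<open>tendsto_close\<close>, stated with \<open>oproj\<close>, applies at
    \<open>block_proj A i x\<close>.\<close>
  have Q_eq: "Q N i x = c N i *\<^sub>C (Bs N ! j N i) (oproj (dom_space A i) (block_proj A i x))" if "i <
      ?l" for N i x
    using oproj_id[OF dom_space_subspace[OF AM] block_proj_in_dom[OF AM that]] that
        by (simp add: Q_def)
  have limQ: "(\<lambda>N. Q N i x) \<longlonglongrightarrow> block_map A i x" if "i < ?l" for i x
    using tendsto_close(1)[OF AM Bs close that, of "block_proj A i x"] that
    by (simp add: Q_eq block_map_def block_proj_block_proj[OF AM])
  have chQ: "Q N i \<in> chom UNIV UNIV" if "i < ?l" for N i
  proof -
    note R = tendsto_close(2)[OF AM Bs close that, of N]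
    show ?thesis
      using chom_add[OF R] chom_scale[OF R] chom_add[OF block_proj_chom[OF AM that]] chom_scale[OF
          block_proj_chom[OF AM that]]
      by (intro chom_UNIVI) (auto simp: Q_eq[OF that])
  qed
  have inj: "eventually (\<lambda>N. inj (\<lambda>x. \<Sum>i<?l. Q N i x)) sequentially"
  proof (rule eventually_inj)
    show "linear (\<lambda>x. \<Sum>i<?l. Q N i x)" for N
      using chQ by (intro chom_UNIV_real_linear chom_UNIV_sum) auto
    show "linear (sum_map A)"
      by (intro chom_UNIV_real_linear sum_map_chom AM)
    show "inj (sum_map A)"
      using A MH_iff[OF AM] by simp
    show "(\<lambda>N. \<Sum>i<?l. Q N i x) \<longlonglongrightarrow> sum_map A x" for x
      unfolding sum_map_eq[OF AM] using limQ by (intro tendsto_sum) auto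
  qed
  show MH: "eventually (\<lambda>N. Bs N \<in> MH) sequentially"
    using inj
  proof (rule eventually_mono)
    fix N assume "inj (\<lambda>x. \<Sum>i<?l. Q N i x)"
    then show "Bs N \<in> MH"
      using cl by (intro coarse_MH[OF AM Bs, where j = "j N" and c = "c N" and Q = "Q N"])
          (auto simp: Q_def)
  qed
  assume k: "1 \<le> k" "k \<le> cdim (UNIV :: 'v set)"
    and W: "openin (proj_topology (chom (ext_power k) (ext_power k))) W" "proj_class (ext_seq k A) \<in>
        W"
  let ?E = "chom (ext_power k) (ext_power k) :: ((('v list \<Rightarrow> complex) \<Rightarrow> complex) \<Rightarrow> _) set"
  let ?F = "\<lambda>N. ext_word k ?l (coarse_weight k A (j N) (c N)) (Q N)"
  have seq: "eventually (\<lambda>N. ext_seq k (Bs N) = coarse_scale k A (c N) *\<^sub>C ?F N) sequentially"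
    using inj
  proof (rule eventually_mono)
    fix N assume "inj (\<lambda>x. \<Sum>i<?l. Q N i x)"
    then show "ext_seq k (Bs N) = coarse_scale k A (c N) *\<^sub>C ?F N"
      using cl k by (intro ext_seq_coarse[OF AM Bs]) (auto simp: Q_def)
  qed
  have lim: "?F \<longlonglongrightarrow> ext_seq k A"
    unfolding ext_seq_eq[OF AM k]
  proof (rule tendsto_ext_word[OF chQ block_map_chom[OF AM] limQ])
    fix g assume g: "g \<in> words ?l k"
    have "(\<lambda>N. coarse_weight k A (j N) (c N) (mset g)) \<longlonglongrightarrow>
      (if \<forall>a\<le>?l. low (mset g) a \<le> min k (flag_rk A a)
        then \<Prod>b\<in>{1..<?l}. 0 ^ (min k (flag_rk A b) - low (mset g) b) else 0)"
    proof (cases "\<forall>a\<le>?l. low (mset g) a \<le> min k (flag_rk A a)")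
      case True
      show ?thesis
        unfolding coarse_weight_def if_P[OF True]
        by (intro tendsto_prod tendsto_power tendsto_coarse_ratio[OF AM Bs close])
    next
      case False
      show ?thesis
        unfolding coarse_weight_def if_not_P[OF False] by (rule tendsto_const)
    qed
    then show "(\<lambda>N. coarse_weight k A (j N) (c N) (mset g)) \<longlonglongrightarrow> top_weight k A (mset g)"
      unfolding coarse_weight_limit[OF AM k(2) g] .
  qed
  \<comment> \<open>Open sets of classes are tested on nonzero representatives. The convergent
    representatives are the \<open>?F N\<close>, not the \<open>ext_seq k (Bs N)\<close>.\<close>
  obtain T where T: "open T" "{F \<in> ?E - {0}. proj_class F \<in> W} = (?E - {0}) \<inter> T"
    using W(1) by (auto simp: openin_proj_topology openin_open)
  have "ext_seq k A \<in> ?E - {0}"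
    using ext_seq_nonzero[OF A k] ext_word_chom[OF block_map_chom[OF AM]]
        by (simp add: ext_seq_eq[OF AM k])
  then have "ext_seq k A \<in> T"
    using T(2) W(2) by blast
  then have "eventually (\<lambda>N. ?F N \<in> T) sequentially"
    using lim T(1) topological_tendstoD by blast
  then show "eventually (\<lambda>N. proj_class (ext_seq k (Bs N)) \<in> W) sequentially"
    using seq MH
  proof eventually_elim
    case (elim N)
    have sc: "coarse_scale k A (c N) \<noteq> 0"
      using cl by (intro coarse_scale_nonzero[OF AM]) auto
    have "?F N \<noteq> 0"
      using ext_seq_nonzero[OF elim(3) k] elim(2) by auto
    moreover have "?F N \<in> ?E"
      by (rule ext_word_chom[OF chQ])
    ultimately have "proj_class (?F N) \<in> W"
      using T(2) elim(1) by blast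
    then show ?case
      unfolding elim(2) proj_class_scale[OF sc] .
  qed
qed

text \<open>If every bound \<open>1 / Suc N\<close> failed, the counterexamples would form a
  sequence approaching \<open>A\<close> along which \<open>P\<close> never holds.\<close>

lemma close_nbhd:
  fixes A :: "('v::hermitian_space \<Rightarrow> 'v) list"
  assumes "\<And>Bs j c. (\<And>N. Bs N \<in> MM) \<Longrightarrow> (\<And>N. close_at (1 / Suc N) A (Bs N) (j N) (c N)) \<Longrightarrow>
    eventually (\<lambda>N. P (Bs N)) sequentially"
  shows "\<exists>\<epsilon>>0. \<forall>B\<in>MM. \<forall>j c. close_at \<epsilon> A B j c \<longrightarrow> P B"
proof (rule ccontr)
  assume neg: "\<not> ?thesis"
  have "\<exists>B j c. B \<in> MM \<and> close_at (1 / Suc N) A B j c \<and> \<not> P B" for N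
  proof -
    have "1 / real (Suc N) > 0"
      by simp
    then show ?thesis
      using neg by meson
  qed
  then obtain Bs j c where "\<And>N. Bs N \<in> MM \<and> close_at (1 / Suc N) A (Bs N) (j N) (c N) \<and> \<not> P (Bs N)"
    by metis
  moreover from this have "eventually (\<lambda>N. P (Bs N)) sequentially"
    by (intro assms) auto
  ultimately show False
    by (simp add: eventually_sequentially)
qed

text \<open>The classes that have a multiple within \<open>\<epsilon>\<close> of
  \<open>A ! i\<close> form an open set, and these sets serve as the \<open>U i\<close> of a basic
  neighborhood.\<close>

lemma openin_PM_topologyI:
  fixes S :: "('v::hermitian_space \<Rightarrow> 'v) set list set"
  assumes S: "S \<subseteq> PM"
    and nbhd: "\<And>A. A \<in> MM \<Longrightarrow> proj_seq A \<in> S \<Longrightarrow>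
      \<exists>\<epsilon>>0. \<forall>B\<in>MM. \<forall>j c. close_at \<epsilon> A B j c \<longrightarrow> proj_seq B \<in> S"
  shows "openin PM_topology S"
  unfolding openin_PM_topology
proof (intro conjI ballI impI S)
  fix A :: "('v \<Rightarrow> 'v) list"
  assume A: "A \<in> MM" "proj_seq A \<in> S"
  then obtain \<epsilon> where \<epsilon>: "\<epsilon> > 0" "\<And>B j c. B \<in> MM \<Longrightarrow> close_at \<epsilon> A B j c \<Longrightarrow> proj_seq B \<in> S"
    using nbhd by meson
  let ?H = "\<lambda>i. chom (dom_space A i) (UNIV :: 'v set) - {0}"
  \<comment> \<open>Quantifying over the scale \<open>c\<close> makes nearness invariant under
    rescaling of \<open>D\<close>, hence a property of the class.\<close>
  define near where "near i D \<longleftrightarrow> (\<exists>c. c \<noteq> 0 \<and> (\<forall>b\<in>Basis. norm (c *\<^sub>C D (oproj (dom_space A i) b) -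
      (A ! i) (oproj (dom_space A i) b)) < \<epsilon>))" for i and D :: "'v \<Rightarrow> 'v"
  define U where "U i = proj_class ` {D \<in> ?H i. near i D}" for i
  have near_scale: "near i D" if nd: "near i (d *\<^sub>C D)" "d \<noteq> 0" for i d D
  proof -
    obtain c where "c \<noteq> 0" "\<forall>b\<in>Basis. norm (c *\<^sub>C (d *\<^sub>C D) (oproj (dom_space A i) b) -
      (A ! i) (oproj (dom_space A i) b)) < \<epsilon>"
      using nd(1) by (auto simp: near_def)
    then show ?thesis
      unfolding near_def using nd(2)
      by (intro exI[of _ "c * d"]) (simp add: scaleC_fun_def scaleC_scaleC)
  qed
  have near_iff: "proj_class D \<in> U i \<longleftrightarrow> near i D" if "D \<in> ?H i" for i D
  proof
    assume "proj_class D \<in> U i"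
    then obtain D' where D': "near i D'" "proj_class D' = proj_class D"
      by (auto simp: U_def)
    then show "near i D"
      using proj_class_eqD[OF D'(2)] near_scale by blast
  qed (use that in \<open>auto simp: U_def\<close>)
  have op: "openin (proj_topology (chom (dom_space A i) UNIV)) (U i)" for i
  proof -
    have "open {D :: 'v \<Rightarrow> 'v. norm (c *\<^sub>C D y - z) < \<epsilon>}" for c y z
    proof (rule open_Collect_less)
      have "linear (\<lambda>x :: 'v. c *\<^sub>C x)"
        by (intro chom_UNIV_real_linear chom_UNIV_scale chom_UNIVI) auto
      then have "continuous_on UNIV (\<lambda>x :: 'v. c *\<^sub>C x)"
        by (rule linear_continuous_on[OF linear_conv_bounded_linear[THEN iffD1]])
      then have "continuous_on UNIV (\<lambda>D :: 'v \<Rightarrow> 'v. c *\<^sub>C D y)"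
        by (rule continuous_on_compose2) (auto intro: continuous_on_product_coordinates)
      then show "continuous_on UNIV (\<lambda>D :: 'v \<Rightarrow> 'v. norm (c *\<^sub>C D y - z))"
        by (intro continuous_intros)
    qed simp
    then have "open (\<Inter>b\<in>Basis. {D. norm (c *\<^sub>C D (oproj (dom_space A i) b) -
        (A ! i) (oproj (dom_space A i) b)) < \<epsilon>})" for c
      by (intro open_INT) auto
    \<comment> \<open>For a fixed scale this is a finite intersection of open conditions; the union
      over all scales stays open.\<close>
    then have "open (\<Union>c\<in>-{0}. \<Inter>b\<in>Basis. {D. norm (c *\<^sub>C D (oproj (dom_space A i) b) -
        (A ! i) (oproj (dom_space A i) b)) < \<epsilon>})"
      by blast
    moreover have "(\<Union>c\<in>-{0}. \<Inter>b\<in>Basis. {D. norm (c *\<^sub>C D (oproj (dom_space A i) b) -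
        (A ! i) (oproj (dom_space A i) b)) < \<epsilon>})
        = {D. near i D}"
      by (simp add: near_def set_eq_iff Bex_def)
    ultimately have "open {D. near i D}"
      by simp
    moreover have "{D \<in> ?H i. proj_class D \<in> U i} = ?H i \<inter> {D. near i D}"
      using near_iff[of _ i] by blast
    moreover have "U i \<subseteq> proj_space (chom (dom_space A i) UNIV)"
      by (auto simp: U_def proj_space_def)
    ultimately show ?thesis
      unfolding openin_proj_topology openin_open by blast
  qed
  have mem: "proj_class (A ! i) \<in> U i" if "i < length A" for i
  proof -
    have "near i (A ! i)"
      unfolding near_def using \<epsilon>(1) by (intro exI[of _ 1]) (simp add: scaleC_one)
    then show ?thesis
      using near_iff[of "A ! i" i] nth_chom[OF A(1) that] nth_neq_0[OF A(1) that] by blast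
  qed
  have sub: "basic_nbhd A U \<subseteq> S"
  proof
    fix p assume "p \<in> basic_nbhd A U"
    then obtain B where B: "p = proj_seq B" "B \<in> MM" and
      ex: "\<forall>i<length A. \<exists>j<length B. dom_space A i \<subseteq> dom_space B j \<and>
      hom_restrict (B ! j) (dom_space A i) \<noteq> 0 \<and>
          proj_class (hom_restrict (B ! j) (dom_space A i)) \<in> U i"
      by (auto simp: basic_nbhd_def)
    have "\<forall>i<length A. \<exists>j c. j < length B \<and> dom_space A i \<subseteq> dom_space B j \<and>
      hom_restrict (B ! j) (dom_space A i) \<noteq> 0 \<and> c \<noteq> 0 \<and>
          (\<forall>b\<in>Basis. norm (c *\<^sub>C (B ! j) (oproj (dom_space A i) b) -
      (A ! i) (oproj (dom_space A i) b)) < \<epsilon>)"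
    proof (intro allI impI)
      fix i assume i: "i < length A"
      then obtain j where j: "j < length B" "dom_space A i \<subseteq> dom_space B j"
        "hom_restrict (B ! j) (dom_space A i) \<noteq> 0" "proj_class (hom_restrict (B ! j) (dom_space A
            i)) \<in> U i"
        using ex by blast
      have s: "csubspace (dom_space A i)"
        using dom_space_subspace[OF A(1)] i by simp
      \<comment> \<open>The inclusion \<open>dom_space A i \<subseteq> dom_space B j\<close> makes
        the restriction linear, and it agrees with \<open>B ! j\<close> at the projected basis
        vectors.\<close>
      have "hom_restrict (B ! j) (dom_space A i) \<in> chom (dom_space A i) UNIV"
        using nth_chom[OF B(2) j(1)] j(2) complex_vector.subspace_add[OF s]
            complex_vector.subspace_scale[OF s]
        by (auto simp: chom_def hom_restrict_def subset_iff)
      then have "near i (hom_restrict (B ! j) (dom_space A i))"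
        using near_iff[of "hom_restrict (B ! j) (dom_space A i)" i] j by blast
      then obtain c where c: "c \<noteq> 0" "\<forall>b\<in>Basis. norm (c *\<^sub>C hom_restrict (B ! j) (dom_space A i)
          (oproj (dom_space A i) b) -
          (A ! i) (oproj (dom_space A i) b)) < \<epsilon>"
        by (auto simp: near_def)
      have "hom_restrict (B ! j) (dom_space A i) (oproj (dom_space A i) b) =
          (B ! j) (oproj (dom_space A i) b)" for b
        using oproj_in[OF s] by (simp add: hom_restrict_def)
      then show "\<exists>j c. j < length B \<and> dom_space A i \<subseteq> dom_space B j \<and>
      hom_restrict (B ! j) (dom_space A i) \<noteq> 0 \<and> c \<noteq> 0 \<and>
          (\<forall>b\<in>Basis. norm (c *\<^sub>C (B ! j) (oproj (dom_space A i) b) -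
      (A ! i) (oproj (dom_space A i) b)) < \<epsilon>)"
        using j c by (intro exI[of _ j] exI[of _ c]) simp
    qed
    then obtain j c where "\<forall>i<length A. j i < length B \<and> dom_space A i \<subseteq> dom_space B (j i) \<and>
      hom_restrict (B ! j i) (dom_space A i) \<noteq> 0 \<and> c i \<noteq> 0 \<and>
          (\<forall>b\<in>Basis. norm (c i *\<^sub>C (B ! j i) (oproj (dom_space A i) b) -
      (A ! i) (oproj (dom_space A i) b)) < \<epsilon>)"
      by metis
    then have "close_at \<epsilon> A B j c"
      by (simp add: close_at_def)
    then show "p \<in> S"
      using \<epsilon>(2) B by blast
  qed
  show "\<exists>U. (\<forall>i<length A. openin (proj_topology (chom (dom_space A i) UNIV)) (U i) \<and>
              proj_class (A ! i) \<in> U i) \<and> basic_nbhd A U \<subseteq> S"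
    using op mem sub by blast
qed

lemma proj_seq_PMH_iff:
  fixes A :: "('v::hermitian_space \<Rightarrow> 'v) list"
  assumes "A \<in> MM"
  shows "proj_seq A \<in> PMH \<longleftrightarrow> A \<in> MH"
proof
  assume "proj_seq A \<in> PMH"
  then obtain A' where "A' \<in> MH" "proj_seq A' = proj_seq A"
    unfolding PMH_def by (metis imageE)
  then show "A \<in> MH"
    using same_proj_seq(1)[OF _ assms] by simp
qed (simp add: PMH_def)

lemma PMH_subset: "PMH \<subseteq> PM"
  by (auto simp: PMH_def PM_def MH_def)

lemma openin_PMH: "openin PM_topology PMH"
proof (rule openin_PM_topologyI[OF PMH_subset])
  fix A :: "('v::hermitian_space \<Rightarrow> 'v) list"
  assume A: "A \<in> MM" "proj_seq A \<in> PMH"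
  then have "A \<in> MH"
    by (simp add: proj_seq_PMH_iff)
  then have "\<exists>\<epsilon>>0. \<forall>B\<in>MM. \<forall>j c. close_at \<epsilon> A B j c \<longrightarrow> B \<in> MH"
    by (intro close_nbhd eventually_close(1))
  then show "\<exists>\<epsilon>>0. \<forall>B\<in>MM. \<forall>j c. close_at \<epsilon> A B j c \<longrightarrow> proj_seq B \<in> PMH"
    using proj_seq_PMH_iff by blast
qed

lemma openin_lambda_bar_vimage:
  fixes k :: nat
  assumes k: "k \<in> {1..cdim (UNIV :: 'v::hermitian_space set) - 1}"
    and W: "openin (proj_topology (chom (ext_power k) (ext_power k))) W"
  shows "openin PM_topology {p \<in> (PMH :: ('v \<Rightarrow> 'v) set list set). lambda_bar p k \<in> W}"
proof (rule openin_PM_topologyI)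
  show "{p \<in> (PMH :: ('v \<Rightarrow> 'v) set list set). lambda_bar p k \<in> W} \<subseteq> PM"
    using PMH_subset by blast
  have k': "1 \<le> k" "k \<le> cdim (UNIV :: 'v set)"
    using k by (simp_all only: atLeastAtMost_iff) linarith
  have iff: "proj_seq B \<in> {p \<in> PMH. lambda_bar p k \<in> W} \<longleftrightarrow> B \<in> MH \<and> proj_class (ext_seq k B) \<in> W"
    if "B \<in> MM" for B :: "('v \<Rightarrow> 'v) list"
    using proj_seq_PMH_iff[OF that] lambda_bar_eq[OF _ k, of B] by auto
  fix A :: "('v \<Rightarrow> 'v) list"
  assume A: "A \<in> MM" "proj_seq A \<in> {p \<in> PMH. lambda_bar p k \<in> W}"
  then have A': "A \<in> MH" "proj_class (ext_seq k A) \<in> W"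
    using iff by blast+
  have "\<exists>\<epsilon>>0. \<forall>B\<in>MM. \<forall>j c. close_at \<epsilon> A B j c \<longrightarrow> B \<in> MH \<and> proj_class (ext_seq k B) \<in> W"
    by (intro close_nbhd eventually_conj eventually_close(1)[OF A'(1)] eventually_close(2)[OF A'(1)
        _ _ k' W A'(2)])
  then show "\<exists>\<epsilon>>0. \<forall>B\<in>MM. \<forall>j c. close_at \<epsilon> A B j c \<longrightarrow> proj_seq B \<in> {p \<in> PMH. lambda_bar p k \<in> W}"
    using iff by blast
qed

theorem theorem8p2:
  fixes n :: nat
  assumes "cdim (UNIV :: 'v::hermitian_space set) = n" and "n \<ge> 1"
  shows "openin PM_topology (PMH :: ('v \<Rightarrow> 'v) set list set) \<and>
    continuous_map (subtopology PM_topology (PMH :: ('v \<Rightarrow> 'v) set list set))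
      (product_topology (\<lambda>k. proj_topology (chom (ext_power k) (ext_power k))) {1..n - 1})
      lambda_bar"
proof
  let ?X = "subtopology PM_topology (PMH :: ('v \<Rightarrow> 'v) set list set)"
  show op: "openin PM_topology (PMH :: ('v \<Rightarrow> 'v) set list set)"
    by (rule openin_PMH)
  have top: "topspace ?X = PMH"
    using openin_subset[OF op] by (auto simp: topspace_subtopology)
  show "continuous_map ?X (product_topology (\<lambda>k. proj_topology (chom (ext_power k) (ext_power k)))
      {1..n - 1}) lambda_bar"
    unfolding continuous_map_componentwise
  proof (intro conjI ballI)
    show "lambda_bar ` topspace ?X \<subseteq> extensional {1..n - 1}"
      unfolding assms(1)[symmetric] lambda_bar_def by auto
    fix k assume "k \<in> {1..n - 1}"
    then have k: "k \<in> {1..cdim (UNIV :: 'v set) - 1}" "1 \<le> k" "k \<le> cdim (UNIV :: 'v set)"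
      unfolding assms(1) by auto
    have "lambda_bar p k \<in> proj_space (chom (ext_power k) (ext_power k))"
      if p: "p \<in> (PMH :: ('v \<Rightarrow> 'v) set list set)" for p
    proof -
      obtain A :: "('v \<Rightarrow> 'v) list" where A: "A \<in> MH" "p = proj_seq A"
        using p by (auto simp: PMH_def)
      have AM: "A \<in> MM"
        using A(1) by (simp add: MH_def)
      have "ext_seq k A \<in> chom (ext_power k) (ext_power k)"
        unfolding ext_seq_eq[OF AM k(2,3)] by (rule ext_word_chom[OF block_map_chom[OF AM]])
      then show ?thesis
        unfolding A(2) lambda_bar_eq[OF A(1) k(1)] using ext_seq_nonzero[OF A(1) k(2,3)]
        by (simp add: proj_space_def)
    qed
    moreover have "openin ?X {p \<in> PMH. lambda_bar p k \<in> W}"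
      if "openin (proj_topology (chom (ext_power k) (ext_power k))) W" for W
      using openin_lambda_bar_vimage[OF k(1) that] op by (simp add: openin_open_subtopology)
    ultimately show "continuous_map ?X (proj_topology (chom (ext_power k) (ext_power k))) (\<lambda>p.
        lambda_bar p k)"
      unfolding continuous_map_def top topspace_proj_topology Pi_iff by blast
  qed
qed

end
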